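(* Let $\mathcal{F}=\ast_{\alpha\in I}G_\alpha$ be the free product of torsion free groups $G_\alpha$, $\alpha\in I$. Let $k,\ell\ge 0$ and $m\ge 1$ be integers, and suppose that $$c_1\cdots c_k\,d_1\cdots d_\ell=h_1\cdots h_m$$ in $\mathcal{F}$, where $c_1,\dots,c_k,d_1,\dots,d_\ell,h_1,\dots,h_m$ are elements of $\mathcal{F}$ such that each $c_i$ is a commutator, each $d_i$ is conjugate in $\mathcal{F}$ to an element of some free factor $G_\alpha$, and $h_1,\dots,h_m$ are conjugate to each other in $\mathcal{F}$ and are not conjugate to elements of free factors $G_\alpha$ of $\mathcal{F}$. Then no element occurs in the sequence $h_1,\dots,h_m$ more than $2k+\ell-1$ times.
   Context: A commutator is an element of the form $[x,y]=x^{-1}y^{-1}xy$. Empty products are equal to $1$. *)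

theory Defs
  imports "HOL-Algebra.Algebra"
begin

text \<open>
  The free product of a family of groups is realised by its normal forms: finite sequences of
  syllables, each a nontrivial element of a factor tagged by the index of that factor,
  with consecutive syllables coming from different factors.  Since syllables carry their index, the
  carriers of the factors need not be disjoint.
\<close>

definition reduced_words :: "'i set \<Rightarrow> ('i \<Rightarrow> ('a, 'b) monoid_scheme) \<Rightarrow> ('i \<times> 'a) list set"
  where "reduced_words I G =
    {w. (\<forall>(\<alpha>, g)\<in>set w. \<alpha> \<in> I \<and> g \<in> carrier (G \<alpha>) \<and> g \<noteq> \<one>\<^bsub>G \<alpha>\<^esub>) \<and>
        successively (\<lambda>s t. fst s \<noteq> fst t) w}"

fun syllable_mult :: "('i \<Rightarrow> ('a, 'b) monoid_scheme) \<Rightarrow> 'i \<times> 'a \<Rightarrow> ('i \<times> 'a) list \<Rightarrow> ('i \<times> 'a) list"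
  where
    "syllable_mult G (\<alpha>, g) [] = (if g = \<one>\<^bsub>G \<alpha>\<^esub> then [] else [(\<alpha>, g)])"
  | "syllable_mult G (\<alpha>, g) ((\<beta>, h) # w) =
      (if g = \<one>\<^bsub>G \<alpha>\<^esub> then (\<beta>, h) # w
       else if \<alpha> \<noteq> \<beta> then (\<alpha>, g) # (\<beta>, h) # w
       else if g \<otimes>\<^bsub>G \<alpha>\<^esub> h = \<one>\<^bsub>G \<alpha>\<^esub> then w
       else (\<alpha>, g \<otimes>\<^bsub>G \<alpha>\<^esub> h) # w)"

definition free_product :: "'i set \<Rightarrow> ('i \<Rightarrow> ('a, 'b) monoid_scheme) \<Rightarrow> ('i \<times> 'a) list monoid"
  where "free_product I G =
    \<lparr>carrier = reduced_words I G, monoid.mult = foldr (syllable_mult G), one = []\<rparr>"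

definition factor_embedding :: "('i \<Rightarrow> ('a, 'b) monoid_scheme) \<Rightarrow> 'i \<Rightarrow> 'a \<Rightarrow> ('i \<times> 'a) list"
  where "factor_embedding G \<alpha> g = (if g = \<one>\<^bsub>G \<alpha>\<^esub> then [] else [(\<alpha>, g)])"

definition free_factor :: "('i \<Rightarrow> ('a, 'b) monoid_scheme) \<Rightarrow> 'i \<Rightarrow> ('i \<times> 'a) list set"
  where "free_factor G \<alpha> = factor_embedding G \<alpha> ` carrier (G \<alpha>)"

definition torsion_free_group :: "('a, 'b) monoid_scheme \<Rightarrow> bool"
  where "torsion_free_group G \<longleftrightarrow>
    group G \<and> (\<forall>x\<in>carrier G. \<forall>n::nat. n > 0 \<and> x [^]\<^bsub>G\<^esub> n = \<one>\<^bsub>G\<^esub> \<longrightarrow> x = \<one>\<^bsub>G\<^esub>)"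

definition is_commutator :: "('a, 'b) monoid_scheme \<Rightarrow> 'a \<Rightarrow> bool"
  where "is_commutator G c \<longleftrightarrow>
    (\<exists>x\<in>carrier G. \<exists>y\<in>carrier G. c = inv\<^bsub>G\<^esub> x \<otimes>\<^bsub>G\<^esub> inv\<^bsub>G\<^esub> y \<otimes>\<^bsub>G\<^esub> x \<otimes>\<^bsub>G\<^esub> y)"

definition conjugate_in :: "('a, 'b) monoid_scheme \<Rightarrow> 'a \<Rightarrow> 'a \<Rightarrow> bool"
  where "conjugate_in G x y \<longleftrightarrow> (\<exists>z\<in>carrier G. y = inv\<^bsub>G\<^esub> z \<otimes>\<^bsub>G\<^esub> x \<otimes>\<^bsub>G\<^esub> z)"

definition group_product :: "('a, 'b) monoid_scheme \<Rightarrow> 'a list \<Rightarrow> 'a"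
  where "group_product G xs = foldr (\<otimes>\<^bsub>G\<^esub>) xs \<one>\<^bsub>G\<^esub>"

definition conjugate_into_factor ::
    "'i set \<Rightarrow> ('i \<Rightarrow> ('a, 'b) monoid_scheme) \<Rightarrow> ('i \<times> 'a) list \<Rightarrow> bool"
  where "conjugate_into_factor I G x \<longleftrightarrow>
    (\<exists>\<alpha>\<in>I. \<exists>g\<in>free_factor G \<alpha>. conjugate_in (free_product I G) x g)"

lemma free_product_simps [simp]:
  "carrier (free_product I G) = reduced_words I G"
  "monoid.mult (free_product I G) = foldr (syllable_mult G)"
  "monoid.one (free_product I G) = []"
  by (simp_all add: free_product_def)

lemma reduced_words_Nil [simp]: "[] \<in> reduced_words I G"
  by (simp add: reduced_words_def)

lemma reduced_words_Cons:
  "(\<alpha>, g) # w \<in> reduced_words I G \<longleftrightarrow>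
    \<alpha> \<in> I \<and> g \<in> carrier (G \<alpha>) \<and> g \<noteq> \<one>\<^bsub>G \<alpha>\<^esub> \<and> w \<in> reduced_words I G \<and>
    (w \<noteq> [] \<longrightarrow> fst (hd w) \<noteq> \<alpha>)"
  by (cases w) (auto simp: reduced_words_def)

lemma syllable_mult_one [simp]: "syllable_mult G (\<alpha>, \<one>\<^bsub>G \<alpha>\<^esub>) w = w"
  by (cases "(G, (\<alpha>, \<one>\<^bsub>G \<alpha>\<^esub>), w)" rule: syllable_mult.cases) auto

lemma syllable_mult_reduced:
  assumes "(\<alpha>, g) # w \<in> reduced_words I G"
  shows "syllable_mult G (\<alpha>, g) w = (\<alpha>, g) # w"
  using assms by (cases w) (auto simp: reduced_words_Cons)

locale group_family =
  fixes I :: "'i set" and G :: "'i \<Rightarrow> ('a, 'b) monoid_scheme"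
  assumes group_G: "\<alpha> \<in> I \<Longrightarrow> group (G \<alpha>)"
begin

lemma syllable_mult_closed:
  assumes "\<alpha> \<in> I" "g \<in> carrier (G \<alpha>)" "w \<in> reduced_words I G"
  shows "syllable_mult G (\<alpha>, g) w \<in> reduced_words I G"
proof -
  interpret group "G \<alpha>" by (rule group_G) fact
  show ?thesis
    using assms by (cases w) (auto simp: reduced_words_Cons)
qed

lemma syllable_mult_mult:
  assumes "\<alpha> \<in> I" "a \<in> carrier (G \<alpha>)" "b \<in> carrier (G \<alpha>)" "w \<in> reduced_words I G"
  shows "syllable_mult G (\<alpha>, a) (syllable_mult G (\<alpha>, b) w) =
         syllable_mult G (\<alpha>, a \<otimes>\<^bsub>G \<alpha>\<^esub> b) w"
proof -
  interpret group "G \<alpha>" by (rule group_G) fact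
  show ?thesis
  proof (cases "a = \<one>\<^bsub>G \<alpha>\<^esub> \<or> b = \<one>\<^bsub>G \<alpha>\<^esub>")
    case True
    then show ?thesis using assms by auto
  next
    case nontriv: False
    show ?thesis
    proof (cases "w \<noteq> [] \<and> fst (hd w) = \<alpha>")
      case False
      then have "(\<alpha>, b) # w \<in> reduced_words I G"
        using assms nontriv by (auto simp: reduced_words_Cons)
      then have "syllable_mult G (\<alpha>, b) w = (\<alpha>, b) # w"
        by (rule syllable_mult_reduced)
      moreover have "syllable_mult G (\<alpha>, a \<otimes>\<^bsub>G \<alpha>\<^esub> b) w =
          (if a \<otimes>\<^bsub>G \<alpha>\<^esub> b = \<one>\<^bsub>G \<alpha>\<^esub> then w else (\<alpha>, a \<otimes>\<^bsub>G \<alpha>\<^esub> b) # w)"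
        using False by (cases w) auto
      ultimately show ?thesis using nontriv by simp
    next
      case True
      then obtain h v where w: "w = (\<alpha>, h) # v" by (cases w) auto
      have h: "h \<in> carrier (G \<alpha>)" "h \<noteq> \<one>\<^bsub>G \<alpha>\<^esub>" and v: "v \<in> reduced_words I G"
        and hd: "v \<noteq> [] \<longrightarrow> fst (hd v) \<noteq> \<alpha>"
        using assms(4) by (auto simp: w reduced_words_Cons)
      have tail: "syllable_mult G (\<alpha>, c) v = (if c = \<one>\<^bsub>G \<alpha>\<^esub> then v else (\<alpha>, c) # v)" for c
        using hd by (cases v) auto
      have step: "syllable_mult G (\<alpha>, c) w = syllable_mult G (\<alpha>, c \<otimes>\<^bsub>G \<alpha>\<^esub> h) v"
        if "c \<in> carrier (G \<alpha>)" for c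
        using that h by (simp add: w tail)
      show ?thesis
      proof (cases "b \<otimes>\<^bsub>G \<alpha>\<^esub> h = \<one>\<^bsub>G \<alpha>\<^esub>")
        case True
        then have "a \<otimes>\<^bsub>G \<alpha>\<^esub> b \<otimes>\<^bsub>G \<alpha>\<^esub> h = a"
          using assms h by (simp add: m_assoc)
        then show ?thesis using assms True by (simp add: step)
      next
        case False
        then have "syllable_mult G (\<alpha>, b) w = (\<alpha>, b \<otimes>\<^bsub>G \<alpha>\<^esub> h) # v"
          using assms by (simp add: step tail)
        then show ?thesis
          using assms h nontriv by (simp add: step tail m_assoc)
      qed
    qed
  qed
qed

lemma foldr_syllable_mult_closed:
  assumes "u \<in> reduced_words I G" "v \<in> reduced_words I G"
  shows "foldr (syllable_mult G) u v \<in> reduced_words I G"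
  using assms
proof (induction u)
  case (Cons s u)
  then show ?case
    by (cases s) (auto simp: reduced_words_Cons intro: syllable_mult_closed)
qed simp

lemma foldr_syllable_mult_syllable:
  assumes "\<alpha> \<in> I" "a \<in> carrier (G \<alpha>)" "v \<in> reduced_words I G" "w \<in> reduced_words I G"
  shows "foldr (syllable_mult G) (syllable_mult G (\<alpha>, a) v) w =
         syllable_mult G (\<alpha>, a) (foldr (syllable_mult G) v w)"
proof (cases v)
  case Nil
  then show ?thesis by auto
next
  case (Cons s u)
  interpret group "G \<alpha>" by (rule group_G) fact
  obtain \<beta> h where s: "s = (\<beta>, h)" by (cases s)
  have u: "u \<in> reduced_words I G" and h: "h \<in> carrier (G \<beta>)"
    using assms(3) by (auto simp: Cons s reduced_words_Cons)
  have uw: "foldr (syllable_mult G) u w \<in> reduced_words I G"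
    by (rule foldr_syllable_mult_closed) fact+
  show ?thesis
    using assms h uw by (auto simp: Cons s syllable_mult_mult)
qed

lemma foldr_syllable_mult_assoc:
  assumes "u \<in> reduced_words I G" "v \<in> reduced_words I G" "w \<in> reduced_words I G"
  shows "foldr (syllable_mult G) (foldr (syllable_mult G) u v) w =
         foldr (syllable_mult G) u (foldr (syllable_mult G) v w)"
  using assms
proof (induction u)
  case (Cons s u)
  then show ?case
    by (cases s)
       (auto simp: reduced_words_Cons foldr_syllable_mult_syllable foldr_syllable_mult_closed)
qed simp

lemma foldr_syllable_mult_Nil:
  assumes "u \<in> reduced_words I G"
  shows "foldr (syllable_mult G) u [] = u"
  using assms
proof (induction u)
  case (Cons s u)
  then show ?case
    by (cases s) (auto simp: syllable_mult_reduced reduced_words_Cons)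
qed simp

lemma free_product_l_inv:
  assumes "u \<in> reduced_words I G"
  shows "\<exists>v\<in>reduced_words I G. foldr (syllable_mult G) v u = []"
  using assms
proof (induction u)
  case Nil
  show ?case by (auto intro: bexI[of _ "[]"])
next
  case (Cons s u)
  obtain \<alpha> g where s: "s = (\<alpha>, g)" by (cases s)
  have \<alpha>: "\<alpha> \<in> I" and g: "g \<in> carrier (G \<alpha>)" "g \<noteq> \<one>\<^bsub>G \<alpha>\<^esub>" and u: "u \<in> reduced_words I G"
    using Cons.prems by (auto simp: s reduced_words_Cons)
  interpret group "G \<alpha>" by (rule group_G) fact
  obtain v where v: "v \<in> reduced_words I G" "foldr (syllable_mult G) v u = []"
    using Cons.IH u by blast
  let ?t = "[(\<alpha>, inv\<^bsub>G \<alpha>\<^esub> g)]"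
  have t: "?t \<in> reduced_words I G"
    using \<alpha> g by (auto simp: reduced_words_Cons)
  have "foldr (syllable_mult G) (foldr (syllable_mult G) v ?t) (s # u) = []"
    using Cons.prems v t g by (simp add: foldr_syllable_mult_assoc s)
  then show ?case
    using foldr_syllable_mult_closed[OF v(1) t] by blast
qed

theorem group_free_product: "group (free_product I G)"
  by (rule groupI)
     (auto simp: foldr_syllable_mult_closed foldr_syllable_mult_assoc free_product_l_inv)

lemma factor_embedding_hom:
  assumes "\<alpha> \<in> I"
  shows "factor_embedding G \<alpha> \<in> hom (G \<alpha>) (free_product I G)"
proof -
  interpret group "G \<alpha>" by (rule group_G) fact
  show ?thesis
    using assms by (auto simp: hom_def factor_embedding_def reduced_words_Cons)
qed

lemma inj_factor_embedding: "inj_on (factor_embedding G \<alpha>) (carrier (G \<alpha>))"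
  by (auto simp: inj_on_def factor_embedding_def split: if_splits)

theorem free_product_universal:
  assumes "group H" and \<phi>: "\<And>\<alpha>. \<alpha> \<in> I \<Longrightarrow> \<phi> \<alpha> \<in> hom (G \<alpha>) H"
  shows "\<exists>f\<in>hom (free_product I G) H. \<forall>\<alpha>\<in>I. \<forall>g\<in>carrier (G \<alpha>). f (factor_embedding G \<alpha> g) = \<phi> \<alpha> g"
    and "\<lbrakk>f \<in> hom (free_product I G) H; f' \<in> hom (free_product I G) H;
          \<And>\<alpha> g. \<lbrakk>\<alpha> \<in> I; g \<in> carrier (G \<alpha>)\<rbrakk> \<Longrightarrow>
            f (factor_embedding G \<alpha> g) = f' (factor_embedding G \<alpha> g);
          w \<in> carrier (free_product I G)\<rbrakk> \<Longrightarrow> f w = f' w"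
proof -
  interpret H: group H by fact
  have \<phi>_closed: "\<phi> \<alpha> g \<in> carrier H" if "\<alpha> \<in> I" "g \<in> carrier (G \<alpha>)" for \<alpha> g
    using \<phi> that by (auto simp: hom_def)
  have \<phi>_mult: "\<phi> \<alpha> (g \<otimes>\<^bsub>G \<alpha>\<^esub> h) = \<phi> \<alpha> g \<otimes>\<^bsub>H\<^esub> \<phi> \<alpha> h"
    if "\<alpha> \<in> I" "g \<in> carrier (G \<alpha>)" "h \<in> carrier (G \<alpha>)" for \<alpha> g h
    using \<phi> that by (auto simp: hom_def)
  have \<phi>_one: "\<phi> \<alpha> \<one>\<^bsub>G \<alpha>\<^esub> = \<one>\<^bsub>H\<^esub>" if "\<alpha> \<in> I" for \<alpha>
    using hom_one[OF \<phi>[OF that] group_G[OF that] H.is_group] .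
  define e where "e w = foldr (\<lambda>(\<alpha>, g) x. \<phi> \<alpha> g \<otimes>\<^bsub>H\<^esub> x) w \<one>\<^bsub>H\<^esub>" for w
  have e_Nil: "e [] = \<one>\<^bsub>H\<^esub>" and e_Cons: "e ((\<alpha>, g) # w) = \<phi> \<alpha> g \<otimes>\<^bsub>H\<^esub> e w" for \<alpha> g w
    by (simp_all add: e_def)
  have e_closed: "e w \<in> carrier H" if "w \<in> reduced_words I G" for w
    using that
  proof (induction w)
    case (Cons s w)
    then show ?case by (cases s) (auto simp: e_Cons reduced_words_Cons \<phi>_closed)
  qed (simp add: e_Nil)
  have e_syl: "e (syllable_mult G (\<alpha>, g) w) = \<phi> \<alpha> g \<otimes>\<^bsub>H\<^esub> e w"
    if "\<alpha> \<in> I" "g \<in> carrier (G \<alpha>)" "w \<in> reduced_words I G" for \<alpha> g w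
  proof (cases w)
    case Nil
    then show ?thesis using that by (auto simp: e_Nil e_Cons \<phi>_one)
  next
    case (Cons s v)
    obtain \<beta> h where s: "s = (\<beta>, h)" by (cases s)
    have v: "v \<in> reduced_words I G" and \<beta>: "\<beta> \<in> I" "h \<in> carrier (G \<beta>)"
      using that(3) by (auto simp: Cons s reduced_words_Cons)
    have cl: "\<phi> \<alpha> g \<in> carrier H" "\<phi> \<beta> h \<in> carrier H" "e v \<in> carrier H"
      using that v \<beta> by (auto simp: \<phi>_closed e_closed)
    show ?thesis
    proof (cases "g = \<one>\<^bsub>G \<alpha>\<^esub> \<or> \<alpha> \<noteq> \<beta>")
      case True
      then show ?thesis using that cl by (auto simp: Cons s e_Cons \<phi>_one)
    next
      case False
      then have eq: "\<phi> \<alpha> (g \<otimes>\<^bsub>G \<alpha>\<^esub> h) = \<phi> \<alpha> g \<otimes>\<^bsub>H\<^esub> \<phi> \<beta> h"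
        using \<phi>_mult that \<beta> by simp
      have "\<phi> \<alpha> g \<otimes>\<^bsub>H\<^esub> e w = \<phi> \<alpha> (g \<otimes>\<^bsub>G \<alpha>\<^esub> h) \<otimes>\<^bsub>H\<^esub> e v"
        using cl by (simp add: Cons s e_Cons eq H.m_assoc)
      moreover have "e (syllable_mult G (\<alpha>, g) w) = \<phi> \<alpha> (g \<otimes>\<^bsub>G \<alpha>\<^esub> h) \<otimes>\<^bsub>H\<^esub> e v"
        using False \<phi>_one[OF that(1)] cl by (auto simp: Cons s e_Cons)
      ultimately show ?thesis by simp
    qed
  qed
  have e_mult: "e (foldr (syllable_mult G) u w) = e u \<otimes>\<^bsub>H\<^esub> e w"
    if "u \<in> reduced_words I G" "w \<in> reduced_words I G" for u w
    using that
  proof (induction u)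
    case (Cons s u)
    then show ?case
      by (cases s)
         (auto simp: e_Cons e_syl reduced_words_Cons foldr_syllable_mult_closed \<phi>_closed e_closed
            H.m_assoc)
  qed (simp add: e_Nil e_closed)
  have "e \<in> hom (free_product I G) H"
    by (auto simp: hom_def e_closed e_mult)
  moreover have "e (factor_embedding G \<alpha> g) = \<phi> \<alpha> g" if "\<alpha> \<in> I" "g \<in> carrier (G \<alpha>)" for \<alpha> g
    using that by (auto simp: factor_embedding_def e_Nil e_Cons \<phi>_one \<phi>_closed)
  ultimately show "\<exists>f\<in>hom (free_product I G) H.
      \<forall>\<alpha>\<in>I. \<forall>g\<in>carrier (G \<alpha>). f (factor_embedding G \<alpha> g) = \<phi> \<alpha> g"
    by blast
  show "f w = f' w"
    if f: "f \<in> hom (free_product I G) H" and f': "f' \<in> hom (free_product I G) H"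
      and eq: "\<And>\<alpha> g. \<lbrakk>\<alpha> \<in> I; g \<in> carrier (G \<alpha>)\<rbrakk> \<Longrightarrow>
        f (factor_embedding G \<alpha> g) = f' (factor_embedding G \<alpha> g)"
      and w: "w \<in> carrier (free_product I G)"
  proof -
    have "w \<in> reduced_words I G" using w by simp
    then show ?thesis
    proof (induction w)
      case Nil
      then show ?case
        using hom_one[OF f group_free_product H.is_group] hom_one[OF f' group_free_product H.is_group]
        by simp
    next
      case (Cons s w)
      obtain \<alpha> g where s: "s = (\<alpha>, g)" by (cases s)
      have \<alpha>: "\<alpha> \<in> I" "g \<in> carrier (G \<alpha>)" "g \<noteq> \<one>\<^bsub>G \<alpha>\<^esub>" and w: "w \<in> reduced_words I G"
        using Cons.prems by (auto simp: s reduced_words_Cons)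
      have "[(\<alpha>, g)] \<otimes>\<^bsub>free_product I G\<^esub> w = s # w"
        using Cons.prems by (simp add: s syllable_mult_reduced)
      moreover have "[(\<alpha>, g)] \<in> carrier (free_product I G)" "w \<in> carrier (free_product I G)"
        using \<alpha> w by (auto simp: reduced_words_Cons)
      moreover have "f [(\<alpha>, g)] = f' [(\<alpha>, g)]"
        using eq[OF \<alpha>(1,2)] \<alpha>(3) by (simp add: factor_embedding_def)
      ultimately show ?case
        using hom_mult[OF f, of "[(\<alpha>, g)]" w] hom_mult[OF f', of "[(\<alpha>, g)]" w] Cons.IH w
        by simp
    qed
  qed
qed

end

end

theory Submission
  imports Defs
begin

text \<open>
  Write the common conjugacy class of the \<open>h\<^sub>i\<close> as that of a cyclically reduced word
  \<open>g\<^sub>1 \<dots> g\<^sub>L\<close>, \<open>L \<ge> 2\<close>.  The equation describes a map from a compact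
  surface \<open>\<Sigma>\<close> into a wedge of classifying spaces; conjugating the copies of \<open>h\<^sub>i\<close> different from a
  given one off to separate boundary components, \<open>\<Sigma>\<close> has boundary components reading the powers
  \<open>g\<^sup>n, g, \<dots>, g\<close>, and the claim becomes \<open>- \<chi>(\<Sigma>) \<ge> m\<close>, where every \<open>d\<^sub>j\<close> counts as a puncture.

  Cutting \<open>\<Sigma>\<close> along the preimage of the wedge point decomposes it into pieces mapped into a factor and
  pieces mapped to the wedge point, which are separated by arcs running from the end of one boundary
  letter to the beginning of another.  Only discs contribute positively to the Euler characteristic.
  Give the letter \<open>g\<^sub>i\<close> the level \<open>i\<close> and let an arc from level \<open>i\<close> to level \<open>j\<close> be ascending if
  \<open>i < j\<close>.  As the factors are torsion free, a disc mapped to a factor cannot have letters of one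
  level only, so it has an ascending arc; a central disc cannot have one level only either, because
  consecutive letters lie in different factors.  Each arc pays for at most one disc, and the \<open>m\<close> arcs
  leaving a last letter \<open>g\<^sub>L\<close> pay for none.

  The surface is encoded by permutations of its letters with labels in the group: the boundary
  permutation is a product of labelled transpositions inside the factors (pieces over the factors)
  followed by transpositions without labels (central pieces).  The Euler characteristic is the number
  of transpositions, and the discs are the cycles with trivial label.
\<close>

section \<open>Paths with labels in a group\<close>

text \<open>The constant \<open>2k + l - 1\<close> is a count of surgeries. The relation, written as
  one word \<open>h_1 ... h_m d_l^-1 ... c_1^-1\<close> of trivial value, bounds a disc, where minus
  the Euler characteristic is \<open>-1\<close>. Erasing a commutator from the boundary costs 2,
  erasing a conjugate of a factor element costs 1, and cutting off a copy of \<open>h_i\<close> that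
  differs from the given element costs 1. If n copies equal the given element, then
  \<open>- 1 + 2k + l + (m - n)\<close> has to be at least \<open>m\<close>, and \<open>m\<close>
  disappears.

  Surgery only ever appends transpositions, so a letter erased from the boundary cannot be deleted
  from the permutations. It stays behind as a fixed point of the boundary permutation with trivial
  label; therefore the counting theorems carry a set \<open>S\<close> of the letters still on the
  boundary, and closed curves of erased letters have to be controlled. Labels lie in a
  noncommutative group and only their holonomy matters, so components with trivial holonomy take the
  place of the components in the usual genus inequality.\<close>

inductive lpath :: "('p \<times> 'g::group_add \<times> 'p) set \<Rightarrow> 'p \<Rightarrow> 'g \<Rightarrow> 'p \<Rightarrow> bool" for E where
  lpath_refl: "lpath E p 0 p"
| lpath_fwd: "lpath E p y q \<Longrightarrow> (q, z, r) \<in> E \<Longrightarrow> lpath E p (y + z) r"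
| lpath_bwd: "lpath E p y q \<Longrightarrow> (r, z, q) \<in> E \<Longrightarrow> lpath E p (y - z) r"

lemma lpath_edge: "(p, y, q) \<in> E \<Longrightarrow> lpath E p y q"
  using lpath_fwd[OF lpath_refl] by fastforce

lemma lpath_edge_rev: "(p, y, q) \<in> E \<Longrightarrow> lpath E q (- y) p"
  using lpath_bwd[OF lpath_refl] by fastforce

lemma lpath_trans:
  assumes "lpath E p y q" "lpath E q z r"
  shows "lpath E p (y + z) r"
  using assms(2,1)
proof (induction rule: lpath.induct)
  case lpath_refl
  then show ?case by simp
next
  case (lpath_fwd q z r w s)
  then show ?case by (metis add.assoc lpath.lpath_fwd)
next
  case (lpath_bwd q z r s w)
  then show ?case by (metis add_diff_eq lpath.lpath_bwd)
qed

lemma lpath_sym: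
  assumes "lpath E p y q"
  shows "lpath E q (- y) p"
  using assms
proof (induction rule: lpath.induct)
  case (lpath_refl p)
  then show ?case using lpath.lpath_refl by simp
next
  case (lpath_fwd p y q z r)
  show ?case
    using lpath_trans[OF lpath_edge_rev[OF lpath_fwd(2)] lpath_fwd(3)] by (simp add: minus_add)
next
  case (lpath_bwd p y q r z)
  show ?case
    using lpath_trans[OF lpath_edge[OF lpath_bwd(2)] lpath_bwd(3)] by (simp flip: diff_conv_add_uminus)
qed

lemma lpath_subsume:
  assumes "lpath E p y q" "\<And>a w b. (a, w, b) \<in> E \<Longrightarrow> lpath E' a w b"
  shows "lpath E' p y q"
  using assms(1)
proof (induction rule: lpath.induct)
  case (lpath_refl p)
  then show ?case by (rule lpath.lpath_refl)
next
  case (lpath_fwd p y q z r)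
  show ?case using lpath_trans[OF lpath_fwd(3) assms(2)[OF lpath_fwd(2)]] .
next
  case (lpath_bwd p y q r z)
  show ?case using lpath_trans[OF lpath_bwd(3) lpath_sym[OF assms(2)[OF lpath_bwd(2)]]] by simp
qed

lemma lpath_mono: "lpath E p y q \<Longrightarrow> E \<subseteq> E' \<Longrightarrow> lpath E' p y q"
  by (erule lpath_subsume) (auto intro: lpath_edge)

text \<open>
  Components on which the labels have trivial holonomy, that is, are differences of a potential.
\<close>

definition balanced :: "('p \<times> 'g::group_add \<times> 'p) set \<Rightarrow> 'p \<Rightarrow> bool"
  where "balanced E p \<longleftrightarrow> (\<forall>y. lpath E p y p \<longrightarrow> y = 0)"

definition lcomp :: "('p \<times> 'g::group_add \<times> 'p) set \<Rightarrow> 'p \<Rightarrow> 'p set"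
  where "lcomp E p = {q. \<exists>y. lpath E p y q}"

text \<open>For finite \<open>V\<close> containing all ends of edges,
  \<open>card V - num_balanced E V\<close> is the rank of \<open>E\<close> in the frame matroid of a
  gain graph. For trivial labels the number is that of the components meeting
  \<open>V\<close>.\<close>

definition num_balanced :: "('p \<times> 'g::group_add \<times> 'p) set \<Rightarrow> 'p set \<Rightarrow> nat"
  where "num_balanced E V = card (lcomp E ` {p \<in> V. balanced E p})"

lemma balancedD: "balanced E p \<Longrightarrow> lpath E p y p \<Longrightarrow> y = 0"
  by (auto simp: balanced_def)

lemma lcomp_refl: "p \<in> lcomp E p"
  using lpath_refl[of E p] by (auto simp: lcomp_def)

lemma lcomp_eq_iff: "lcomp E p = lcomp E q \<longleftrightarrow> (\<exists>y. lpath E p y q)"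
proof
  assume "lcomp E p = lcomp E q"
  then show "\<exists>y. lpath E p y q" using lcomp_refl[of q E] by (auto simp: lcomp_def)
next
  assume "\<exists>y. lpath E p y q"
  then obtain y where y: "lpath E p y q" by blast
  show "lcomp E p = lcomp E q"
    using lpath_trans[OF y] lpath_trans[OF lpath_sym[OF y]] by (fastforce simp: lcomp_def)
qed

lemma lcomp_eqI: "lpath E p y q \<Longrightarrow> lcomp E p = lcomp E q"
  using lcomp_eq_iff[of E p q] by blast

lemma balanced_unique:
  assumes "balanced E p" "lpath E p y q" "lpath E p z q"
  shows "y = z"
  using balancedD[OF assms(1) lpath_trans[OF assms(2) lpath_sym[OF assms(3)]]] by simp

lemma balanced_conn:
  assumes "lpath E p y q" "balanced E p"
  shows "balanced E q"
  unfolding balanced_def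
proof (intro allI impI)
  fix w assume "lpath E q w q"
  then have "lpath E p (y + w) q"
    by (rule lpath_trans[OF assms(1)])
  then have "y + w = y" using balanced_unique[OF assms(2)] assms(1) by blast
  then show "w = 0" by (metis add.right_neutral add_left_cancel)
qed

lemma balanced_subsume:
  assumes "balanced E' p" "\<And>a w b. (a, w, b) \<in> E \<Longrightarrow> lpath E' a w b"
  shows "balanced E p"
  using assms lpath_subsume unfolding balanced_def by meson

lemma num_balanced_cong:
  assumes "\<And>p y q. lpath E p y q \<longleftrightarrow> lpath E' p y q"
  shows "num_balanced E V = num_balanced E' V"
  using assms by (simp add: num_balanced_def balanced_def lcomp_def)

text \<open>Only the components of \<open>a\<close> and \<open>b\<close> are affected. A balanced
  one is lost if two components merge and at least one is balanced, or if the new label contradicts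
  that of an existing path in a balanced component.\<close>

lemma num_balanced_insert:
  assumes fin: "finite V" and ab: "a \<in> V" "b \<in> V"
  shows "num_balanced E V = num_balanced (insert (a, y, b) E) V +
    (if lpath E a y b \<or> \<not> balanced E a \<and> \<not> balanced E b then 0 else 1)"
proof (cases "lpath E a y b")
  case True
  have "lpath (insert (a, y, b) E) p w q \<longleftrightarrow> lpath E p w q" for p w q
  proof
    assume "lpath (insert (a, y, b) E) p w q"
    then show "lpath E p w q"
      by (rule lpath_subsume) (use True in \<open>auto intro: lpath_edge\<close>)
  qed (erule lpath_mono, blast)
  then have "num_balanced (insert (a, y, b) E) V = num_balanced E V" by (rule num_balanced_cong)
  then show ?thesis using True by simp
next
  case nab: False
  define E' where "E' = insert (a, y, b) E"
  have sub: "lpath E p w q \<Longrightarrow> lpath E' p w q" for p w q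
    by (rule lpath_mono) (auto simp: E'_def)
  have e': "lpath E' a y b" by (rule lpath_edge) (simp add: E'_def)
  have balmono: "balanced E' p \<Longrightarrow> balanced E p" for p
    using sub by (auto simp: balanced_def)
  \<comment> \<open>The points away from \<open>a\<close> and \<open>b\<close>: their components and
    holonomies agree in both graphs and contribute the same \<open>B\<close> to both counts.\<close>
  define U where "U = {p \<in> V. (\<forall>w. \<not> lpath E p w a) \<and> (\<forall>w. \<not> lpath E p w b)}"
  have U_same: "lpath E' p w q \<longleftrightarrow> lpath E p w q" if "p \<in> U" for p w q
  proof
    assume "lpath E' p w q"
    then show "lpath E p w q" using that
    proof (induction rule: lpath.induct)
      case (lpath_refl p)
      then show ?case by (simp add: lpath.lpath_refl)
    next
      case (lpath_fwd p y q z r)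
      then show ?case using lpath.lpath_fwd by (force simp: E'_def U_def)
    next
      case (lpath_bwd p y q r z)
      then show ?case using lpath.lpath_bwd by (force simp: E'_def U_def)
    qed
  qed (rule sub)
  define B where "B = lcomp E ` {p \<in> U. balanced E p}"
  have B': "B = lcomp E' ` {p \<in> U. balanced E' p}"
    using U_same by (auto simp: B_def balanced_def lcomp_def image_iff)
  define S where "S = lcomp E ` {p \<in> {a, b}. balanced E p}"
  define S' where "S' = lcomp E' ` {p \<in> {a}. balanced E' p}"
  have finB: "finite B" unfolding B_def U_def using fin by auto
  have "lcomp E ` {p \<in> V. balanced E p} = B \<union> S"
  proof (intro equalityI subsetI)
    fix c assume "c \<in> lcomp E ` {p \<in> V. balanced E p}"
    then obtain p where p: "p \<in> V" "balanced E p" "c = lcomp E p" by auto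
    show "c \<in> B \<union> S"
    proof (cases "p \<in> U")
      case False
      then obtain w where "lpath E p w a \<or> lpath E p w b" using p by (auto simp: U_def)
      then show ?thesis
        using p balanced_conn[of E p w] lcomp_eq_iff[of E p] unfolding S_def by blast
    qed (use p in \<open>auto simp: B_def\<close>)
  next
    fix c assume "c \<in> B \<union> S"
    then show "c \<in> lcomp E ` {p \<in> V. balanced E p}"
      using ab by (auto simp: B_def S_def U_def)
  qed
  moreover have "B \<inter> S = {}"
    using lcomp_eq_iff[of E] by (auto simp: B_def S_def U_def)
  ultimately have nE: "num_balanced E V = card B + card S"
    using finB by (simp add: num_balanced_def card_Un_disjoint S_def)
  have "lcomp E' ` {p \<in> V. balanced E' p} = B \<union> S'"
  proof (intro equalityI subsetI)
    fix c assume "c \<in> lcomp E' ` {p \<in> V. balanced E' p}"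
    then obtain p where p: "p \<in> V" "balanced E' p" "c = lcomp E' p" by auto
    show "c \<in> B \<union> S'"
    proof (cases "p \<in> U")
      case False
      then obtain w where "lpath E p w a \<or> lpath E p w b" using p by (auto simp: U_def)
      then have "\<exists>w. lpath E' p w a"
        using sub lpath_trans[OF _ lpath_sym[OF e']] by meson
      then show ?thesis
        using p balanced_conn[of E' p _ a] lcomp_eq_iff[of E' p a] unfolding S'_def by blast
    qed (use p B' in auto)
  next
    fix c assume "c \<in> B \<union> S'"
    then show "c \<in> lcomp E' ` {p \<in> V. balanced E' p}"
      using ab unfolding B' by (auto simp: S'_def U_def)
  qed
  moreover have "B \<inter> S' = {}"
  proof -
    have "lcomp E' p \<noteq> lcomp E' a" if "p \<in> U" for p
      using lcomp_eq_iff[of E' p a] U_same[OF that] that by (auto simp: U_def)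
    then show ?thesis unfolding B' S'_def by auto
  qed
  ultimately have nE': "num_balanced E' V = card B + card S'"
    using finB by (simp add: num_balanced_def card_Un_disjoint S'_def)
  have S: "S = (if balanced E a then {lcomp E a} else {}) \<union> (if balanced E b then {lcomp E b} else {})"
    by (auto simp: S_def)
  have S': "S' = (if balanced E' a then {lcomp E' a} else {})"
    by (auto simp: S'_def)
  have "card S = card S' + (if \<not> balanced E a \<and> \<not> balanced E b then 0 else 1)"
  proof (cases "\<exists>w. lpath E a w b")
    case True
    then obtain w where w: "lpath E a w b" by blast
    have ball: "balanced E a \<longleftrightarrow> balanced E b"
      using balanced_conn[OF w] balanced_conn[OF lpath_sym[OF w]] by blast
    \<comment> \<open>The old path and the new edge join the same points with different labels, so
      going out along one and back along the other has nontrivial holonomy.\<close>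
    have "lpath E' a (w - y) a"
      using lpath_trans[OF sub[OF w] lpath_sym[OF e']] by simp
    moreover have "w - y \<noteq> 0" using nab w by auto
    ultimately have "\<not> balanced E' a" using balancedD[of E' a] by blast
    moreover have "lcomp E a = lcomp E b" using w lcomp_eq_iff[of E a b] by blast
    ultimately show ?thesis using ball by (simp add: S S')
  next
    case False
    then have ne: "lcomp E a \<noteq> lcomp E b" using lcomp_eq_iff[of E a b] by blast
    consider "balanced E a" "balanced E b" | "\<not> balanced E a" | "\<not> balanced E b" by blast
    then show ?thesis
    proof cases
      case 1
      \<comment> \<open>A walk from \<open>a\<close> is, up to loops with trivial label, either a
        walk in the old component of \<open>a\<close> or one crossing of the new edge followed by a
        walk in that of \<open>b\<close>. Hence merging balanced components preserves
        balance.\<close>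
      have "lpath E a w q \<or> lpath E b (- y + w) q" if "lpath E' a w q" for w q
        using that
      proof (induction a\<equiv>a w q rule: lpath.induct)
        case lpath_refl
        then show ?case by (simp add: lpath.lpath_refl)
      next
        case (lpath_fwd w q z r)
        show ?case
        proof (cases "(q, z, r) \<in> E")
          case True
          then show ?thesis
            using lpath_fwd(2) lpath.lpath_fwd[of E a w q z r] lpath.lpath_fwd[of E b "- y + w" q z r]
            by (auto simp: add.assoc)
        next
          case F: False
          then have e: "q = a" "z = y" "r = b" using lpath_fwd(3) by (auto simp: E'_def)
          have "\<not> lpath E b (- y + w) a" using False lpath_sym[of E b _ a] by blast
          then have "lpath E a w a" using lpath_fwd(2) e by simp
          then have "w = 0" using 1 balancedD[of E a] by blast
          then show ?thesis using e lpath.lpath_refl[of E b] by simp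
        qed
      next
        case (lpath_bwd w q r z)
        show ?case
        proof (cases "(r, z, q) \<in> E")
          case True
          then show ?thesis
            using lpath_bwd(2) lpath.lpath_bwd[of E a w q r z] lpath.lpath_bwd[of E b "- y + w" q r z]
            by (auto simp: add_diff_eq)
        next
          case F: False
          then have e: "q = b" "z = y" "r = a" using lpath_bwd(3) by (auto simp: E'_def)
          have "\<not> lpath E a w b" using False by blast
          then have "lpath E b (- y + w) b" using lpath_bwd(2) e by simp
          then have "- y + w = 0" using 1 balancedD[of E b] by blast
          then have "w = y" by (metis add_minus_cancel add.right_neutral)
          then show ?thesis using e lpath.lpath_refl[of E a] by simp
        qed
      qed
      then have "balanced E' a"
        using False 1 lpath_sym[of E b _ a] unfolding balanced_def by blast
      then show ?thesis using 1 ne by (simp add: S S')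
    next
      case 2
      then have "\<not> balanced E' a" using balmono by blast
      then show ?thesis using 2 by (simp add: S S')
    next
      case 3
      then have "\<not> balanced E' b" using balmono by blast
      then have "\<not> balanced E' a" using balanced_conn[OF lpath_sym[OF e']] balanced_conn[OF e'] by blast
      then show ?thesis using 3 by (simp add: S S')
    qed
  qed
  then show ?thesis using nE nE' nab by (simp add: E'_def)
qed

section \<open>Products of labelled transpositions\<close>

definition pgraph :: "'p set \<Rightarrow> ('p \<Rightarrow> 'p) \<Rightarrow> ('p \<Rightarrow> 'g) \<Rightarrow> ('p \<times> 'g \<times> 'p) set"
  where "pgraph V \<pi> lab = (\<lambda>p. (p, lab p, \<pi> p)) ` V"

text \<open>
  \<open>lab p\<close> is the label of the step from \<open>p\<close> to \<open>\<pi> p\<close>.  The edges record the transpositions used, and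
  the case \<open>a = b\<close> of a mere change of label is allowed.
\<close>

inductive swap_product :: "'p set \<Rightarrow> ('p \<times> 'g::group_add \<times> 'p) set \<Rightarrow> ('p \<Rightarrow> 'p) \<Rightarrow> ('p \<Rightarrow> 'g) \<Rightarrow> nat \<Rightarrow> bool"
  for V where
  swap_product_id: "swap_product V {} id (\<lambda>_. 0) 0"
| swap_product_step: "swap_product V E \<pi> lab u \<Longrightarrow> a \<in> V \<Longrightarrow> b \<in> V \<Longrightarrow>
    swap_product V (insert (a, y, b) E) (\<pi> \<circ> transpose a b) (lab(a := y + lab b, b := - y + lab a)) (Suc u)"

lemma swap_product_mono: "swap_product V E \<pi> lab u \<Longrightarrow> V \<subseteq> V' \<Longrightarrow> swap_product V' E \<pi> lab u"
  by (induction rule: swap_product.induct) (auto intro: swap_product_id swap_product_step)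

lemma swap_product_permutes: "swap_product V E \<pi> lab u \<Longrightarrow> \<pi> permutes V"
proof (induction rule: swap_product.induct)
  case swap_product_id
  show ?case by (rule permutes_id)
next
  case (swap_product_step E \<pi> lab u a b y)
  then show ?case by (intro permutes_compose permutes_swap_id)
qed

lemma swap_product_lab_outside: "swap_product V E \<pi> lab u \<Longrightarrow> p \<notin> V \<Longrightarrow> lab p = 0"
  by (induction rule: swap_product.induct) auto

lemma swap_product_edges: "swap_product V E \<pi> lab u \<Longrightarrow> (p, y, q) \<in> E \<Longrightarrow> p \<in> V \<and> q \<in> V"
  by (induction rule: swap_product.induct) auto

lemma swap_product_lpath: "swap_product V E \<pi> lab u \<Longrightarrow> lpath E p (lab p) (\<pi> p)"
proof (induction arbitrary: p rule: swap_product.induct)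
  case swap_product_id
  then show ?case by (simp add: lpath_refl)
next
  case (swap_product_step E \<pi> lab u a b y)
  let ?E = "insert (a, y, b) E"
  have IH: "lpath ?E q (lab q) (\<pi> q)" for q
    by (rule lpath_mono[OF swap_product_step.IH]) auto
  have e: "lpath ?E a y b" by (rule lpath_edge) simp
  show ?case
    using IH[of p] lpath_trans[OF e IH] lpath_trans[OF lpath_sym[OF e] IH]
    by (auto simp: transpose_def)
qed

section \<open>Orbits of permutations of a finite set and first returns\<close>

lemma permutes_return:
  assumes "finite V" "\<pi> permutes V"
  obtains n where "n > 0" "(\<pi> ^^ n) p = p"
  using permutation_is_nilpotent assms by (metis id_apply permutation_permutes)

definition first_return :: "('p \<Rightarrow> 'p) \<Rightarrow> 'p set \<Rightarrow> 'p \<Rightarrow> 'p"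
  where "first_return \<pi> S s = (\<pi> ^^ (LEAST k. 0 < k \<and> (\<pi> ^^ k) s \<in> S)) s"

lemma first_return_eqI:
  assumes "0 < k" "(\<pi> ^^ k) s \<in> S" "\<And>i. 0 < i \<Longrightarrow> i < k \<Longrightarrow> (\<pi> ^^ i) s \<notin> S"
  shows "first_return \<pi> S s = (\<pi> ^^ k) s"
proof -
  have "(LEAST k. 0 < k \<and> (\<pi> ^^ k) s \<in> S) = k"
    by (rule Least_equality) (use assms in \<open>auto simp: not_less[symmetric]\<close>)
  then show ?thesis by (simp add: first_return_def)
qed

lemma first_return_obtain:
  assumes "finite V" "\<pi> permutes V" "s \<in> S"
  obtains k where "0 < k" "first_return \<pi> S s = (\<pi> ^^ k) s" "(\<pi> ^^ k) s \<in> S"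
    "\<And>i. 0 < i \<Longrightarrow> i < k \<Longrightarrow> (\<pi> ^^ i) s \<notin> S"
proof -
  obtain n where n: "n > 0" "(\<pi> ^^ n) s = s" using permutes_return assms by metis
  define k where "k = (LEAST k. 0 < k \<and> (\<pi> ^^ k) s \<in> S)"
  have k: "0 < k \<and> (\<pi> ^^ k) s \<in> S"
    unfolding k_def by (rule LeastI[of _ n]) (use n assms in auto)
  have less: "(\<pi> ^^ i) s \<notin> S" if "0 < i" "i < k" for i
    using not_less_Least[of i "\<lambda>k. 0 < k \<and> (\<pi> ^^ k) s \<in> S"] that k_def by auto
  show ?thesis using that[of k] k less by (auto simp: first_return_def k_def)
qed

text \<open>The path avoids edges that start in \<open>S\<close>, so it persists when
  \<open>\<pi>\<close> and \<open>lab\<close> are altered on \<open>S\<close>; this lets orbits be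
  compared before and after a swap.\<close>

lemma pgraph_hit:
  assumes "finite V" "\<pi> permutes V" "S \<subseteq> V" "s \<in> S"
  obtains t l where "t \<in> S" "lpath (pgraph (V - S) \<pi> lab) (\<pi> s) l t"
proof -
  obtain k where k: "0 < k" "(\<pi> ^^ k) s \<in> S"
    and less: "\<And>i. 0 < i \<Longrightarrow> i < k \<Longrightarrow> (\<pi> ^^ i) s \<notin> S"
    using first_return_obtain[OF assms(1,2,4)] by metis
  have "\<exists>l. lpath (pgraph (V - S) \<pi> lab) (\<pi> s) l ((\<pi> ^^ i) s)" if "0 < i" "i \<le> k" for i
    using that
  proof (induction i)
    case (Suc i)
    show ?case
    proof (cases "i = 0")
      case True
      then show ?thesis using lpath_refl[of _ "\<pi> s"] by auto
    next
      case False
      then obtain l where l: "lpath (pgraph (V - S) \<pi> lab) (\<pi> s) l ((\<pi> ^^ i) s)"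
        using Suc by auto
      have "(\<pi> ^^ i) s \<in> V - S"
        using less[of i] False Suc.prems assms permutes_in_image[OF permutes_funpow[OF assms(2)], of i s]
        by auto
      then show ?thesis using lpath_fwd[OF l] by (auto simp: pgraph_def)
    qed
  qed auto
  then show ?thesis using k that by blast
qed

lemma num_balanced_trivial:
  assumes "\<And>p y q. (p, y, q) \<in> E \<Longrightarrow> y = 0 \<and> p = q"
  shows "num_balanced E V = card V"
proof -
  have *: "lpath E p y q \<longleftrightarrow> p = q \<and> y = 0" for p y q
  proof
    assume "lpath E p y q" then show "p = q \<and> y = 0"
      by (induction rule: lpath.induct) (auto dest: assms)
  qed (auto intro: lpath_refl)
  have "{p \<in> V. balanced E p} = V" by (auto simp: balanced_def *)
  moreover have "lcomp E = (\<lambda>p. {p})" by (auto simp: lcomp_def *)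
  ultimately show ?thesis by (simp add: num_balanced_def card_image)
qed

text \<open>
  When the edge \<open>(a, y, b)\<close> merges balanced orbits of \<open>\<pi>\<close> or unbalances one, the composition with the
  corresponding transposition does the same, so the edge has no further effect on the new orbits.
\<close>

lemma swap_drop_exclusive:
  assumes fin: "finite V" and perm: "\<pi> permutes V" and ab: "a \<in> V" "b \<in> V"
    and \<Gamma>: "\<Gamma> = pgraph V \<pi> lab"
    and \<Gamma>': "\<Gamma>' = pgraph V (\<pi> \<circ> transpose a b) (lab(a := y + lab b, b := - y + lab a))"
    and n: "\<not> lpath \<Gamma> a y b" and bal: "balanced \<Gamma> a \<or> balanced \<Gamma> b"
  shows "lpath \<Gamma>' a y b \<or> \<not> balanced \<Gamma>' a \<and> \<not> balanced \<Gamma>' b"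
proof -
  let ?R = "pgraph (V - {a, b}) \<pi> lab"
  have R: "?R \<subseteq> \<Gamma>" "?R \<subseteq> \<Gamma>'"
    by (auto simp: \<Gamma> \<Gamma>' pgraph_def transpose_def image_iff)
  obtain s la where s: "s = a \<or> s = b" "lpath ?R (\<pi> a) la s"
    using pgraph_hit[OF fin perm, of "{a, b}" a lab] ab by auto
  obtain t lb where t: "t = a \<or> t = b" "lpath ?R (\<pi> b) lb t"
    using pgraph_hit[OF fin perm, of "{a, b}" b lab] ab by auto
  have "lpath \<Gamma> a (lab a) (\<pi> a)" "lpath \<Gamma> b (lab b) (\<pi> b)"
    using ab by (auto simp: \<Gamma> pgraph_def intro: lpath_edge)
  then have A: "lpath \<Gamma> a (lab a + la) s" and B: "lpath \<Gamma> b (lab b + lb) t"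
    using lpath_mono[OF s(2) R(1)] lpath_mono[OF t(2) R(1)] by (auto intro: lpath_trans)
  have "lpath \<Gamma>' b (- y + lab a) (\<pi> a)"
    using ab by (auto simp: \<Gamma>' pgraph_def image_iff transpose_def intro!: lpath_edge bexI[of _ b])
  then have A': "lpath \<Gamma>' b (- y + (lab a + la)) s"
    using lpath_trans[OF _ lpath_mono[OF s(2) R(2)], of b "- y + lab a"] by (simp only: add.assoc)
  show ?thesis
  proof (cases "a = b")
    \<comment> \<open>Here the swap only relabels one step: the loop through \<open>a\<close> had
      label 0 and now has label \<open>- y\<close>.\<close>
    case True
    then have "s = a" "t = a" using s t by auto
    then have "lab a + la = 0" using bal A True balancedD[of \<Gamma> a] by blast
    then have "lpath \<Gamma>' a (- y) a" using A' True \<open>s = a\<close> by simp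
    then have "lpath \<Gamma>' a y a" using lpath_sym[of \<Gamma>' a "- y" a] by simp
    then show ?thesis using True by simp
  next
    case False
    then have "lpath \<Gamma>' a (y + lab b) (\<pi> b)"
      using ab by (auto simp: \<Gamma>' pgraph_def image_iff transpose_def intro!: lpath_edge bexI[of _ a])
    then have B': "lpath \<Gamma>' a (y + (lab b + lb)) t"
      using lpath_trans[OF _ lpath_mono[OF t(2) R(2)], of a "y + lab b"] by (simp only: add.assoc)
    consider (split) "s = b" "t = a" | (sa) "s = a" | (tb) "t = b" using s t by auto
    then show ?thesis
    proof cases
      \<comment> \<open>Both points lie on one cycle of trivial label, with \<open>?w\<close> the
        label from \<open>a\<close> to \<open>b\<close>. The swap cuts it into cycles with labels
        \<open>y - ?w\<close> and \<open>- y + ?w\<close>, nontrivial because \<open>y\<close> was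
        not already realised.\<close>
      case split
      let ?w = "lab a + la"
      have ba: "balanced \<Gamma> a" using bal balanced_conn[of \<Gamma> b "lab b + lb" a] B split by blast
      have w: "lpath \<Gamma> a ?w b" using A split by simp
      have "?w + (lab b + lb) = 0"
        using balancedD[OF ba] lpath_trans[OF w, of "lab b + lb" a] B split by simp
      then have lb: "lab b + lb = - ?w" by (metis add.inverse_unique)
      have ne: "?w \<noteq> y" using n w by auto
      have "lpath \<Gamma>' a (y - ?w) a" using B' split lb by simp
      moreover have "y - ?w \<noteq> 0" using ne by auto
      ultimately have "\<not> balanced \<Gamma>' a" using balancedD[of \<Gamma>' a] by blast
      moreover have "- y + ?w \<noteq> 0"
        using ne by (metis add_minus_cancel add.right_neutral)
      then have "\<not> balanced \<Gamma>' b" using balancedD[of \<Gamma>' b "- y + ?w"] A' split by blast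
      ultimately show ?thesis by blast
    next
      \<comment> \<open>Some balanced cycle meets only one of the two points. The swap inserts it
        into the way from the other point, where it contributes 0, so the new path between the
        points reads just \<open>y\<close> or \<open>- y\<close>.\<close>
      case sa
      show ?thesis
      proof (cases "balanced \<Gamma> a")
        case True
        then have "lab a + la = 0" using A sa balancedD[of \<Gamma> a] by blast
        then have "lpath \<Gamma>' b (- y) a" using A' sa by simp
        then show ?thesis using lpath_sym[of \<Gamma>' b "- y" a] by simp
      next
        case F: False
        then have bb: "balanced \<Gamma> b" using bal by blast
        then have "t = b" using F t B balanced_conn[of \<Gamma> b "lab b + lb" a] by blast
        then have "lab b + lb = 0" using B bb balancedD[of \<Gamma> b] by blast
        then show ?thesis using B' \<open>t = b\<close> by simp
      qed
    next
      case tb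
      show ?thesis
      proof (cases "balanced \<Gamma> b")
        case True
        then have "lab b + lb = 0" using B tb balancedD[of \<Gamma> b] by blast
        then show ?thesis using B' tb by simp
      next
        case F: False
        then have bb: "balanced \<Gamma> a" using bal by blast
        then have "s = a" using F s A balanced_conn[of \<Gamma> a "lab a + la" b] by blast
        then have "lab a + la = 0" using A bb balancedD[of \<Gamma> a] by blast
        then have "lpath \<Gamma>' b (- y) a" using A' \<open>s = a\<close> by simp
        then show ?thesis using lpath_sym[of \<Gamma>' b "- y" a] by simp
      qed
    qed
  qed
qed

text \<open>
  A labelled version of Ree's inequality, which for trivial labels says that the genus of a
  factorisation is nonnegative.
\<close>

lemma swap_product_ree:
  assumes "finite V" "swap_product V E \<pi> lab u"
  shows "card V + num_balanced (pgraph V \<pi> lab) V \<le> u + 2 * num_balanced E V"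
  using assms(2)
proof (induction rule: swap_product.induct)
  case swap_product_id
  have "num_balanced (pgraph V id (\<lambda>_. 0 :: 'b)) V = card V"
    by (rule num_balanced_trivial) (auto simp: pgraph_def)
  moreover have "num_balanced ({} :: ('a \<times> 'b \<times> 'a) set) V = card V"
    by (rule num_balanced_trivial) auto
  ultimately show ?case by linarith
next
  case (swap_product_step E \<pi> lab u a b y)
  define \<Gamma> where "\<Gamma> = pgraph V \<pi> lab"
  define \<Gamma>' where "\<Gamma>' = pgraph V (\<pi> \<circ> transpose a b) (lab(a := y + lab b, b := - y + lab a))"
  let ?e = "(a, y, b)"
  have ab: "a \<in> V" "b \<in> V" by fact+
  have e: "lpath (insert ?e \<Gamma>) a y b" "lpath (insert ?e \<Gamma>') a y b" by (auto intro: lpath_edge)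
  have \<Gamma>_edge: "lpath (insert ?e \<Gamma>) p (lab p) (\<pi> p)" if "p \<in> V" for p
    by (rule lpath_edge) (use that in \<open>auto simp: \<Gamma>_def pgraph_def\<close>)
  have \<Gamma>'_b: "lpath (insert ?e \<Gamma>') b (- y + lab a) (\<pi> a)"
    by (rule lpath_edge) (use ab in \<open>auto simp: \<Gamma>'_def pgraph_def image_iff transpose_def intro!: bexI[of _ b]\<close>)
  have \<Gamma>'_a: "lpath (insert ?e \<Gamma>') a (y + lab b) (\<pi> b)" if "a \<noteq> b"
    by (rule lpath_edge) (use ab that in \<open>auto simp: \<Gamma>'_def pgraph_def image_iff transpose_def intro!: bexI[of _ a]\<close>)
  have a_old: "lpath (insert ?e \<Gamma>') a (lab a) (\<pi> a)"
    using lpath_trans[OF e(2) \<Gamma>'_b] by simp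
  have b_old: "lpath (insert ?e \<Gamma>') b (lab b) (\<pi> b)"
    using lpath_trans[OF lpath_sym[OF e(2)] \<Gamma>'_a] a_old by (cases "a = b") simp_all
  \<comment> \<open>Together with the new edge, the old and the new steps generate each other, so
    both orbit counts exceed the same number, by at most one each.\<close>
  have "num_balanced (insert ?e \<Gamma>) V = num_balanced (insert ?e \<Gamma>') V"
  proof (rule num_balanced_cong, rule iffI)
    fix p w q assume "lpath (insert ?e \<Gamma>) p w q"
    then show "lpath (insert ?e \<Gamma>') p w q"
    proof (rule lpath_subsume)
      fix r v s assume "(r, v, s) \<in> insert ?e \<Gamma>"
      then consider "(r, v, s) = ?e" | "r \<in> V" "v = lab r" "s = \<pi> r"
        by (auto simp: \<Gamma>_def pgraph_def)
      then show "lpath (insert ?e \<Gamma>') r v s"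
      proof cases
        case 2
        show ?thesis
        proof (cases "r = a \<or> r = b")
          case False
          then show ?thesis using 2
            by (auto simp: \<Gamma>'_def pgraph_def image_iff transpose_def intro!: lpath_edge bexI[of _ r])
        qed (use 2 a_old b_old in auto)
      qed (use e in auto)
    qed
  next
    fix p w q assume "lpath (insert ?e \<Gamma>') p w q"
    then show "lpath (insert ?e \<Gamma>) p w q"
    proof (rule lpath_subsume)
      fix r v s assume "(r, v, s) \<in> insert ?e \<Gamma>'"
      then consider "(r, v, s) = ?e" | "r \<in> V" "r \<noteq> a" "r \<noteq> b" "v = lab r" "s = \<pi> r"
        | "r = b" "v = - y + lab a" "s = \<pi> a" | "r = a" "v = y + lab b" "s = \<pi> b"
        by (auto simp: \<Gamma>'_def pgraph_def transpose_def split: if_splits)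
      then show "lpath (insert ?e \<Gamma>) r v s"
        using e(1) \<Gamma>_edge lpath_trans[OF e(1) \<Gamma>_edge[OF ab(2)]]
          lpath_trans[OF lpath_sym[OF e(1)] \<Gamma>_edge[OF ab(1)]]
        by cases auto
    qed
  qed
  moreover note num_balanced_insert[OF assms(1) ab, of \<Gamma> y] num_balanced_insert[OF assms(1) ab, of \<Gamma>' y]
    num_balanced_insert[OF assms(1) ab, of E y]
  \<comment> \<open>If the edge lowers the count of \<open>E\<close> then it lowers that of
    \<open>\<Gamma>\<close>, whose paths are paths of \<open>E\<close>, hence not that of
    \<open>\<Gamma>'\<close>. The orbit count then falls by one, as does the right-hand side, which
    gains a transposition and loses 2.\<close>
  moreover have "lpath E a y b \<or> \<not> balanced E a \<and> \<not> balanced E b \<or>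
    \<not> (lpath \<Gamma> a y b \<or> \<not> balanced \<Gamma> a \<and> \<not> balanced \<Gamma> b) \<and>
      (lpath \<Gamma>' a y b \<or> \<not> balanced \<Gamma>' a \<and> \<not> balanced \<Gamma>' b)"
  proof -
    have sub: "(r, v, s) \<in> \<Gamma> \<Longrightarrow> lpath E r v s" for r v s
      using swap_product_lpath[OF swap_product_step(1), of r] by (auto simp: \<Gamma>_def pgraph_def)
    have "lpath \<Gamma> a y b \<Longrightarrow> lpath E a y b" by (erule lpath_subsume) (rule sub)
    moreover have "balanced E p \<Longrightarrow> balanced \<Gamma> p" for p
      by (erule balanced_subsume) (rule sub)
    moreover note swap_drop_exclusive[OF assms(1) swap_product_permutes[OF swap_product_step(1)] ab \<Gamma>_def \<Gamma>'_def]
    ultimately show ?thesis by blast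
  qed
  ultimately show ?case
    using swap_product_step.IH unfolding \<Gamma>_def[symmetric] \<Gamma>'_def[symmetric]
    by (auto split: if_splits)
qed

text \<open>Each edge lowers the count by at most one, starting from \<open>card V\<close>. With
  trivial labels, the case applied later, a graph with \<open>c\<close> components has at least
  \<open>card V - c\<close> edges.\<close>

lemma num_balanced_card:
  assumes "finite V" "finite E" "\<And>a y b. (a, y, b) \<in> E \<Longrightarrow> a \<in> V \<and> b \<in> V"
  shows "card V \<le> num_balanced E V + card E"
  using assms(2,3)
proof (induction E)
  case empty
  show ?case by (subst num_balanced_trivial) auto
next
  case (insert e E)
  obtain a y b where e: "e = (a, y, b)" by (cases e)
  have "card V \<le> num_balanced E V + card E" using insert by blast
  moreover have "a \<in> V" "b \<in> V" using insert.prems e by auto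
  ultimately show ?case
    using num_balanced_insert[OF assms(1), of a b E y] insert.hyps by (auto simp: e split: if_splits)
qed

section \<open>Orbits and components that miss a set of letters\<close>

lemma lpath_label_0:
  assumes "\<And>a y b. (a, y, b) \<in> E \<Longrightarrow> y = 0"
  shows "lpath E p w q \<Longrightarrow> w = 0"
  by (induction rule: lpath.induct) (auto dest: assms)

lemma lpath_agree:
  assumes "lcomp E p \<inter> S = {}"
    and "\<And>a y b. (a, y, b) \<in> E \<Longrightarrow> a \<notin> S \<Longrightarrow> (a, y, b) \<in> E'"
    and "lpath E p w q"
  shows "lpath E' p w q"
  using assms(3,1)
proof (induction rule: lpath.induct)
  case (lpath_refl p)
  show ?case by (rule lpath.lpath_refl)
next
  case (lpath_fwd p y q z r)
  then have "q \<in> lcomp E p" by (auto simp: lcomp_def)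
  then have "(q, z, r) \<in> E'" using lpath_fwd assms(2) by blast
  then show ?case using lpath_fwd lpath.lpath_fwd[of E' p y q z r] by blast
next
  case (lpath_bwd p y q r z)
  then have "r \<in> lcomp E p" using lpath.lpath_bwd[of E p y q r z] by (auto simp: lcomp_def)
  then have "(r, z, q) \<in> E'" using lpath_bwd assms(2) by blast
  then show ?case using lpath_bwd lpath.lpath_bwd[of E' p y q r z] by blast
qed

text \<open>An orbit that misses \<open>S\<close> follows the same steps under both maps. Backward
  steps need finiteness: \<open>\<pi>\<close> maps the finite component onto itself, so a
  predecessor under \<open>\<nu>\<close> is found inside it.\<close>

lemma pgraph_agree:
  assumes fin: "finite V" and perm: "\<pi> permutes V" "\<nu> permutes V"
    and agree: "\<And>r. r \<in> V - S \<Longrightarrow> \<pi> r = \<nu> r \<and> lab r = lab' r"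
    and free: "lcomp (pgraph V \<pi> lab) p \<inter> S = {}"
  shows "lpath (pgraph V \<nu> lab') p w q \<longleftrightarrow> lpath (pgraph V \<pi> lab) p w q"
proof
  assume "lpath (pgraph V \<pi> lab) p w q"
  then show "lpath (pgraph V \<nu> lab') p w q"
    by (rule lpath_agree[OF free, rotated]) (use agree in \<open>auto simp: pgraph_def\<close>)
next
  let ?\<Gamma> = "pgraph V \<pi> lab" and ?C = "lcomp (pgraph V \<pi> lab) p"
  have closed: "\<pi> r \<in> ?C" if "r \<in> ?C" for r
  proof (cases "r \<in> V")
    case True
    then have "(r, lab r, \<pi> r) \<in> ?\<Gamma>" by (simp add: pgraph_def)
    then show ?thesis using that lpath_fwd[of ?\<Gamma> p _ r] by (auto simp: lcomp_def)
  next
    case False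
    then show ?thesis using that permutes_not_in[OF perm(1)] by simp
  qed
  have "q \<in> insert p V" if "lpath ?\<Gamma> p y q" for y q
    using that by (induction rule: lpath.induct)
      (use permutes_in_image[OF perm(1)] in \<open>auto simp: pgraph_def\<close>)
  then have "?C \<subseteq> insert p V" by (auto simp: lcomp_def)
  then have "finite ?C" using fin finite_subset by blast
  then have onto: "\<pi> ` ?C = ?C"
    using closed permutes_inj_on[OF perm(1)] by (intro endo_inj_surj) auto
  assume "lpath (pgraph V \<nu> lab') p w q"
  then show "lpath ?\<Gamma> p w q" using free onto
  proof (induction rule: lpath.induct)
    case (lpath_refl p)
    show ?case by (rule lpath.lpath_refl)
  next
    case (lpath_fwd p y q z r)
    then have "q \<in> lcomp ?\<Gamma> p" by (auto simp: lcomp_def)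
    moreover have q: "q \<in> V" "z = lab' q" "r = \<nu> q" using lpath_fwd(2) by (auto simp: pgraph_def)
    moreover have "q \<notin> S" using calculation(1) lpath_fwd(4) by (meson disjoint_iff)
    ultimately have "z = lab q" "r = \<pi> q" using agree[of q] by auto
    then have "(q, z, r) \<in> ?\<Gamma>" using q by (auto simp: pgraph_def)
    then show ?case using lpath_fwd lpath.lpath_fwd[of ?\<Gamma> p y q z r] by blast
  next
    case (lpath_bwd p y q r z)
    then have r: "r \<in> V" "z = lab' r" "\<nu> r = q" by (auto simp: pgraph_def)
    have "q \<in> lcomp ?\<Gamma> p" using lpath_bwd by (auto simp: lcomp_def)
    then obtain r' where r': "r' \<in> lcomp ?\<Gamma> p" "\<pi> r' = q" using lpath_bwd(5) by (metis imageE)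
    have "\<pi> r' \<in> V" using r r' permutes_in_image[OF perm(2), of r] by simp
    then have "r' \<in> V" using permutes_in_image[OF perm(1)] by blast
    moreover have "r' \<notin> S" using r'(1) lpath_bwd(4) by (meson disjoint_iff)
    ultimately have "\<nu> r' = q" "lab r' = lab' r'" using r' agree[of r'] by auto
    then have "r = r'" using r permutes_inj[OF perm(2)] by (metis injD)
    then have "(r, z, q) \<in> ?\<Gamma>" using r r' \<open>lab r' = lab' r'\<close> by (auto simp: pgraph_def)
    then show ?case using lpath_bwd lpath.lpath_bwd[of ?\<Gamma> p y q r z] by blast
  qed
qed

lemma swap_product_zero_labels:
  assumes "swap_product V E \<pi> lab u" "\<And>a y b. (a, y, b) \<in> E \<Longrightarrow> y = 0"
  shows "lab = (\<lambda>_. 0)"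
  using assms
proof (induction rule: swap_product.induct)
  case (swap_product_step E \<pi> lab u a b y)
  then have "lab = (\<lambda>_. 0)" "y = 0" by blast+
  then show ?case by auto
qed simp

lemma card_image_factor_le:
  assumes "finite A" "\<And>x y. x \<in> A \<Longrightarrow> y \<in> A \<Longrightarrow> g x = g y \<Longrightarrow> f x = f y"
  shows "card (f ` A) \<le> card (g ` A)"
proof (rule surj_card_le)
  show "f ` A \<subseteq> (\<lambda>c. f (inv_into A g c)) ` g ` A"
  proof
    fix y assume "y \<in> f ` A"
    then obtain x where x: "x \<in> A" "y = f x" by blast
    then have "f (inv_into A g (g x)) = f x"
      using assms(2)[of "inv_into A g (g x)" x] by (simp add: inv_into_into f_inv_into_f)
    then show "y \<in> (\<lambda>c. f (inv_into A g c)) ` g ` A" using x by force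
  qed
qed (use assms(1) in simp)

lemma card_lcomp_le:
  assumes "finite A" "\<And>p y q. lpath E p y q \<Longrightarrow> \<exists>w. lpath E' p w q"
  shows "card (lcomp E' ` A) \<le> card (lcomp E ` A)"
proof (rule card_image_factor_le[OF assms(1)])
  fix p q assume "lcomp E p = lcomp E q"
  then obtain y where "lpath E p y q" using lcomp_eq_iff[of E p q] by blast
  then show "lcomp E' p = lcomp E' q" using assms(2) lcomp_eq_iff[of E' p q] by blast
qed

lemma num_balanced_split:
  assumes "finite V" "S \<subseteq> V"
  shows "num_balanced E V = card (lcomp E ` {p \<in> S. balanced E p}) +
    card (lcomp E ` {p \<in> V. balanced E p \<and> lcomp E p \<inter> S = {}})"
proof -
  have "lcomp E ` {p \<in> V. balanced E p} = lcomp E ` {p \<in> S. balanced E p} \<union>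
    lcomp E ` {p \<in> V. balanced E p \<and> lcomp E p \<inter> S = {}}"
  proof (intro equalityI subsetI)
    fix c assume "c \<in> lcomp E ` {p \<in> V. balanced E p}"
    then obtain p where p: "p \<in> V" "balanced E p" "c = lcomp E p" by auto
    show "c \<in> lcomp E ` {p \<in> S. balanced E p} \<union> lcomp E ` {p \<in> V. balanced E p \<and> lcomp E p \<inter> S = {}}"
    proof (cases "lcomp E p \<inter> S = {}")
      case False
      then obtain q y where q: "q \<in> S" "lpath E p y q" by (auto simp: lcomp_def)
      then have "balanced E q" "lcomp E p = lcomp E q"
        using p balanced_conn[of E p y q] lcomp_eq_iff[of E p q] by auto
      then show ?thesis using p q by blast
    qed (use p in auto)
  qed (use assms in auto)
  moreover have "lcomp E ` {p \<in> S. balanced E p} \<inter>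
    lcomp E ` {p \<in> V. balanced E p \<and> lcomp E p \<inter> S = {}} = {}"
    using lcomp_refl by fastforce
  moreover have "finite S" using assms finite_subset by blast
  ultimately show ?thesis using assms(1) by (simp add: num_balanced_def card_Un_disjoint)
qed

text \<open>
  The points outside \<open>S\<close> are letters that have been glued away.  An orbit of such points is a closed
  curve; discs bounded by it are not counted, which is compensated since each closed curve cuts off
  at most one closed component.
\<close>

theorem swap_product_pair_count:
  fixes lab :: "'p \<Rightarrow> 'g::group_add" and EM :: "('p \<times> 'g \<times> 'p) set"
  assumes fin: "finite V" and Q: "swap_product V EQ \<pi> lab u" and N: "swap_product V EM \<nu> lab' v"
    and EM0: "\<And>a y b. (a, y, b) \<in> EM \<Longrightarrow> y = 0"
    and S: "S \<subseteq> V" "S \<noteq> {}"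
    and ghost: "\<And>p. p \<in> V - S \<Longrightarrow> \<pi> p = \<nu> p \<and> lab p = 0"
    and conn: "\<And>p q. p \<in> V \<Longrightarrow> q \<in> V \<Longrightarrow> \<exists>y. lpath (EQ \<union> EM) p y q"
  shows "2 * card V \<le> u + v + card (lcomp (pgraph V \<pi> lab) ` {p \<in> S. balanced (pgraph V \<pi> lab) p})
    + card (lcomp (pgraph V \<nu> lab') ` S)"
proof -
  define \<Gamma> where "\<Gamma> = pgraph V \<pi> lab"
  define \<Delta> where "\<Delta> = pgraph V \<nu> lab'"
  have lab': "lab' = (\<lambda>_. 0)" using EM0 by (rule swap_product_zero_labels[OF N])
  have finS: "finite S" using fin S finite_subset by blast
  have EM0': "lpath EM p w q \<Longrightarrow> w = 0" for p w q
    by (rule lpath_label_0[of EM]) (auto simp: EM0)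
  have \<Gamma>E: "(r, w, s) \<in> \<Gamma> \<Longrightarrow> lpath EQ r w s" for r w s
    using swap_product_lpath[OF Q, of r] by (auto simp: \<Gamma>_def pgraph_def)
  have \<Delta>E: "(r, w, s) \<in> \<Delta> \<Longrightarrow> lpath EM r w s" for r w s
    using swap_product_lpath[OF N, of r] by (auto simp: \<Delta>_def pgraph_def)
  have \<Gamma>sub: "lpath \<Gamma> p w q \<Longrightarrow> lpath EQ p w q" for p w q
    by (erule lpath_subsume) (rule \<Gamma>E)
  have \<Delta>sub: "lpath \<Delta> p w q \<Longrightarrow> lpath EM p w q" for p w q
    by (erule lpath_subsume) (rule \<Delta>E)
  have comp_sub: "lcomp \<Gamma> p \<subseteq> lcomp EQ p" "lcomp \<Delta> p \<subseteq> lcomp EM p" for p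
    by (auto simp: lcomp_def intro: \<Gamma>sub \<Delta>sub)
  have bal\<Delta>: "balanced \<Delta> p" "balanced EM p" for p
    using \<Delta>sub EM0' unfolding balanced_def by blast+
  note perm = swap_product_permutes[OF Q] swap_product_permutes[OF N]
  have free1: "lpath \<Delta> p w q \<longleftrightarrow> lpath \<Gamma> p w q" if "lcomp \<Gamma> p \<inter> S = {}" for p w q
    using pgraph_agree[OF fin perm, of S lab lab' p w q] that ghost
    by (auto simp: \<Gamma>_def \<Delta>_def lab')
  have free2: "lpath \<Delta> p w q \<longleftrightarrow> lpath \<Gamma> p w q" if "lcomp \<Delta> p \<inter> S = {}" for p w q
    using pgraph_agree[OF fin perm(2,1), of S lab' lab p w q] that ghost
    by (auto simp: \<Gamma>_def \<Delta>_def lab')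
  have free_eq: "lcomp \<Delta> p = lcomp \<Gamma> p" if "lcomp \<Gamma> p \<inter> S = {}" for p
    using free1[OF that] by (simp add: lcomp_def)
  have free_eq': "lcomp \<Delta> p = lcomp \<Gamma> p" if "lcomp \<Delta> p \<inter> S = {}" for p
    using free2[OF that] by (simp add: lcomp_def)
  have free_iff: "lcomp \<Gamma> p \<inter> S = {} \<longleftrightarrow> lcomp \<Delta> p \<inter> S = {}" for p
    using free_eq[of p] free_eq'[of p] by metis
  have free_bal: "balanced \<Gamma> p" if "lcomp \<Gamma> p \<inter> S = {}" for p
    using free1[OF that] bal\<Delta>(1)[of p] by (auto simp: balanced_def)
  \<comment> \<open>\<open>Z\<close> consists of the closed curves of erased letters, seen alike by
    both permutations; \<open>D\<close> and \<open>e\<close> count the balanced orbits meeting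
    \<open>S\<close>, and \<open>CQ\<close>, \<open>CM\<close> are the components of either kind
    without letters of \<open>S\<close>.\<close>
  define Z where "Z = lcomp \<Gamma> ` {p \<in> V. lcomp \<Gamma> p \<inter> S = {}}"
  define D where "D = card (lcomp \<Gamma> ` {p \<in> S. balanced \<Gamma> p})"
  define e where "e = card (lcomp \<Delta> ` S)"
  define CQ where "CQ = lcomp EQ ` {p \<in> V. lcomp EQ p \<inter> S = {}}"
  define CM where "CM = lcomp EM ` {p \<in> V. lcomp EM p \<inter> S = {}}"
  have finC: "finite Z" "finite CQ" "finite CM" using fin by (simp_all add: Z_def CQ_def CM_def)
  have "{p \<in> V. balanced \<Gamma> p \<and> lcomp \<Gamma> p \<inter> S = {}} = {p \<in> V. lcomp \<Gamma> p \<inter> S = {}}"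
    using free_bal by blast
  then have n\<Gamma>: "num_balanced \<Gamma> V = D + card Z"
    using num_balanced_split[OF fin S(1), of \<Gamma>] by (simp add: D_def Z_def)
  have "lcomp \<Delta> ` {p \<in> V. lcomp \<Delta> p \<inter> S = {}} = Z"
    unfolding Z_def free_iff[symmetric] by (rule image_cong) (use free_eq in auto)
  then have n\<Delta>: "num_balanced \<Delta> V = e + card Z"
    using num_balanced_split[OF fin S(1), of \<Delta>] by (simp add: bal\<Delta> e_def)
  have "card (lcomp EQ ` {p \<in> S. balanced EQ p}) \<le> D"
  proof -
    have "balanced \<Gamma> p" if "balanced EQ p" for p
      using that \<Gamma>sub unfolding balanced_def by blast
    then have "lcomp EQ ` {p \<in> S. balanced EQ p} \<subseteq> lcomp EQ ` {p \<in> S. balanced \<Gamma> p}" by blast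
    then have "card (lcomp EQ ` {p \<in> S. balanced EQ p}) \<le> card (lcomp EQ ` {p \<in> S. balanced \<Gamma> p})"
      using finS by (intro card_mono) auto
    also have "\<dots> \<le> D"
      unfolding D_def by (rule card_lcomp_le) (use finS in simp, use \<Gamma>sub in blast)
    finally show ?thesis .
  qed
  moreover have "card (lcomp EQ ` {p \<in> V. balanced EQ p \<and> lcomp EQ p \<inter> S = {}}) \<le> card CQ"
    unfolding CQ_def by (rule card_mono) (use fin in auto)
  ultimately have nQ: "num_balanced EQ V \<le> D + card CQ"
    using num_balanced_split[OF fin S(1), of EQ] by linarith
  have "card (lcomp EM ` S) \<le> e"
    unfolding e_def by (rule card_lcomp_le) (use finS in simp, use \<Delta>sub in blast)
  then have nM: "num_balanced EM V \<le> e + card CM"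
    using num_balanced_split[OF fin S(1), of EM] by (simp add: bal\<Delta> CM_def)
  have "card CQ + card CM \<le> card Z"
  proof -
    \<comment> \<open>An auxiliary graph: its nodes are the closed components of both kinds, tagged
      by a Boolean, with everything that meets \<open>S\<close> collapsed to \<open>None\<close>;
      its edges come from the curves in \<open>Z\<close>, with a dummy label 0. By
      \<open>conn\<close> it is connected, so it has at least as many edges as nodes other than
      \<open>None\<close>.\<close>
    define fQ where "fQ p = (if lcomp EQ p \<inter> S = {} then Some (lcomp EQ p, True) else None)" for p
    define fM where "fM p = (if lcomp EM p \<inter> S = {} then Some (lcomp EM p, False) else None)" for p
    define H where "H = (\<lambda>p. (fQ p, 0 :: int, fM p)) ` {p \<in> V. lcomp \<Gamma> p \<inter> S = {}}"
    define Nd where "Nd = insert None (Some ` (CQ \<times> {True} \<union> CM \<times> {False}))"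
    have "card Nd = Suc (card CQ + card CM)"
    proof -
      have "card (CQ \<times> {True} \<union> CM \<times> {False}) = card CQ + card CM"
        by (subst card_Un_disjoint) (use finC in auto)
      then show ?thesis
        using finC by (subst Nd_def, subst card_insert_disjoint) (auto simp: card_image)
    qed
    moreover have "card Nd \<le> num_balanced H Nd + card H"
      by (rule num_balanced_card) (use finC fin in \<open>auto simp: H_def Nd_def fQ_def fM_def CQ_def CM_def\<close>)
    moreover have "card H \<le> card Z"
    proof -
      have "fQ p = fQ q \<and> fM p = fM q" if pq: "lcomp \<Gamma> p \<inter> S = {}" "lcomp \<Gamma> p = lcomp \<Gamma> q" for p q
      proof -
        obtain y where y: "lpath \<Gamma> p y q" using pq lcomp_eq_iff[of \<Gamma> p q] by blast
        then have "lpath \<Delta> p y q" using free1 pq by blast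
        then have "lcomp EM p = lcomp EM q" by (intro lcomp_eqI \<Delta>sub)
        moreover have "lcomp EQ p = lcomp EQ q" using y by (intro lcomp_eqI \<Gamma>sub)
        ultimately show ?thesis by (simp add: fQ_def fM_def)
      qed
      then show ?thesis
        unfolding H_def Z_def by (intro card_image_factor_le) (use fin in auto)
    qed
    moreover have "num_balanced H Nd \<le> 1"
    proof -
      have link: "lcomp H (fQ p) = lcomp H (fM p)" if "p \<in> V" for p
      proof (cases "lcomp \<Gamma> p \<inter> S = {}")
        case True
        then have "lpath H (fQ p) 0 (fM p)" using that by (auto simp: H_def intro!: lpath_edge)
        then show ?thesis by (rule lcomp_eqI)
      next
        case False
        then have "lcomp EQ p \<inter> S \<noteq> {}" using comp_sub(1)[of p] by blast
        moreover have "lcomp \<Delta> p \<inter> S \<noteq> {}" using False free_iff by blast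
        then have "lcomp EM p \<inter> S \<noteq> {}" using comp_sub(2)[of p] by blast
        ultimately show ?thesis by (simp add: fQ_def fM_def)
      qed
      have step: "lcomp H (fQ a) = lcomp H (fQ b)" if "(a, y, b) \<in> EQ \<union> EM" for a y b
      proof (cases "(a, y, b) \<in> EQ")
        case True
        then have "lcomp EQ a = lcomp EQ b" by (intro lcomp_eqI lpath_edge)
        then show ?thesis by (simp add: fQ_def)
      next
        case False
        then have ab: "(a, y, b) \<in> EM" using that by blast
        then have "a \<in> V" "b \<in> V" using swap_product_edges[OF N] by blast+
        moreover have "lcomp EM a = lcomp EM b" using ab by (intro lcomp_eqI lpath_edge)
        then have "fM a = fM b" by (simp add: fM_def)
        ultimately show ?thesis using link[of a] link[of b] by simp
      qed
      have walk: "lpath (EQ \<union> EM) p y q \<Longrightarrow> lcomp H (fQ p) = lcomp H (fQ q)" for p y q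
      proof (induction rule: lpath.induct)
        case (lpath_fwd p y q z r)
        then show ?case using step[of q z r] by simp
      next
        case (lpath_bwd p y q r z)
        then show ?case using step[of r z q] by simp
      qed simp
      obtain s where s: "s \<in> S" "s \<in> V" using S by blast
      have "fQ s = None" using s lcomp_refl[of s EQ] by (auto simp: fQ_def)
      then have fQ: "lcomp H (fQ p) = lcomp H None" if "p \<in> V" for p
        using conn[OF that s(2)] walk[of p _ s] by auto
      have "lcomp H x = lcomp H None" if "x \<in> Nd" for x
      proof -
        from that consider "x = None" | p where "p \<in> V" "x = fQ p" | p where "p \<in> V" "x = fM p"
          unfolding Nd_def CQ_def CM_def fQ_def fM_def by fastforce
        then show ?thesis using fQ link by cases auto
      qed
      then have "lcomp H ` {x \<in> Nd. balanced H x} \<subseteq> {lcomp H None}" by blast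
      then have "card (lcomp H ` {x \<in> Nd. balanced H x}) \<le> card {lcomp H None}"
        by (rule card_mono[rotated]) simp
      then show ?thesis by (simp add: num_balanced_def)
    qed
    ultimately show ?thesis by linarith
  qed
  \<comment> \<open>Adding the two Ree inequalities leaves \<open>card Z\<close> twice on the left
    and \<open>card CQ + card CM\<close> twice on the right, so the closed curves cancel.\<close>
  then show ?thesis
    using swap_product_ree[OF fin Q] swap_product_ree[OF fin N] n\<Gamma> n\<Delta> nQ nM
    unfolding D_def[symmetric] e_def[symmetric] \<Gamma>_def[symmetric] \<Delta>_def[symmetric] by linarith
qed

section \<open>Counting orbits against levels\<close>

text \<open>The function is controlled only on visits to \<open>S\<close>, so the induction on
  \<open>j\<close> jumps from each visit to the next.\<close>

lemma first_return_monotone: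
  fixes f :: "'p \<Rightarrow> 'b::preorder"
  assumes fin: "finite V" and perm: "\<pi> permutes V"
    and "s \<in> S" "(\<pi> ^^ j) s \<in> S"
    and mono: "\<And>i. (\<pi> ^^ i) s \<in> S \<Longrightarrow> f ((\<pi> ^^ i) s) \<le> f (first_return \<pi> S ((\<pi> ^^ i) s))"
  shows "f s \<le> f ((\<pi> ^^ j) s)"
  using assms(3,4) mono
proof (induction j arbitrary: s rule: less_induct)
  case (less j)
  show ?case
  proof (cases "j = 0")
    case False
    obtain k where k: "0 < k" "first_return \<pi> S s = (\<pi> ^^ k) s" "(\<pi> ^^ k) s \<in> S"
      "\<And>i. 0 < i \<Longrightarrow> i < k \<Longrightarrow> (\<pi> ^^ i) s \<notin> S"
      using first_return_obtain[OF fin perm less.prems(1)] by metis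
    have kj: "k \<le> j" using k(4)[of j] less.prems(2) False by force
    have add: "(\<pi> ^^ i) ((\<pi> ^^ k) s) = (\<pi> ^^ (i + k)) s" for i
      by (simp add: funpow_add)
    have "f ((\<pi> ^^ k) s) \<le> f ((\<pi> ^^ (j - k)) ((\<pi> ^^ k) s))"
    proof (rule less.IH)
      show "j - k < j" using k False by simp
      show "(\<pi> ^^ k) s \<in> S" by (rule k)
      show "(\<pi> ^^ (j - k)) ((\<pi> ^^ k) s) \<in> S" using add[of "j - k"] kj less.prems by simp
      show "f ((\<pi> ^^ i) ((\<pi> ^^ k) s)) \<le> f (first_return \<pi> S ((\<pi> ^^ i) ((\<pi> ^^ k) s)))"
        if "(\<pi> ^^ i) ((\<pi> ^^ k) s) \<in> S" for i
        using less.prems(3)[of "i + k"] that by (simp add: funpow_add)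
    qed
    also have "(\<pi> ^^ (j - k)) ((\<pi> ^^ k) s) = (\<pi> ^^ j) s" using add[of "j - k"] kj by simp
    finally show ?thesis
      using less.prems(3)[of 0] less.prems(1) k(2) by (auto intro: order_trans)
  qed simp
qed

text \<open>A full turn of the cycle leads back to \<open>s\<close>, so a function that never
  decreases cannot increase.\<close>

lemma first_return_constant:
  fixes f :: "'p \<Rightarrow> 'b::order"
  assumes fin: "finite V" and perm: "\<pi> permutes V"
    and s: "s \<in> S" "(\<pi> ^^ j) s \<in> S"
    and mono: "\<And>i. (\<pi> ^^ i) s \<in> S \<Longrightarrow> f ((\<pi> ^^ i) s) \<le> f (first_return \<pi> S ((\<pi> ^^ i) s))"
  shows "f ((\<pi> ^^ j) s) = f s"
proof (rule antisym)
  show "f s \<le> f ((\<pi> ^^ j) s)" by (rule first_return_monotone) fact+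
  obtain n where n: "n > 0" "(\<pi> ^^ n) s = s" using permutes_return[OF fin perm] by blast
  have nm: "(\<pi> ^^ (n * m)) s = s" for m
    by (induction m) (use n in \<open>auto simp: funpow_add\<close>)
  \<comment> \<open>With \<open>n\<close> a period of \<open>s\<close>, these further steps complete
    \<open>j\<close> periods.\<close>
  have bk: "(\<pi> ^^ (n * j - j)) ((\<pi> ^^ j) s) = s"
  proof -
    have "(\<pi> ^^ (n * j - j)) ((\<pi> ^^ j) s) = (\<pi> ^^ (n * j - j + j)) s" by (simp add: funpow_add)
    also have "n * j - j + j = n * j" using n(1) by simp
    finally show ?thesis using nm by simp
  qed
  have "f ((\<pi> ^^ j) s) \<le> f ((\<pi> ^^ (n * j - j)) ((\<pi> ^^ j) s))"
  proof (rule first_return_monotone[OF fin perm])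
    show "(\<pi> ^^ j) s \<in> S" "(\<pi> ^^ (n * j - j)) ((\<pi> ^^ j) s) \<in> S" using s bk by simp_all
    show "f ((\<pi> ^^ i) ((\<pi> ^^ j) s)) \<le> f (first_return \<pi> S ((\<pi> ^^ i) ((\<pi> ^^ j) s)))"
      if "(\<pi> ^^ i) ((\<pi> ^^ j) s) \<in> S" for i
      using mono[of "i + j"] that by (simp add: funpow_add)
  qed
  then show "f ((\<pi> ^^ j) s) \<le> f s" using bk by simp
qed

lemma lcomp_funpow:
  assumes "\<pi> permutes V" "s \<in> V"
  shows "lcomp (pgraph V \<pi> lab) ((\<pi> ^^ i) s) = lcomp (pgraph V \<pi> lab) s"
proof (induction i)
  case (Suc i)
  have "(\<pi> ^^ i) s \<in> V" using permutes_in_image[OF permutes_funpow[OF assms(1)]] assms(2) by blast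
  then have "lpath (pgraph V \<pi> lab) ((\<pi> ^^ i) s) (lab ((\<pi> ^^ i) s)) ((\<pi> ^^ Suc i) s)"
    by (intro lpath_edge) (simp add: pgraph_def)
  then show ?case using Suc lcomp_eqI by metis
qed simp

text \<open>After its first step the orbit runs outside \<open>S\<close> until the return, and there
  the maps agree. With \<open>t = R s\<close> this says that an arc ends at the same letter whether
  seen from its factor piece or from its central piece.\<close>

lemma first_return_transfer:
  assumes fin: "finite V" and perm: "\<pi> permutes V" and s: "s \<in> S" and S: "S \<subseteq> V"
    and t: "\<nu> t = \<pi> s" and ghost: "\<And>p. p \<in> V - S \<Longrightarrow> \<pi> p = \<nu> p"
  shows "first_return \<nu> S t = first_return \<pi> S s"
proof -
  obtain k where k: "0 < k" "first_return \<pi> S s = (\<pi> ^^ k) s" "(\<pi> ^^ k) s \<in> S"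
    "\<And>i. 0 < i \<Longrightarrow> i < k \<Longrightarrow> (\<pi> ^^ i) s \<notin> S"
    using first_return_obtain[OF fin perm s] by metis
  have eq: "(\<nu> ^^ i) t = (\<pi> ^^ i) s" if "0 < i" "i \<le> k" for i
    using that
  proof (induction i)
    case (Suc i)
    show ?case
    proof (cases "i = 0")
      case False
      have "(\<pi> ^^ i) s \<in> V" using permutes_in_image[OF permutes_funpow[OF perm]] s S by blast
      then show ?thesis using Suc False k(4)[of i] ghost by simp
    qed (simp add: t)
  qed simp
  show ?thesis
    unfolding k(2) eq[OF k(1) order_refl, symmetric]
    by (rule first_return_eqI) (use k eq in auto)
qed

lemma first_return_in:
  assumes "finite V" "\<pi> permutes V" "s \<in> S"
  shows "first_return \<pi> S s \<in> S" "\<exists>k. first_return \<pi> S s = (\<pi> ^^ k) s"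
  using first_return_obtain[OF assms] by metis+

text \<open>A point \<open>s\<close> of \<open>S\<close> stands for the arc ending at
  \<open>Q' s\<close>, which starts at \<open>s\<close> in its factor piece and at
  \<open>R s\<close> in its central piece. As \<open>lev (R s)\<close> is at most
  \<open>lev s + 1\<close>, the level cannot rise in the first and fall in the second; if
  \<open>lev (R s) = 0\<close>, then \<open>s\<close> has top level and neither happens. So
  \<open>A1\<close>, \<open>A2\<close>, \<open>A3\<close> are disjoint.\<close>

theorem cyclic_word_count:
  fixes lab :: "'p \<Rightarrow> 'g::group_add" and lev :: "'p \<Rightarrow> nat" and fac :: "'p \<Rightarrow> 'i"
  assumes fin: "finite V" and perm: "\<pi> permutes V" "\<nu> permutes V" and S: "S \<subseteq> V"
    and ghost: "\<And>p. p \<in> V - S \<Longrightarrow> \<pi> p = \<nu> p \<and> lab p = 0"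
    and R: "\<And>p. p \<in> S \<Longrightarrow> R p \<in> S \<and> \<nu> (R p) = \<pi> p"
    and lev: "\<And>p. p \<in> S \<Longrightarrow> lev p < L \<and> lev (R p) = Suc (lev p) mod L
      \<and> lab p = gx (lev p) \<and> fac p = fx (lev p)"
    and fac: "\<And>p. p \<in> V \<Longrightarrow> fac (\<pi> p) = fac p"
    and fx: "\<And>i. i < L \<Longrightarrow> fx (Suc i mod L) \<noteq> fx i"
    and gx: "\<And>i n. i < L \<Longrightarrow> n > 0 \<Longrightarrow> sum_list (replicate n (gx i)) \<noteq> 0"
  shows "card (lcomp (pgraph V \<pi> lab) ` {p \<in> S. balanced (pgraph V \<pi> lab) p})
    + card (lcomp (pgraph V \<nu> lab') ` S) + card {p \<in> S. lev (R p) = 0} \<le> card S"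
proof -
  define Q' where "Q' = first_return \<pi> S"
  define A1 where "A1 = {s \<in> S. lev s < lev (Q' s)}"
  define A2 where "A2 = {s \<in> S. lev (Q' s) < lev (R s)}"
  define A3 where "A3 = {s \<in> S. lev (R s) = 0}"
  have finS: "finite S" using fin S finite_subset by blast
  have Q'S: "Q' s \<in> S" if "s \<in> S" for s
    using first_return_in[OF fin perm(1) that] by (simp add: Q'_def)
  have L: "L > 0" if "s \<in> S" for s using lev[OF that] by linarith
  have injR: "inj_on R S"
  proof (rule inj_onI)
    fix p q assume "p \<in> S" "q \<in> S" "R p = R q"
    then have "\<pi> p = \<pi> q" using R by metis
    then show "p = q" using permutes_inj[OF perm(1)] by (metis injD)
  qed
  then have surjR: "R ` S = S" using R finS by (intro endo_inj_surj) auto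
  have retN: "first_return \<nu> S (R s) = Q' s" if "s \<in> S" for s
    unfolding Q'_def by (rule first_return_transfer[OF fin perm(1) that S]) (use R[OF that] ghost in auto)
  have fac_pow: "fac ((\<pi> ^^ k) p) = fac p" if "p \<in> V" for p k
  proof (induction k)
    case (Suc k)
    have "(\<pi> ^^ k) p \<in> V" using permutes_in_image[OF permutes_funpow[OF perm(1)]] that by blast
    then show ?case using Suc fac by simp
  qed simp
  have facQ: "fac (Q' s) = fac s" if "s \<in> S" for s
    using first_return_in(2)[OF fin perm(1) that] fac_pow[of s] that S unfolding Q'_def by fastforce
  have "card (lcomp (pgraph V \<pi> lab) ` {p \<in> S. balanced (pgraph V \<pi> lab) p}) \<le> card A1"
  proof -
    let ?\<Gamma> = "pgraph V \<pi> lab"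
    have "lcomp ?\<Gamma> s \<in> lcomp ?\<Gamma> ` A1" if s: "s \<in> S" "balanced ?\<Gamma> s" for s
    proof (rule ccontr)
      assume no: "lcomp ?\<Gamma> s \<notin> lcomp ?\<Gamma> ` A1"
      have sV: "s \<in> V" using s S by blast
      \<comment> \<open>Without an ascending arc on the orbit the level never rises between visits
        to \<open>S\<close>; the sign turns this into the required monotonicity.\<close>
      have desc: "- int (lev ((\<pi> ^^ i) s)) \<le> - int (lev (first_return \<pi> S ((\<pi> ^^ i) s)))" if "(\<pi> ^^ i) s \<in> S" for i
      proof (rule ccontr)
        assume "\<not> ?thesis"
        then have "(\<pi> ^^ i) s \<in> A1" using that by (simp add: A1_def Q'_def)
        moreover have "lcomp ?\<Gamma> s = lcomp ?\<Gamma> ((\<pi> ^^ i) s)"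
          using lcomp_funpow[OF perm(1) sV, of lab i] by simp
        ultimately show False using no by blast
      qed
      have const: "lev ((\<pi> ^^ i) s) = lev s" if "(\<pi> ^^ i) s \<in> S" for i
        using first_return_constant[OF fin perm(1) s(1) that, of "\<lambda>p. - int (lev p)"] desc by simp
      \<comment> \<open>The number of letters of \<open>S\<close> passed in the first
        \<open>i\<close> steps. Erased letters carry label 0, so the path reads a multiple of one
        single element, which \<open>gx\<close> forbids to vanish once the cycle closes.\<close>
      define m where "m i = card {j. j < i \<and> (\<pi> ^^ j) s \<in> S}" for i
      have "lpath ?\<Gamma> s (sum_list (replicate (m i) (gx (lev s)))) ((\<pi> ^^ i) s)" for i
      proof (induction i)
        case 0
        then show ?case by (simp add: m_def lpath_refl)
      next
        case (Suc i)
        have "(\<pi> ^^ i) s \<in> V" using permutes_in_image[OF permutes_funpow[OF perm(1)]] sV by blast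
        then have e: "((\<pi> ^^ i) s, lab ((\<pi> ^^ i) s), (\<pi> ^^ Suc i) s) \<in> ?\<Gamma>" by (simp add: pgraph_def)
        show ?case
        proof (cases "(\<pi> ^^ i) s \<in> S")
          case True
          have "{j. j < Suc i \<and> (\<pi> ^^ j) s \<in> S} = insert i {j. j < i \<and> (\<pi> ^^ j) s \<in> S}"
            using True by (auto simp: less_Suc_eq)
          then have "m (Suc i) = Suc (m i)" by (simp add: m_def)
          then have "replicate (m (Suc i)) (gx (lev s)) = replicate (m i) (gx (lev s)) @ [gx (lev s)]"
            by (simp add: replicate_append_same)
          moreover have "lab ((\<pi> ^^ i) s) = gx (lev s)" using lev[OF True] const[OF True] by simp
          ultimately show ?thesis using lpath_fwd[OF Suc e] by simp
        next
          case False
          then have "{j. j < Suc i \<and> (\<pi> ^^ j) s \<in> S} = {j. j < i \<and> (\<pi> ^^ j) s \<in> S}"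
            by (auto simp: less_Suc_eq)
          then have "m (Suc i) = m i" by (simp add: m_def)
          moreover have "lab ((\<pi> ^^ i) s) = 0" using ghost \<open>(\<pi> ^^ i) s \<in> V\<close> False by blast
          ultimately show ?thesis using lpath_fwd[OF Suc e] by simp
        qed
      qed
      moreover obtain n where n: "n > 0" "(\<pi> ^^ n) s = s" using permutes_return[OF fin perm(1)] by blast
      ultimately have "sum_list (replicate (m n) (gx (lev s))) = 0"
        using balancedD[OF s(2)] by metis
      moreover have "m n > 0"
        unfolding m_def card_gt_0_iff using n s by (auto intro!: exI[of _ 0])
      ultimately show False using gx[of "lev s" "m n"] lev[OF s(1)] by blast
    qed
    then have "lcomp ?\<Gamma> ` {p \<in> S. balanced ?\<Gamma> p} \<subseteq> lcomp ?\<Gamma> ` A1" by blast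
    moreover have "finite A1" using finS by (simp add: A1_def)
    ultimately show ?thesis by (meson card_image_le card_mono finite_imageI order_trans)
  qed
  moreover have "card (lcomp (pgraph V \<nu> lab') ` S) \<le> card A2"
  proof -
    let ?\<Delta> = "pgraph V \<nu> lab'"
    have "lcomp ?\<Delta> s \<in> lcomp ?\<Delta> ` R ` A2" if s: "s \<in> S" for s
    proof (rule ccontr)
      assume no: "lcomp ?\<Delta> s \<notin> lcomp ?\<Delta> ` R ` A2"
      have sV: "s \<in> V" using s S by blast
      have asc: "lev ((\<nu> ^^ i) s) \<le> lev (first_return \<nu> S ((\<nu> ^^ i) s))" if i: "(\<nu> ^^ i) s \<in> S" for i
      proof (rule ccontr)
        assume a: "\<not> ?thesis"
        have "(\<nu> ^^ i) s \<in> R ` S" using surjR i by simp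
        then obtain t where t: "t \<in> S" "(\<nu> ^^ i) s = R t" by blast
        then have "t \<in> A2" using a retN[OF t(1)] by (simp add: A2_def)
        moreover have "lcomp ?\<Delta> s = lcomp ?\<Delta> (R t)"
          using lcomp_funpow[OF perm(2) sV, of lab' i] t(2) by simp
        ultimately show False using no by blast
      qed
      obtain k where k: "first_return \<nu> S s = (\<nu> ^^ k) s" "first_return \<nu> S s \<in> S"
        using first_return_in[OF fin perm(2) s] by blast
      have eq: "lev (first_return \<nu> S s) = lev s"
        using first_return_constant[OF fin perm(2) s, of k lev] asc k by simp
      have "s \<in> R ` S" using surjR s by simp
      then obtain t where t: "t \<in> S" "s = R t" by blast
      \<comment> \<open>\<open>Q' t\<close> lies in the factor of \<open>t\<close>; having the level
        of \<open>R t\<close>, it also lies in the factor of the next letter of the word, which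
        \<open>fx\<close> forbids.\<close>
      have "fac (Q' t) = fac t" using facQ t by blast
      moreover have "lev (Q' t) = lev (R t)" using eq t retN by simp
      moreover have "Q' t \<in> S" "R t \<in> S" using t R Q'S by blast+
      ultimately have "fx (Suc (lev t) mod L) = fx (lev t)"
        using lev[OF t(1)] lev[of "Q' t"] by simp
      then show False using fx[of "lev t"] lev[OF t(1)] by blast
    qed
    then have "lcomp ?\<Delta> ` S \<subseteq> lcomp ?\<Delta> ` R ` A2" by blast
    moreover have "finite A2" using finS by (simp add: A2_def)
    ultimately show ?thesis
      by (meson card_image_le card_mono finite_imageI order_trans)
  qed
  moreover have "card A1 + card A2 + card A3 \<le> card S"
  proof -
    have "A1 \<inter> A2 = {}"
    proof -
      have False if "s \<in> S" "lev s < lev (Q' s)" "lev (Q' s) < lev (R s)" for s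
      proof -
        have "lev (R s) \<le> Suc (lev s)" using lev[OF that(1)] by (simp add: mod_less_eq_dividend)
        then show False using that by linarith
      qed
      then show ?thesis by (auto simp: A1_def A2_def)
    qed
    moreover have "(A1 \<union> A2) \<inter> A3 = {}"
    proof -
      have False if "s \<in> S" "lev s < lev (Q' s)" "lev (R s) = 0" for s
      proof -
        have "Suc (lev s) mod L = 0" "lev s < L" "lev (Q' s) < L"
          using lev[OF that(1)] lev[OF Q'S[OF that(1)]] that by auto
        moreover have "Suc (lev s) < L" using that calculation by linarith
        ultimately show False by simp
      qed
      then show ?thesis by (auto simp: A1_def A2_def A3_def)
    qed
    moreover have "A1 \<union> A2 \<union> A3 \<subseteq> S" by (auto simp: A1_def A2_def A3_def)
    moreover have "finite A1" "finite A2" "finite A3" using finS by (simp_all add: A1_def A2_def A3_def)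
    ultimately show ?thesis
      by (metis card_Un_disjoint card_mono finS finite_UnI)
  qed
  ultimately show ?thesis unfolding A3_def by linarith
qed

section \<open>Realisable families of cyclic words\<close>

text \<open>
  The boundary permutation is \<open>R = \<nu>\<^sup>-\<^sup>1 \<pi>\<close>: the transpositions of \<open>\<pi>\<close> respect the factors, those of \<open>\<nu>\<close>
  carry no labels.
\<close>

definition factored_data where
  "factored_data fac V R lab r EQ \<pi> u EM \<nu> lab' v \<longleftrightarrow> finite V \<and>
    swap_product V EQ \<pi> lab u \<and> swap_product V EM \<nu> (lab' :: 'p \<Rightarrow> 'g::group_add) v \<and>
    (\<forall>a y b. (a, y, b) \<in> EQ \<longrightarrow> fac a = fac b) \<and> (\<forall>a y b. (a, y, b) \<in> EM \<longrightarrow> y = (0::'g)) \<and>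
    (\<forall>p. \<nu> (R p) = \<pi> p) \<and> r = u + v \<and>
    (\<forall>p\<in>V. \<forall>q\<in>V. \<exists>y. lpath (EQ \<union> EM) p y q)"

lemma factored_dataD:
  assumes "factored_data fac V R lab r EQ \<pi> u EM \<nu> lab' v"
  shows "finite V" "swap_product V EQ \<pi> lab u" "swap_product V EM \<nu> lab' v"
    "\<And>a y b. (a, y, b) \<in> EQ \<Longrightarrow> fac a = fac b" "\<And>a y b. (a, y, b) \<in> EM \<Longrightarrow> y = 0"
    "\<And>p. \<nu> (R p) = \<pi> p" "r = u + v"
    "\<forall>p\<in>V. \<forall>q\<in>V. \<exists>y. lpath (EQ \<union> EM) p y q"
proof -
  note * = assms[unfolded factored_data_def]
  show "finite V" using * by (elim conjE)
  show "swap_product V EQ \<pi> lab u" using * by (elim conjE)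
  show "swap_product V EM \<nu> lab' v" using * by (elim conjE)
  have 1: "\<forall>a y b. (a, y, b) \<in> EQ \<longrightarrow> fac a = fac b" using * by (elim conjE)
  have 2: "\<forall>a y b. (a, y, b) \<in> EM \<longrightarrow> y = 0" using * by (elim conjE)
  show "fac a = fac b" if "(a, y, b) \<in> EQ" for a y b using 1 that by blast
  show "y = 0" if "(a, y, b) \<in> EM" for a y b using 2 that by blast
  show "\<nu> (R p) = \<pi> p" for p using * by (elim conjE) (elim allE)
  show "r = u + v" using * by (elim conjE)
  show "\<forall>p\<in>V. \<forall>q\<in>V. \<exists>y. lpath (EQ \<union> EM) p y q" using * by (elim conjE)
qed

definition factored :: "('p \<Rightarrow> 'i) \<Rightarrow> 'p set \<Rightarrow> ('p \<Rightarrow> 'p) \<Rightarrow> ('p \<Rightarrow> 'g::group_add) \<Rightarrow> nat \<Rightarrow> bool"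
  where "factored fac V R lab r \<longleftrightarrow> (\<exists>EQ \<pi> u EM \<nu> lab' v. factored_data fac V R lab r EQ \<pi> u EM \<nu> lab' v)"

lemma factored_I:
  assumes "finite V" "swap_product V EQ \<pi> lab u" "swap_product V EM \<nu> lab' v"
    "\<And>a y b. (a, y, b) \<in> EQ \<Longrightarrow> fac a = fac b" "\<And>a y b. (a, y, b) \<in> EM \<Longrightarrow> y = 0"
    "\<And>p. \<nu> (R p) = \<pi> p" "r = u + v"
    "\<forall>p\<in>V. \<forall>q\<in>V. \<exists>y. lpath (EQ \<union> EM) p y q"
  shows "factored fac V R lab r"
proof -
  have "factored_data fac V R lab r EQ \<pi> u EM \<nu> lab' v" unfolding factored_data_def using assms by blast
  then show ?thesis unfolding factored_def by blast
qed

lemma factored_init: "factored fac {p} id (\<lambda>_. 0) 0"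
proof (rule factored_I)
  show "swap_product {p} {} id (\<lambda>_. 0) 0" by (rule swap_product_id)
  show "swap_product {p} {} id (\<lambda>_. 0) 0" by (rule swap_product_id)
  have "\<exists>y. lpath ({} \<union> {}) p y p" using lpath_refl by (rule exI)
  then show "\<forall>p'\<in>{p}. \<forall>q\<in>{p}. \<exists>y. lpath ({} \<union> {}) p' y q" by simp
qed simp_all

lemma connected_insert:
  assumes conn: "\<forall>p\<in>V. \<forall>q\<in>V. \<exists>y. lpath E p y q" and e: "lpath E' a z b" and a: "a \<in> V"
    and sub: "E \<subseteq> E'"
  shows "\<forall>p\<in>insert b V. \<forall>q\<in>insert b V. \<exists>y. lpath E' p y q"
proof -
  have *: "lcomp E' p = lcomp E' a" if pV: "p \<in> insert b V" for p
  proof (cases "p = b")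
    case True
    then show ?thesis using lcomp_eqI[OF e] by simp
  next
    case False
    then obtain y where "lpath E p y a" using conn pV a by auto
    then have "lpath E' p y a" using sub by (rule lpath_mono)
    then show ?thesis by (rule lcomp_eqI)
  qed
  show ?thesis
  proof (intro ballI)
    fix p q assume "p \<in> insert b V" "q \<in> insert b V"
    then have "lcomp E' p = lcomp E' q" using * by simp
    then show "\<exists>y. lpath E' p y q" by (simp only: lcomp_eq_iff)
  qed
qed

text \<open>For a transposition \<open>\<tau>\<close>,
  \<open>(\<nu> \<tau>) (\<tau> R) = \<nu> R\<close>, so exchanging two targets of \<open>R\<close>
  is absorbed by \<open>\<nu>\<close>: a surgery of central pieces, possible across factors. The
  point \<open>b\<close> may be new.\<close>

lemma factored_swap_left:
  assumes "factored fac V R lab r" "a \<in> V"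
  shows "factored fac (insert b V) (transpose a b \<circ> R) lab (Suc r)"
proof -
  obtain EQ \<pi> u EM \<nu> lab' v where "factored_data fac V R lab r EQ \<pi> u EM \<nu> lab' v"
    using assms(1) unfolding factored_def by (elim exE) (rule that)
  note s = factored_dataD[OF this]
  show ?thesis
  proof (rule factored_I)
    show "swap_product (insert b V) EQ \<pi> lab u" by (rule swap_product_mono[OF s(2)]) blast
    show "swap_product (insert b V) (insert (a, 0, b) EM) (\<nu> \<circ> transpose a b)
        (lab'(a := 0 + lab' b, b := - 0 + lab' a)) (Suc v)"
      by (rule swap_product_step, rule swap_product_mono[OF s(3)]) (use assms in auto)
    show "\<forall>p\<in>insert b V. \<forall>q\<in>insert b V. \<exists>y. lpath (EQ \<union> insert (a, 0, b) EM) p y q"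
      by (rule connected_insert[OF s(8) _ assms(2), of _ 0]) (auto intro: lpath_edge)
    show "(\<nu> \<circ> transpose a b) ((transpose a b \<circ> R) p) = \<pi> p" for p
      using s(6) by (simp only: comp_apply transpose_involutory)
    show "Suc r = u + Suc v" using s(7) by simp
    show "y = 0" if "(p, y, q) \<in> insert (a, 0, b) EM" for p y q using that s(5) by blast
  qed (use s(1) in simp, rule s(4))
qed

text \<open>Exchanging two sources of \<open>R\<close> is absorbed by \<open>\<pi>\<close>: a
  surgery inside a factor piece, which may carry a label \<open>y\<close>.\<close>

lemma factored_swap_right:
  assumes "factored fac V R lab r" "a \<in> V" "fac a = fac b"
  shows "factored fac (insert b V) (R \<circ> transpose a b) (lab(a := y + lab b, b := - y + lab a)) (Suc r)"
proof -
  obtain EQ \<pi> u EM \<nu> lab' v where "factored_data fac V R lab r EQ \<pi> u EM \<nu> lab' v"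
    using assms(1) unfolding factored_def by (elim exE) (rule that)
  note s = factored_dataD[OF this]
  show ?thesis
  proof (rule factored_I)
    show "swap_product (insert b V) EM \<nu> lab' v" by (rule swap_product_mono[OF s(3)]) blast
    show "swap_product (insert b V) (insert (a, y, b) EQ) (\<pi> \<circ> transpose a b)
        (lab(a := y + lab b, b := - y + lab a)) (Suc u)"
      by (rule swap_product_step, rule swap_product_mono[OF s(2)]) (use assms in auto)
    show "\<forall>p\<in>insert b V. \<forall>q\<in>insert b V. \<exists>w. lpath (insert (a, y, b) EQ \<union> EM) p w q"
      by (rule connected_insert[OF s(8) _ assms(2), of _ y]) (auto intro: lpath_edge)
    show "\<nu> ((R \<circ> transpose a b) p) = (\<pi> \<circ> transpose a b) p" for p
      using s(6) by (simp only: comp_apply)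
    show "Suc r = Suc u + v" using s(7) by simp
    show "fac p = fac q" if "(p, w, q) \<in> insert (a, y, b) EQ" for p w q using that s(4) assms(3) by blast
  qed (use s(1) in simp, rule s(5))
qed

lemma factored_outside:
  assumes "factored fac V R lab r" "p \<notin> V"
  shows "R p = p" "lab p = 0"
proof -
  obtain EQ \<pi> u EM \<nu> lab' v where "factored_data fac V R lab r EQ \<pi> u EM \<nu> lab' v"
    using assms(1) unfolding factored_def by (elim exE) (rule that)
  note s = factored_dataD[OF this]
  show "lab p = 0" using swap_product_lab_outside[OF s(2) assms(2)] .
  have "\<nu> (R p) = \<nu> p"
    unfolding s(6) permutes_not_in[OF swap_product_permutes[OF s(2)] assms(2)]
      permutes_not_in[OF swap_product_permutes[OF s(3)] assms(2)] ..
  then show "R p = p" by (rule injD[OF permutes_inj[OF swap_product_permutes[OF s(3)]]])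
qed

text \<open>Keeping the target \<open>b\<close> of the last arrow apart from the list allows cycles,
  where \<open>b = hd xs\<close>, to be cut open and joined.\<close>

fun chain :: "('p \<Rightarrow> 'p) \<Rightarrow> 'p list \<Rightarrow> 'p \<Rightarrow> bool" where
  "chain R [] b \<longleftrightarrow> True"
| "chain R (x # xs) b \<longleftrightarrow> R x = hd (xs @ [b]) \<and> chain R xs b"

lemma chain_append: "chain R (xs @ ys) b \<longleftrightarrow> chain R xs (hd (ys @ [b])) \<and> chain R ys b"
  by (induction xs) (auto simp: hd_append)

lemma chain_cong: "(\<And>x. x \<in> set xs \<Longrightarrow> R x = R' x) \<Longrightarrow> chain R xs b = chain R' xs b"
  by (induction xs) auto

text \<open>The targets inside the list are those in \<open>tl xs\<close>; a transposition that
  avoids them affects only the last arrow.\<close>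

lemma chain_redirect:
  assumes "chain R xs b" "b \<notin> set (tl xs)" "c \<notin> set (tl xs)"
  shows "chain (transpose b c \<circ> R) xs c"
  using assms
proof (induction xs)
  case (Cons x xs)
  then show ?case by (cases xs) auto
qed simp

lemma chain_avoid:
  assumes "chain R xs b" "\<And>x. x \<in> insert b (set xs) \<Longrightarrow> x \<noteq> h \<and> x \<noteq> k"
  shows "chain (transpose h k \<circ> R) xs b"
  using assms
proof (induction xs)
  case (Cons x xs)
  then show ?case by (cases xs) auto
qed simp

lemma chain_nth: "chain R xs b \<Longrightarrow> i < length xs \<Longrightarrow> R (xs ! i) = (xs @ [b]) ! Suc i"
proof (induction xs arbitrary: i)
  case (Cons x xs)
  then show ?case by (cases i; cases xs) auto
qed simp

text \<open>A point is a serial number, giving an endless supply of fresh points, together with its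
  factor. Points outside \<open>concat idss\<close> are the erased letters.\<close>

definition realises ::
    "(nat \<times> 'i) set \<Rightarrow> (nat \<times> 'i \<Rightarrow> nat \<times> 'i) \<Rightarrow> (nat \<times> 'i \<Rightarrow> 'g::group_add) \<Rightarrow> nat \<Rightarrow> (nat \<times> 'i) list list \<Rightarrow> bool"
  where "realises V R lab r idss \<longleftrightarrow> factored snd V R lab r \<and> distinct (concat idss) \<and> set (concat idss) \<subseteq> V \<and>
    (\<forall>xs\<in>set idss. xs \<noteq> [] \<and> chain R xs (hd xs)) \<and>
    (\<forall>p\<in>V - set (concat idss). R p = p \<and> lab p = 0)"

lemma realisesD:
  assumes "realises V R lab r idss"
  shows "factored snd V R lab r" "distinct (concat idss)" "set (concat idss) \<subseteq> V"
    "\<And>xs. xs \<in> set idss \<Longrightarrow> xs \<noteq> [] \<and> chain R xs (hd xs)"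
    "\<And>p. p \<in> V - set (concat idss) \<Longrightarrow> R p = p \<and> lab p = 0" "finite V"
  using assms by (simp_all add: realises_def factored_def factored_data_def)

text \<open>
  \<open>\<delta>\<close> bounds \<open>- \<chi>\<close> of a surface whose boundary components read the words in \<open>C\<close>: there are \<open>r\<close>
  transpositions, and every point of \<open>V\<close> that is no longer on the boundary accounts for two of them,
  every other point for one.
\<close>

definition realisable :: "('i \<times> 'g::group_add) list list \<Rightarrow> int \<Rightarrow> bool"
  where "realisable C \<delta> \<longleftrightarrow> (\<exists>(V :: (nat \<times> 'i) set) R lab r idss. realises V R lab r idss \<and>
    C = map (map (\<lambda>p. (snd p, lab p))) idss \<and>
    int r + int (length (concat idss)) \<le> \<delta> + 2 * int (card V))"

lemma realisable_I:
  fixes lab :: "nat \<times> 'i \<Rightarrow> 'g::group_add"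
  assumes "factored snd V R lab r" "distinct (concat idss)" "set (concat idss) \<subseteq> V"
    "\<And>xs. xs \<in> set idss \<Longrightarrow> xs \<noteq> [] \<and> chain R xs (hd xs)"
    "\<And>p. p \<in> V - set (concat idss) \<Longrightarrow> R p = p \<and> lab p = 0"
    "C = map (map (\<lambda>p. (snd p, lab p))) idss"
    "int r + int (length (concat idss)) \<le> \<delta> + 2 * int (card V)"
  shows "realisable C \<delta>"
  unfolding realisable_def realises_def using assms by blast

section \<open>Surgeries on realisable families and their cost\<close>

lemma realisable_mono: "realisable C \<delta> \<Longrightarrow> \<delta> \<le> \<delta>' \<Longrightarrow> realisable C \<delta>'"
  unfolding realisable_def by (elim exE conjE, intro exI conjI) (assumption, assumption, linarith)

lemma realisable_swap:
  assumes "realisable (u # v # C) \<delta>"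
  shows "realisable (v # u # C) \<delta>"
proof -
  obtain V R lab r idss where s0: "realises V R lab r idss" "u # v # C = map (map (\<lambda>p. (snd p, lab p))) idss"
    "int r + int (length (concat idss)) \<le> \<delta> + 2 * int (card V)"
    using assms unfolding realisable_def by (elim exE conjE) (rule that)
  note s = realisesD[OF s0(1)] s0(2,3)
  obtain x y rest where i: "idss = x # y # rest" using s(7) by auto
  show ?thesis
    by (rule realisable_I[OF s(1), of "y # x # rest"]) (use s i in auto)
qed

lemma realisable_rotate:
  assumes "realisable ((u @ v) # C) \<delta>"
  shows "realisable ((v @ u) # C) \<delta>"
proof -
  obtain V R lab r idss where s0: "realises V R lab r idss" "(u @ v) # C = map (map (\<lambda>p. (snd p, lab p))) idss"
    "int r + int (length (concat idss)) \<le> \<delta> + 2 * int (card V)"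
    using assms unfolding realisable_def by (elim exE conjE) (rule that)
  note s = realisesD[OF s0(1)] s0(2,3)
  then obtain w rest where w: "idss = w # rest" by (cases idss) auto
  then obtain x y where xy: "w = x @ y" "u = map (\<lambda>p. (snd p, lab p)) x" "v = map (\<lambda>p. (snd p, lab p)) y"
    using s(7) by (auto simp: append_eq_map_conv)
  have "chain R (x @ y) (hd (x @ y))" using s(4)[of w] w xy by simp
  then have "chain R (y @ x) (hd (y @ x))" by (cases x; cases y) (auto simp: chain_append hd_append)
  then show ?thesis
    by (intro realisable_I[OF s(1), of "(y @ x) # rest"]) (use s w xy in auto)
qed

text \<open>Two points, two letters and one transposition carrying \<open>g\<close>:
  \<open>1 + 2 - 2 * 2 = - 1\<close>, a disc.\<close>

lemma realisable_base: "realisable [[(\<alpha>, g), (\<alpha>, - g)]] (- 1)"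
proof -
  let ?a = "(0, \<alpha>) :: nat \<times> 'a" and ?b = "(1, \<alpha>) :: nat \<times> 'a"
  have "factored snd (insert ?b {?a}) (id \<circ> transpose ?a ?b)
      ((\<lambda>_. 0)(?a := g + 0, ?b := - g + 0)) (Suc 0)"
    by (rule factored_swap_right[OF factored_init]) simp_all
  then show ?thesis
    by (rule realisable_I[where idss = "[[?a, ?b]]"]) auto
qed

text \<open>Cutting one cycle and joining two are the same surgery, exchanging the first points of
  the two pieces as targets. It uses one transposition and no new point, hence the cost 1.\<close>

lemma realisable_split_join:
  assumes "realisable C \<delta>" "u \<noteq> []" "v \<noteq> []" and C: "C = (u @ v) # D \<and> C' = u # v # D \<or> C = u # v # D \<and> C' = (u @ v) # D"
  shows "realisable C' (\<delta> + 1)"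
proof -
  obtain V R lab r idss where s0: "realises V R lab r idss" "C = map (map (\<lambda>p. (snd p, lab p))) idss"
    "int r + int (length (concat idss)) \<le> \<delta> + 2 * int (card V)"
    using assms(1) unfolding realisable_def by (elim exE conjE) (rule that)
  note s = realisesD[OF s0(1)] s0(2,3)
  let ?f = "map (\<lambda>p. (snd p, lab p))"
  obtain x y rest where xy: "u = ?f x" "v = ?f y" "D = map ?f rest"
    and i: "idss = (x @ y) # rest \<and> C = (u @ v) # D \<or> idss = x # y # rest \<and> C = u # v # D"
  proof (cases "C = (u @ v) # D")
    case True
    then obtain w rest where w: "idss = w # rest" "?f w = u @ v" "D = map ?f rest" using s(7) by auto
    then obtain x y where "w = x @ y" "?f x = u" "?f y = v"
      by (auto simp: map_eq_append_conv)
    then show ?thesis using that[of x y rest] w True by auto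
  next
    case False
    then have "C = u # v # D" using C by blast
    moreover obtain x y rest where "idss = x # y # rest" "?f x = u" "?f y = v" "D = map ?f rest"
      using s(7) calculation by auto
    ultimately show ?thesis using that[of x y rest] by blast
  qed
  have ne: "x \<noteq> []" "y \<noteq> []" using assms xy by auto
  let ?h = "hd x" and ?k = "hd y"
  let ?R = "transpose ?h ?k \<circ> R"
  have dist: "distinct (x @ y @ concat rest)" using i
  proof
    assume "idss = (x @ y) # rest \<and> C = (u @ v) # D"
    then show ?thesis using s(2) by (simp only: concat.simps append_assoc)
  next
    assume "idss = x # y # rest \<and> C = u # v # D"
    then show ?thesis using s(2) by (simp only: concat.simps append_assoc)
  qed
  have hk: "?h \<in> V" "?k \<in> V" using s(3) i ne hd_in_set[of x] hd_in_set[of y] by auto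
  have tl: "?h \<notin> set (tl x)" "?k \<notin> set (tl x)" "?h \<notin> set (tl y)" "?k \<notin> set (tl y)"
    using dist ne by (cases x; cases y; auto)+
  have "factored snd (insert ?k V) ?R lab (Suc r)" by (rule factored_swap_left[OF s(1) hk(1)])
  then have st: "factored snd V ?R lab (Suc r)" using hk by (simp add: insert_absorb)
  have chains: "chain R x ?k \<and> chain R y ?h \<and> C' = u # v # D \<or> chain R x ?h \<and> chain R y ?k \<and> C' = (u @ v) # D"
  proof (cases "idss = (x @ y) # rest \<and> C = (u @ v) # D")
    case True
    then have "chain R (x @ y) ?h" using s(4)[of "x @ y"] ne by simp
    then have "chain R x ?k \<and> chain R y ?h" using ne by (simp add: chain_append)
    moreover have "C' = u # v # D" using C True assms(2,3) by (metis append_eq_append_conv list.inject not_Cons_self2)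
    ultimately show ?thesis by blast
  next
    case False
    then have "idss = x # y # rest" "C = u # v # D" using i by blast+
    then have "chain R x ?h \<and> chain R y ?k" using s(4)[of x] s(4)[of y] by simp
    moreover have "C' = (u @ v) # D" using C \<open>C = u # v # D\<close> assms(2,3)
      by (metis append_self_conv list.inject)
    ultimately show ?thesis by blast
  qed
  have rest: "xs \<noteq> [] \<and> chain ?R xs (hd xs)" if "xs \<in> set rest" for xs
  proof -
    have xs: "xs \<noteq> []" "chain R xs (hd xs)" using s(4)[of xs] that i by auto
    have dj: "z \<notin> set x \<and> z \<notin> set y" if "z \<in> set (concat rest)" for z
      using dist that unfolding distinct_append set_append by blast
    have "z \<noteq> ?h \<and> z \<noteq> ?k" if "z \<in> insert (hd xs) (set xs)" for z
    proof -
      have "z \<in> set xs" using that xs(1) hd_in_set[of xs] by blast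
      then have "z \<in> set (concat rest)" using \<open>xs \<in> set rest\<close> by auto
      then show ?thesis using dj[of z] ne hd_in_set[of x] hd_in_set[of y] by metis
    qed
    then show ?thesis using xs(1) chain_avoid[OF xs(2), of ?h ?k] by blast
  qed
  define jdss where "jdss = (if C' = u # v # D then x # y # rest else (x @ y) # rest)"
  have cc: "concat jdss = concat idss" using i by (auto simp: jdss_def)
  have hk': "?h \<in> set (concat idss)" "?k \<in> set (concat idss)"
    using i ne hd_in_set[of x] hd_in_set[of y] by auto
  have ghost: "?R p = p \<and> lab p = 0" if "p \<in> V - set (concat idss)" for p
  proof -
    have "R p = p" "lab p = 0" using s(5)[OF that] by auto
    moreover have "p \<noteq> ?h" "p \<noteq> ?k" using that hk' by blast+
    ultimately show ?thesis by simp
  qed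
  have jch: "xs \<noteq> [] \<and> chain ?R xs (hd xs)" if "xs \<in> set jdss" for xs
  proof (cases "xs \<in> set rest")
    case False
    show ?thesis
    proof (cases "C' = u # v # D")
      case True
      then have "C' \<noteq> (u @ v) # D" using assms(2,3) by simp
      then have ch: "chain R x ?k" "chain R y ?h" using chains by blast+
      have "chain ?R x ?h" using chain_redirect[OF ch(1) tl(2,1)] by (simp add: transpose_commute)
      moreover have "chain ?R y ?k" using chain_redirect[OF ch(2) tl(3,4)] .
      ultimately show ?thesis using that False True ne by (auto simp: jdss_def)
    next
      case F: False
      then have ch: "chain R x ?h" "chain R y ?k" using chains by blast+
      have "chain ?R x ?k" using chain_redirect[OF ch(1) tl(1,2)] .
      moreover have "chain ?R y ?h" using chain_redirect[OF ch(2) tl(4,3)] by (simp add: transpose_commute)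
      ultimately show ?thesis using that False F ne by (auto simp: jdss_def chain_append)
    qed
  qed (rule rest)
  show ?thesis
  proof (rule realisable_I[OF st])
    show "distinct (concat jdss)" "set (concat jdss) \<subseteq> V" using s(2,3) by (simp_all only: cc)
    show "xs \<noteq> [] \<and> chain ?R xs (hd xs)" if "xs \<in> set jdss" for xs using that by (rule jch)
    show "?R p = p \<and> lab p = 0" if "p \<in> V - set (concat jdss)" for p
      using that unfolding cc by (rule ghost)
    show "C' = map ?f jdss"
    proof (cases "C' = u # v # D")
      case True
      then show ?thesis by (simp add: jdss_def xy)
    next
      case False
      then have "C' = (u @ v) # D" using chains by blast
      then show ?thesis using False by (simp add: jdss_def xy)
    qed
    show "int (Suc r) + int (length (concat jdss)) \<le> \<delta> + 1 + 2 * int (card V)"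
      using s(8) unfolding cc by linarith
  qed
qed

lemma realisable_split: "realisable ((u @ v) # D) \<delta> \<Longrightarrow> u \<noteq> [] \<Longrightarrow> v \<noteq> [] \<Longrightarrow> realisable (u # v # D) (\<delta> + 1)"
  by (rule realisable_split_join[where C = "(u @ v) # D" and D = D]) auto

lemma realisable_join: "realisable (u # v # D) \<delta> \<Longrightarrow> u \<noteq> [] \<Longrightarrow> v \<noteq> [] \<Longrightarrow> realisable ((u @ v) # D) (\<delta> + 1)"
  by (rule realisable_split_join[where C = "u # v # D" and D = D]) auto

lemma chain_image: "chain R xs b \<Longrightarrow> x \<in> set xs \<Longrightarrow> R x \<in> insert b (set xs)"
proof (induction xs)
  case (Cons y ys)
  then show ?case by (cases ys) auto
qed simp

text \<open>A cycle is closed under its map, so the premise \<open>R x \<in> set xs\<close> comes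
  for free; with it, a transposition of targets outside the cycle is seen not to disturb it.\<close>

lemma cyclic_chain_cong:
  assumes "xs \<noteq> [] \<and> chain R xs (hd xs)"
    and "\<And>x. x \<in> set xs \<Longrightarrow> R x \<in> set xs \<Longrightarrow> R' x = R x"
  shows "xs \<noteq> [] \<and> chain R' xs (hd xs)"
proof -
  have "R' x = R x" if "x \<in> set xs" for x
    using chain_image[of R xs "hd xs" x] assms(1) hd_in_set[of xs] that assms(2)[OF that] by auto
  then show ?thesis using assms(1) chain_cong[of xs R R' "hd xs"] by auto
qed

lemma map_map_cong_concat: "(\<And>p. p \<in> set (concat xss) \<Longrightarrow> f p = g p) \<Longrightarrow> map (map f) xss = map (map g) xss"
  by auto

lemma chain_congI: "chain R xs b \<Longrightarrow> (\<And>x. x \<in> set xs \<Longrightarrow> R' x = R x) \<Longrightarrow> chain R' xs b"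
  using chain_cong[of xs R R' b] by simp

lemma realisableE:
  assumes "realisable C \<delta>"
  obtains V R lab r idss where "realises V R lab r idss" "C = map (map (\<lambda>p. (snd p, lab p))) idss"
    "int r + int (length (concat idss)) \<le> \<delta> + 2 * int (card V)"
  using assms unfolding realisable_def by (elim exE conjE) (rule that)

text \<open>
  One transposition inside the factor removes the labels of the two letters, the second one takes
  the first letter out of the cycle.  If no other letter is left, a boundary component is capped off.
\<close>

lemma realisable_cancel_aux:
  assumes "realisable (((\<alpha>, g) # (\<alpha>, - g) # u) # C) \<delta>"
  shows "if u = [] then realisable C (\<delta> - 1) else realisable (u # C) \<delta>"
proof -
  obtain V R lab r idss where s0: "realises V R lab r idss"
    "((\<alpha>, g) # (\<alpha>, - g) # u) # C = map (map (\<lambda>p. (snd p, lab p))) idss"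
    "int r + int (length (concat idss)) \<le> \<delta> + 2 * int (card V)"
    using assms by (rule realisableE)
  note s = realisesD[OF s0(1)] s0(2,3)
  let ?f = "map (\<lambda>p. (snd p, lab p))"
  obtain a b x rest where i: "idss = (a # b # x) # rest" "u = ?f x" "C = map ?f rest"
    and ab: "snd a = \<alpha>" "snd b = \<alpha>" "lab a = g" "lab b = - g"
    using s(7) by (auto simp: Cons_eq_map_conv)
  define T where "T = set x \<union> set (concat rest)"
  have xT: "p \<in> set x \<Longrightarrow> p \<in> T" and restT: "p \<in> set (concat rest) \<Longrightarrow> p \<in> T" for p
    by (simp_all add: T_def)
  have dist: "a \<noteq> b" "a \<notin> T" "b \<notin> T" "distinct (x @ concat rest)"
    using s(2) unfolding i T_def by auto
  have dx: "distinct x" using dist(4) by simp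
  have dj: "p \<in> set (concat rest) \<Longrightarrow> p \<notin> set x" for p using dist(4) unfolding distinct_append by blast
  have V: "a \<in> V" "b \<in> V" "T \<subseteq> V" using s(3) unfolding i T_def by auto
  \<comment> \<open>The label \<open>g\<close> on the transposition turns the two labels into
    \<open>g + (- g)\<close> and \<open>- g + g\<close>.\<close>
  let ?R1 = "R \<circ> transpose a b"
  let ?l = "lab(a := g + lab b, b := - g + lab a)"
  have "factored snd (insert b V) ?R1 ?l (Suc r)"
    by (rule factored_swap_right[OF s(1) V(1)]) (simp add: ab)
  then have st1: "factored snd V ?R1 ?l (Suc r)" using V by (simp add: insert_absorb)
  have labs: "?l p = lab p" if "p \<in> T" for p using that dist by auto
  have labab: "?l a = 0" "?l b = 0" using dist(1) ab by auto
  have ch: "R a = b" "R b = hd (x @ [a])" "chain R x a" using s(4)[of "a # b # x"] i by auto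
  have R1: "?R1 p = R p" if "p \<in> T" for p
  proof -
    have "p \<noteq> a" "p \<noteq> b" using that dist by blast+
    then show ?thesis by simp
  qed
  have Crest: "map (map (\<lambda>p. (snd p, ?l p))) rest = C" "map (\<lambda>p. (snd p, ?l p)) x = u"
    unfolding i by (rule map_map_cong_concat, simp only: labs restT, rule map_cong[OF refl], simp only: labs xT)
  have ghost0: "R p = p" "lab p = 0" "p \<noteq> a" "p \<noteq> b" "p \<in> V"
    if "p \<in> V - T" "p \<notin> {a, b}" for p
    using s(5)[of p] that unfolding i T_def by auto
  show ?thesis
  proof (cases "u = []")
    \<comment> \<open>Both points are now fixed by \<open>?R1\<close>, so two letters have gone for
      one transposition and \<open>\<delta>\<close> drops by 1.\<close>
    case True
    then have x: "x = []" using i by simp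
    have "realisable C (\<delta> - 1)"
    proof (rule realisable_I[OF st1])
      show "distinct (concat rest)" "set (concat rest) \<subseteq> V" using dist V by (auto simp: T_def)
      show "xs \<noteq> [] \<and> chain ?R1 xs (hd xs)" if "xs \<in> set rest" for xs
      proof (rule cyclic_chain_cong)
        show "xs \<noteq> [] \<and> chain R xs (hd xs)" using s(4) i that by simp
        show "?R1 y = R y" if "y \<in> set xs" for y
          by (rule R1) (use that \<open>xs \<in> set rest\<close> in \<open>auto simp: T_def\<close>)
      qed
      show "?R1 p = p \<and> ?l p = 0" if "p \<in> V - set (concat rest)" for p
      proof (cases "p \<in> {a, b}")
        case True
        then show ?thesis using ch x labab by auto
      next
        case False
        then show ?thesis using ghost0[of p] that x by (simp add: T_def)
      qed
      show "int (Suc r) + int (length (concat rest)) \<le> \<delta> - 1 + 2 * int (card V)"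
        using s(8) x unfolding i by simp
    qed (simp only: Crest)
    then show ?thesis using True by simp
  next
    case False
    then have x: "x \<noteq> []" using i by simp
    let ?c = "hd x"
    \<comment> \<open>\<open>?R1\<close> fixes \<open>b\<close>; exchanging the targets
      \<open>a\<close> and \<open>hd x\<close> closes up the rest of the cycle without
      \<open>a\<close>.\<close>
    let ?R2 = "transpose a ?c \<circ> ?R1"
    have c: "?c \<in> T" "?c \<in> V" using x V by (auto simp: T_def)
    then have ca: "?c \<noteq> a" "?c \<noteq> b" using dist by blast+
    have "factored snd (insert ?c V) ?R2 ?l (Suc (Suc r))" by (rule factored_swap_left[OF st1 V(1)])
    then have st2: "factored snd V ?R2 ?l (Suc (Suc r))" using c by (simp add: insert_absorb)
    have "realisable (u # C) \<delta>"
    proof (rule realisable_I[OF st2])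
      show "distinct (concat (x # rest))" "set (concat (x # rest)) \<subseteq> V"
        using dist V by (auto simp: T_def)
      show "xs \<noteq> [] \<and> chain ?R2 xs (hd xs)" if "xs \<in> set (x # rest)" for xs
      proof (cases "xs = x")
        case True
        have "chain ?R1 x a" by (rule chain_congI[OF ch(3)]) (rule R1, rule xT)
        moreover have "a \<notin> set (tl x)" using dist(2) list.set_sel(2)[OF x] xT by metis
        moreover have "?c \<notin> set (tl x)" using dx x by (cases x) auto
        ultimately have "chain ?R2 x ?c" by (rule chain_redirect)
        then show ?thesis using True x by simp
      next
        case F: False
        then have xs: "xs \<in> set rest" using that by simp
        show ?thesis
        proof (rule cyclic_chain_cong)
          show "xs \<noteq> [] \<and> chain R xs (hd xs)" using s(4) i xs by simp
          fix y assume y: "y \<in> set xs" "R y \<in> set xs"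
          then have "y \<in> T" "R y \<in> set (concat rest)" using xs by (auto simp: T_def)
          moreover have "R y \<noteq> ?c" using dj[OF calculation(2)] hd_in_set[OF x] by metis
          moreover have "R y \<noteq> a" using dist(2) restT[OF calculation(2)] by metis
          ultimately show "?R2 y = R y" using R1[of y] by simp
        qed
      qed
      show "?R2 p = p \<and> ?l p = 0" if p: "p \<in> V - set (concat (x # rest))" for p
      proof (cases "p \<in> {a, b}")
        case True
        have "?R1 a = ?c" "?R1 b = b" using ch x by simp_all
        then have "?R2 a = a" "?R2 b = b" using ca dist(1) by simp_all
        then show ?thesis using labab True by auto
      next
        case False
        have pT: "p \<in> V - T" using p by (simp add: T_def)
        have pc: "p \<noteq> ?c" using pT c by blast
        note g = ghost0[OF pT False]
        have "?R1 p = p" using g by simp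
        then show ?thesis using g pc by simp
      qed
      show "int (Suc (Suc r)) + int (length (concat (x # rest))) \<le> \<delta> + 2 * int (card V)"
        using s(8) unfolding i by simp
    qed (simp only: Crest list.map)
    then show ?thesis using False by simp
  qed
qed

lemma realisable_cancel: "realisable (((\<alpha>, g) # (\<alpha>, - g) # u) # C) \<delta> \<Longrightarrow> u \<noteq> [] \<Longrightarrow> realisable (u # C) \<delta>"
  using realisable_cancel_aux[of \<alpha> g u C \<delta>] by simp

lemma realisable_cancel_pair: "realisable ([(\<alpha>, g), (\<alpha>, - g)] # C) \<delta> \<Longrightarrow> realisable C (\<delta> - 1)"
  using realisable_cancel_aux[of \<alpha> g "[]" C \<delta>] by simp

text \<open>A degenerate transposition of the point with itself, carrying its own label, makes that
  label 0. It uses one transposition and saves one letter: the component becomes a puncture and,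
  unlike a disc, gains nothing.\<close>

lemma realisable_single:
  assumes "realisable ([(\<alpha>, g)] # C) \<delta>"
  shows "realisable C \<delta>"
proof -
  obtain V R lab r idss where s0: "realises V R lab r idss"
    "[(\<alpha>, g)] # C = map (map (\<lambda>p. (snd p, lab p))) idss"
    "int r + int (length (concat idss)) \<le> \<delta> + 2 * int (card V)"
    using assms by (rule realisableE)
  note s = realisesD[OF s0(1)] s0(2,3)
  let ?f = "map (\<lambda>p. (snd p, lab p))"
  obtain a rest where i: "idss = [a] # rest" "C = map ?f rest"
    using s(7) by (auto simp: Cons_eq_map_conv)
  have a: "a \<in> V" "a \<notin> set (concat rest)" "distinct (concat rest)" "set (concat rest) \<subseteq> V"
    using s(2,3) unfolding i by auto
  let ?l = "lab(a := lab a + lab a, a := - lab a + lab a)"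
  have "factored snd (insert a V) (R \<circ> transpose a a) ?l (Suc r)"
    by (rule factored_swap_right[OF s(1) a(1)]) simp
  then have st: "factored snd V R ?l (Suc r)" using a by (simp add: insert_absorb)
  have labs: "?l p = lab p" if "p \<in> set (concat rest)" for p using that a by auto
  show ?thesis
  proof (rule realisable_I[OF st])
    show "distinct (concat rest)" "set (concat rest) \<subseteq> V" by fact+
    show "xs \<noteq> [] \<and> chain R xs (hd xs)" if "xs \<in> set rest" for xs using s(4) i that by simp
    show "R p = p \<and> ?l p = 0" if "p \<in> V - set (concat rest)" for p
    proof (cases "p = a")
      case True
      then show ?thesis using s(4)[of "[a]"] i by simp
    next
      case False
      then show ?thesis using s(5)[of p] that i by simp
    qed
    show "C = map (map (\<lambda>p. (snd p, ?l p))) rest"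
      unfolding i by (rule map_map_cong_concat) (simp only: labs)
    show "int (Suc r) + int (length (concat rest)) \<le> \<delta> + 2 * int (card V)"
      using s(8) unfolding i by simp
  qed
qed

lemma fresh_id: "finite V \<Longrightarrow> \<exists>b :: nat \<times> 'i. b \<notin> V \<and> snd b = \<alpha>"
proof -
  assume "finite V"
  then have "finite (fst ` V)" by simp
  then obtain n where "n \<notin> fst ` V" using ex_new_if_finite[OF infinite_UNIV_nat] by blast
  then show ?thesis by (intro exI[of _ "(n, \<alpha>)"]) force
qed

text \<open>The new point adds 2 on the right, the transposition and the new letter add 2 on the
  left, so \<open>\<delta>\<close> is unchanged.\<close>

lemma realisable_split_letter:
  assumes "realisable (((\<alpha>, g + h) # u) # C) \<delta>"
  shows "realisable (((\<alpha>, g) # (\<alpha>, h) # u) # C) \<delta>"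
proof -
  obtain V R lab r idss where s0: "realises V R lab r idss"
    "((\<alpha>, g + h) # u) # C = map (map (\<lambda>p. (snd p, lab p))) idss"
    "int r + int (length (concat idss)) \<le> \<delta> + 2 * int (card V)"
    using assms by (rule realisableE)
  note s = realisesD[OF s0(1)] s0(2,3)
  let ?f = "map (\<lambda>p. (snd p, lab p))"
  obtain a x rest where i: "idss = (a # x) # rest" "u = ?f x" "C = map ?f rest"
    and a: "snd a = \<alpha>" "lab a = g + h"
    using s(7) by (auto simp: Cons_eq_map_conv)
  obtain b where b: "b \<notin> V" "snd b = \<alpha>" using fresh_id[OF s(6)] by blast
  note out = factored_outside[OF s(1) b(1)]
  define T where "T = set x \<union> set (concat rest)"
  have xT: "p \<in> set x \<Longrightarrow> p \<in> T" and restT: "p \<in> set (concat rest) \<Longrightarrow> p \<in> T" for p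
    by (simp_all add: T_def)
  have TV: "a \<in> V" "T \<subseteq> V" "a \<notin> T" "distinct (x @ concat rest)" using s(2,3) unfolding i T_def by auto
  have abT: "a \<noteq> b" "b \<notin> T" using TV b by blast+
  let ?R = "R \<circ> transpose a b"
  let ?l = "lab(a := g + lab b, b := - g + lab a)"
  have st: "factored snd (insert b V) ?R ?l (Suc r)"
    by (rule factored_swap_right[OF s(1) TV(1)]) (simp add: a b)
  have labs: "?l p = lab p" if "p \<in> T" for p using that abT TV by auto
  \<comment> \<open>The fresh point had label 0, so the labels become \<open>g + 0\<close> and
    \<open>- g + (g + h)\<close>.\<close>
  have labab: "?l a = g" "?l b = h" using abT(1) a out by (auto simp flip: add.assoc)
  have Rsame: "?R p = R p" if "p \<noteq> a" "p \<noteq> b" for p using that by simp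
  have ch: "R a = hd (x @ [a])" "chain R x a" using s(4)[of "a # x"] i by auto
  show ?thesis
  proof (rule realisable_I[OF st])
    let ?idss = "(a # b # x) # rest"
    have setI: "set (concat ?idss) = insert b (set (concat idss))" unfolding i by auto
    show "distinct (concat ?idss)" using TV abT unfolding T_def by auto
    show "set (concat ?idss) \<subseteq> insert b V" unfolding setI using s(3) by blast
    show "xs \<noteq> [] \<and> chain ?R xs (hd xs)" if "xs \<in> set ?idss" for xs
    proof (cases "xs = a # b # x")
      case True
      have "chain ?R x a"
        by (rule chain_congI[OF ch(2)], rule Rsame) (use xT TV(3) abT(2) in metis)+
      then show ?thesis using True ch(1) out by simp
    next
      case False
      then have xs: "xs \<in> set rest" using that by simp
      show ?thesis
      proof (rule cyclic_chain_cong)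
        show "xs \<noteq> [] \<and> chain R xs (hd xs)" using s(4) i xs by simp
        fix y assume "y \<in> set xs"
        then have "y \<in> T" using xs by (auto simp: T_def)
        then have "y \<noteq> a" "y \<noteq> b" using TV(3) abT(2) by blast+
        then show "?R y = R y" by (rule Rsame)
      qed
    qed
    show "?R p = p \<and> ?l p = 0" if p: "p \<in> insert b V - set (concat ?idss)" for p
    proof -
      have "p \<noteq> a" "p \<noteq> b" "p \<in> V - set (concat idss)" using p unfolding i by auto
      then show ?thesis using s(5)[of p] by simp
    qed
    show "((\<alpha>, g) # (\<alpha>, h) # u) # C = map (map (\<lambda>p. (snd p, ?l p))) ?idss"
    proof -
      have "map (\<lambda>p. (snd p, ?l p)) x = u" "map (map (\<lambda>p. (snd p, ?l p))) rest = C"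
        unfolding i by (rule map_cong[OF refl], simp only: labs xT, rule map_map_cong_concat, simp only: labs restT)
      then show ?thesis using labab a b by (simp del: fun_upd_apply)
    qed
    show "int (Suc r) + int (length (concat ?idss)) \<le> \<delta> + 2 * int (card (insert b V))"
      using s(8) b(1) s(6) unfolding i by simp
  qed
qed

text \<open>A central swap puts a fresh point before the first letter of the cycle, then a swap in
  the factor adds a second one and the labels \<open>g\<close> and \<open>- g\<close>. Two points
  balance two transpositions and two letters.\<close>

lemma realisable_insert_pair:
  assumes "realisable (u # C) \<delta>"
  shows "realisable (((\<alpha>, g) # (\<alpha>, - g) # u) # C) \<delta>"
proof -
  obtain V R lab r idss where s0: "realises V R lab r idss"
    "u # C = map (map (\<lambda>p. (snd p, lab p))) idss"
    "int r + int (length (concat idss)) \<le> \<delta> + 2 * int (card V)"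
    using assms by (rule realisableE)
  note s = realisesD[OF s0(1)] s0(2,3)
  let ?f = "map (\<lambda>p. (snd p, lab p))"
  obtain x rest where i: "idss = x # rest" "u = ?f x" "C = map ?f rest"
    using s(7) by (auto simp: Cons_eq_map_conv)
  have x: "x \<noteq> []" "chain R x (hd x)" using s(4)[of x] i by auto
  obtain a where a: "a \<notin> V" "snd a = \<alpha>" using fresh_id[OF s(6)] by blast
  have "finite (insert a V)" using s(6) by simp
  from fresh_id[OF this] obtain b where b: "b \<notin> insert a V" "snd b = \<alpha>" by blast
  have bV: "b \<notin> V" "a \<noteq> b" using b by auto
  define T where "T = set x \<union> set (concat rest)"
  have xT: "p \<in> set x \<Longrightarrow> p \<in> T" and restT: "p \<in> set (concat rest) \<Longrightarrow> p \<in> T" for p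
    by (simp_all add: T_def)
  let ?c = "hd x"
  have T: "T \<subseteq> V" "distinct (x @ concat rest)" using s(2,3) unfolding i T_def by auto
  have dj: "p \<in> set (concat rest) \<Longrightarrow> p \<notin> set x" for p using T(2) unfolding distinct_append by blast
  have c: "?c \<in> V" "?c \<in> T" using T x hd_in_set[of x] by (auto simp: T_def)
  have ne: "a \<notin> T" "b \<notin> T" "?c \<noteq> a" "?c \<noteq> b" using T(1) a(1) bV c by blast+
  let ?R1 = "transpose ?c a \<circ> R"
  let ?R = "?R1 \<circ> transpose a b"
  let ?l = "lab(a := g + lab b, b := - g + lab a)"
  have st1: "factored snd (insert a V) ?R1 lab (Suc r)" by (rule factored_swap_left[OF s(1) c(1)])
  have st2: "factored snd (insert b (insert a V)) ?R ?l (Suc (Suc r))"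
    by (rule factored_swap_right[OF st1]) (simp_all add: a b)
  note outa = factored_outside[OF s(1) a(1)] and outb = factored_outside[OF s(1) bV(1)]
  have labab: "?l a = g" "?l b = - g" using bV outa outb by auto
  have labs: "?l p = lab p" if "p \<in> T" for p using that ne by auto
  have Rab: "?R a = b" "?R b = ?c" using outa outb bV ne by (simp_all add: transpose_def)
  have Rsame: "?R p = ?R1 p" if "p \<noteq> a" "p \<noteq> b" for p using that by simp
  show ?thesis
  proof (rule realisable_I[OF st2])
    let ?idss = "(a # b # x) # rest"
    have setI: "set (concat ?idss) = insert b (insert a (set (concat idss)))" unfolding i by auto
    show "distinct (concat ?idss)" using T ne bV unfolding T_def by auto
    show "set (concat ?idss) \<subseteq> insert b (insert a V)" unfolding setI using s(3) by blast
    show "xs \<noteq> [] \<and> chain ?R xs (hd xs)" if "xs \<in> set ?idss" for xs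
    proof (cases "xs = a # b # x")
      case True
      have "?c \<notin> set (tl x)" using T(2) x by (cases x) auto
      moreover have "a \<notin> set (tl x)" using ne(1) list.set_sel(2)[OF x(1)] xT by metis
      ultimately have "chain ?R1 x a" by (rule chain_redirect[OF x(2)])
      then have "chain ?R x a"
        by (rule chain_congI, intro Rsame) (use xT ne(1,2) in metis)+
      then show ?thesis using True Rab x(1) by (simp del: comp_apply)
    next
      case False
      then have xs: "xs \<in> set rest" using that by simp
      show ?thesis
      proof (rule cyclic_chain_cong)
        show "xs \<noteq> [] \<and> chain R xs (hd xs)" using s(4) i xs by simp
        fix y assume y: "y \<in> set xs" "R y \<in> set xs"
        then have yT: "y \<in> T" "R y \<in> set (concat rest)" using xs by (auto simp: T_def)
        then have "y \<noteq> a" "y \<noteq> b" using ne by blast+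
        moreover have "R y \<noteq> ?c" using dj[OF yT(2)] hd_in_set[OF x(1)] by metis
        moreover have "R y \<noteq> a" using ne(1) restT[OF yT(2)] by metis
        ultimately show "?R y = R y" by simp
      qed
    qed
    show "?R p = p \<and> ?l p = 0" if p: "p \<in> insert b (insert a V) - set (concat ?idss)" for p
    proof -
      have *: "p \<noteq> a" "p \<noteq> b" "p \<in> V - set (concat idss)" using p unfolding i by auto
      moreover have "p \<noteq> ?c" using *(3) c(2) unfolding i T_def by auto
      ultimately show ?thesis using s(5)[of p] by simp
    qed
    show "((\<alpha>, g) # (\<alpha>, - g) # u) # C = map (map (\<lambda>p. (snd p, ?l p))) ?idss"
    proof -
      have "map (\<lambda>p. (snd p, ?l p)) x = u" "map (map (\<lambda>p. (snd p, ?l p))) rest = C"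
        unfolding i by (rule map_cong[OF refl], simp only: labs xT, rule map_map_cong_concat, simp only: labs restT)
      then show ?thesis using labab a b by (simp del: fun_upd_apply)
    qed
    show "int (Suc (Suc r)) + int (length (concat ?idss)) \<le> \<delta> + 2 * int (card (insert b (insert a V)))"
      using s(8) b(1) a(1) s(6) unfolding i by simp
  qed
qed

section \<open>Bounding families of powers of one word\<close>

lemma swap_product_fac:
  assumes "swap_product V E \<pi> lab u" "\<And>a y b. (a, y, b) \<in> E \<Longrightarrow> fac a = fac b"
  shows "fac (\<pi> p) = fac p"
  using assms
proof (induction arbitrary: p rule: swap_product.induct)
  case (swap_product_step E \<pi> lab u a b y)
  have "fac a = fac b" by (rule swap_product_step.prems[of _ y]) simp
  moreover have "fac (\<pi> q) = fac q" for q
    by (rule swap_product_step.IH) (rule swap_product_step.prems, blast)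
  ultimately show ?case by (simp add: transpose_def)
qed simp

lemma nth_concat_replicate:
  "i < j * length x \<Longrightarrow> concat (replicate j x) ! i = x ! (i mod length x)"
proof (induction j arbitrary: i)
  case (Suc j)
  show ?case
  proof (cases "i < length x")
    case False
    then have "i - length x < j * length x" using Suc.prems by simp
    then have "concat (replicate j x) ! (i - length x) = x ! (i mod length x)"
      using Suc.IH[of "i - length x"] False by (simp add: le_mod_geq)
    then show ?thesis using False by (simp add: nth_append)
  qed (simp add: nth_append)
qed simp

lemma distinct_concat_nth:
  assumes "distinct (concat xss)" "xs \<in> set xss" "ys \<in> set xss" "i < length xs" "j < length ys"
    "xs ! i = ys ! j"
  shows "i = j"
proof -
  have "xs ! i \<in> set xs" "ys ! j \<in> set ys" using assms(4,5) by simp_all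
  then have "xs ! i \<in> set ys" using assms(6) by simp
  then have "set xs \<inter> set ys \<noteq> {}" using \<open>xs ! i \<in> set xs\<close> by blast
  then have "xs = ys" using assms(1-3) unfolding distinct_concat_iff by blast
  moreover have "distinct xs" using assms(1,2) unfolding distinct_concat_iff by blast
  ultimately show ?thesis using assms(4-6) by (simp add: nth_eq_iff_index_eq)
qed

text \<open>Combining the inequality in \<open>realisable\<close> with the two counting theorems
  bounds the number of letters followed by level 0 by \<open>\<delta>\<close>; there are at least
  \<open>m\<close> of them.\<close>

theorem realisable_bound:
  fixes x :: "('i \<times> 'g::group_add) list"
  assumes realisable: "realisable C \<delta>" and C: "C \<noteq> []" and x: "x \<noteq> []"
    and powers: "\<And>w. w \<in> set C \<Longrightarrow> \<exists>j. w = concat (replicate j x)"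
    and m: "length (concat C) = m * length x"
    and fx: "\<And>i. i < length x \<Longrightarrow> fst (x ! (Suc i mod length x)) \<noteq> fst (x ! i)"
    and gx: "\<And>i n. i < length x \<Longrightarrow> n > 0 \<Longrightarrow> sum_list (replicate n (snd (x ! i))) \<noteq> 0"
  shows "int m \<le> \<delta>"
proof -
  obtain V R lab r idss where s0: "realises V R lab r idss"
    "C = map (map (\<lambda>p. (snd p, lab p))) idss"
    "int r + int (length (concat idss)) \<le> \<delta> + 2 * int (card V)"
    using realisable by (rule realisableE)
  note s = realisesD[OF s0(1)] s0(2,3)
  obtain EQ \<pi> u EM \<nu> lab' v where st: "factored_data snd V R lab r EQ \<pi> u EM \<nu> lab' v"
    using s(1) unfolding factored_def by (elim exE) (rule that)
  note d = factored_dataD[OF st]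
  note perm = swap_product_permutes[OF d(2)] swap_product_permutes[OF d(3)]
  define S where "S = set (concat idss)"
  define L where "L = length x"
  have L: "L > 0" using x by (simp add: L_def)
  \<comment> \<open>The position modulo \<open>L\<close> within its word, unambiguous because the
    points of all words are distinct.\<close>
  define lev where "lev p = (SOME n. \<exists>xs\<in>set idss. \<exists>i<length xs. xs ! i = p \<and> n = i mod L)" for p
  have lev_nth: "lev (xs ! i) = i mod L" if xs: "xs \<in> set idss" "i < length xs" for xs i
    unfolding lev_def
  proof (rule some_equality)
    show "\<exists>ys\<in>set idss. \<exists>j<length ys. ys ! j = xs ! i \<and> i mod L = j mod L" using xs by blast
    show "n = i mod L" if "\<exists>ys\<in>set idss. \<exists>j<length ys. ys ! j = xs ! i \<and> n = j mod L" for n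
      using that distinct_concat_nth[OF s(2) _ xs(1) _ xs(2)] by blast
  qed
  have letter: "lev p < L \<and> lev (R p) = Suc (lev p) mod L \<and> lab p = snd (x ! lev p) \<and> snd p = fst (x ! lev p)
      \<and> R p \<in> S" if p: "p \<in> S" for p
  proof -
    obtain xs where xs: "xs \<in> set idss" "p \<in> set xs" using p by (auto simp: S_def)
    then obtain i where i: "i < length xs" "p = xs ! i" by (metis in_set_conv_nth)
    let ?w = "map (\<lambda>p. (snd p, lab p)) xs"
    have "?w \<in> set C" using xs(1) by (simp add: s(7))
    then obtain j where j: "?w = concat (replicate j x)" using powers by blast
    have len: "length xs = j * L"
    proof -
      have "length xs = length (concat (replicate j x))" using arg_cong[OF j, of length] by simp
      then show ?thesis by (simp add: length_concat sum_list_replicate L_def)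
    qed
    have "?w ! i = x ! (i mod L)"
      using nth_concat_replicate[of i j x] i len unfolding j L_def by simp
    then have let': "(snd p, lab p) = x ! (i mod L)" using i by simp
    have lp: "lev p = i mod L" using lev_nth[OF xs(1) i(1)] i by simp
    have "R p = (xs @ [hd xs]) ! Suc i" using chain_nth[of R xs "hd xs" i] s(4)[OF xs(1)] i by simp
    moreover have "lev ((xs @ [hd xs]) ! Suc i) = Suc i mod L \<and> (xs @ [hd xs]) ! Suc i \<in> S"
    proof (cases "Suc i < length xs")
      case True
      then have "xs ! Suc i \<in> set xs" by (rule nth_mem)
      then have "xs ! Suc i \<in> S" using xs by (auto simp: S_def)
      then show ?thesis using lev_nth[OF xs(1) True] True by (simp add: nth_append)
    next
      case False
      then have e: "Suc i = length xs" using i by simp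
      then have "(xs @ [hd xs]) ! Suc i = xs ! 0" 
        using i by (cases xs) (simp_all add: nth_append)
      moreover have "lev (xs ! 0) = 0" using lev_nth[OF xs(1), of 0] i by (cases xs) simp_all
      moreover have "Suc i mod L = 0" using e len by simp
      moreover have "xs ! 0 \<in> set xs" using i by (cases xs) simp_all
      ultimately show ?thesis using xs by (auto simp: S_def)
    qed
    ultimately have "lev (R p) = Suc i mod L \<and> R p \<in> S" by (simp only:)
    moreover have "snd p = fst (x ! (i mod L))" "lab p = snd (x ! (i mod L))"
      using arg_cong[OF let', of fst] arg_cong[OF let', of snd] by simp_all
    ultimately show ?thesis using lp L by (simp add: mod_Suc_eq)
  qed
  have SV: "S \<subseteq> V" using s(3) by (simp add: S_def)
  have finS: "finite S" using SV s(6) finite_subset by blast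
  have cardS: "card S = m * L"
  proof -
    have "length (concat C) = length (concat idss)"
      unfolding s(7) by (simp add: length_concat comp_def)
    then show ?thesis using distinct_card[OF s(2)] m by (simp add: S_def L_def)
  qed
  have Sne: "S \<noteq> {}"
  proof -
    obtain xs where "xs \<in> set idss" using C s(7) by (cases idss) auto
    moreover have "xs \<noteq> []" using s(4) calculation by blast
    ultimately show ?thesis unfolding S_def by (cases xs) auto
  qed
  have injR: "inj R"
  proof (rule injI)
    fix p q assume "R p = R q"
    then have "\<pi> p = \<pi> q" using d(6)[of p] d(6)[of q] by simp
    then show "p = q" by (rule injD[OF permutes_inj[OF perm(1)]])
  qed
  have ghost: "\<pi> p = \<nu> p \<and> lab p = 0" if "p \<in> V - S" for p
    using s(5)[of p] d(6)[of p] that by (simp add: S_def)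
  have "2 * card V \<le> u + v + card (lcomp (pgraph V \<pi> lab) ` {p \<in> S. balanced (pgraph V \<pi> lab) p})
      + card (lcomp (pgraph V \<nu> lab') ` S)"
    by (rule swap_product_pair_count[OF s(6) d(2,3,5) SV Sne ghost]) (use d(8) in blast)+
  moreover have "card (lcomp (pgraph V \<pi> lab) ` {p \<in> S. balanced (pgraph V \<pi> lab) p})
    + card (lcomp (pgraph V \<nu> lab') ` S) + card {p \<in> S. lev (R p) = 0} \<le> card S"
  proof (rule cyclic_word_count[OF s(6) perm SV ghost])
    show "R p \<in> S \<and> \<nu> (R p) = \<pi> p" if "p \<in> S" for p using letter[OF that] d(6) by blast
    show "lev p < L \<and> lev (R p) = Suc (lev p) mod L \<and> lab p = snd (x ! lev p) \<and> snd p = fst (x ! lev p)"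
      if "p \<in> S" for p using letter[OF that] by blast
    show "snd (\<pi> p) = snd p" for p using swap_product_fac[OF d(2), of snd p] d(4) by blast
    show "fst (x ! (Suc i mod L)) \<noteq> fst (x ! i)" if "i < L" for i
      using fx[of i] that by (simp add: L_def)
    show "sum_list (replicate n (snd (x ! i))) \<noteq> 0" if "i < L" "n > 0" for i n
      using gx[of i n] that by (simp add: L_def)
  qed
  moreover have "m \<le> card {p \<in> S. lev (R p) = 0}"
  proof -
    \<comment> \<open>\<open>R\<close> injects each level class below the top into the next, so the
      class of level \<open>L - 1\<close> is the largest and has at least the average size
      \<open>m\<close>.\<close>
    define A where "A i = {p \<in> S. lev p = i}" for i
    have up: "card (A i) \<le> card (A (Suc i))" if "Suc i < L" for i
    proof (rule card_inj_on_le)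
      show "inj_on R (A i)" using injR by (rule inj_on_subset) simp
      show "R ` A i \<subseteq> A (Suc i)" using letter that by (auto simp: A_def)
      show "finite (A (Suc i))" using finS by (simp add: A_def)
    qed
    have le: "card (A i) \<le> card (A (L - 1))" if "i < L" for i
    proof -
      have "i \<le> L - 1" using that by simp
      then show ?thesis
      proof (induction rule: inc_induct)
        case (step n)
        then have "Suc n < L" by linarith
        then show ?case using up[of n] step by linarith
      qed simp
    qed
    have "S = (\<Union>i<L. A i)" using letter by (auto simp: A_def)
    moreover have "card (\<Union>i<L. A i) = (\<Sum>i<L. card (A i))"
      by (rule card_UN_disjoint) (use finS in \<open>auto simp: A_def\<close>)
    ultimately have "card S = (\<Sum>i<L. card (A i))" by simp
    also have "\<dots> \<le> (\<Sum>i<L. card (A (L - 1)))" by (rule sum_mono) (use le in simp)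
    finally have "m * L \<le> L * card (A (L - 1))" using cardS by simp
    then have "m \<le> card (A (L - 1))" using L by simp
    also have "A (L - 1) \<subseteq> {p \<in> S. lev (R p) = 0}"
    proof
      fix p assume "p \<in> A (L - 1)"
      then have "p \<in> S" "lev p = L - 1" by (auto simp: A_def)
      then show "p \<in> {p \<in> S. lev (R p) = 0}" using letter[of p] L by simp
    qed
    then have "card (A (L - 1)) \<le> card {p \<in> S. lev (R p) = 0}"
      using finS by (intro card_mono) auto
    finally show ?thesis .
  qed
  moreover have "length (concat idss) = card S"
    using distinct_card[OF s(2)] by (simp add: S_def)
  ultimately show ?thesis using s(8) d(7) by linarith
qed

section \<open>Calculus of words\<close>

definition word_inv :: "('i \<times> 'g::group_add) list \<Rightarrow> ('i \<times> 'g) list"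
  where "word_inv w = rev (map (\<lambda>(\<alpha>, g). (\<alpha>, - g)) w)"

abbreviation word_val :: "('i \<times> 'g::group_add) list \<Rightarrow> 'g"
  where "word_val w \<equiv> sum_list (map snd w)"

lemma word_inv_simps [simp]:
  "word_inv [] = []" "word_inv (u @ v) = word_inv v @ word_inv u"
  "word_inv (p # u) = word_inv u @ [(fst p, - snd p)]" "word_inv (word_inv w) = w"
  "word_inv w = [] \<longleftrightarrow> w = []"
  by (auto simp: word_inv_def rev_map comp_def split_def)

lemma word_val_inv [simp]: "word_val (word_inv w) = - word_val w"
  by (induction w) (simp_all add: minus_add)

text \<open>Rotation brings the last letter of \<open>e\<close> in front of its inverse, where it
  cancels at no cost; \<open>y \<noteq> []\<close> ensures that no component is closed up on the
  way.\<close>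

lemma realisable_conj:
  assumes "realisable ((word_inv e @ y @ e) # C) \<delta>" "y \<noteq> []"
  shows "realisable (y # C) \<delta>"
  using assms(1)
proof (induction e rule: rev_induct)
  case (snoc p f)
  have "realisable ((((fst p, - snd p) # word_inv f @ y @ f) @ [p]) # C) \<delta>" using snoc.prems by simp
  then have "realisable (([p] @ ((fst p, - snd p) # word_inv f @ y @ f)) # C) \<delta>" by (rule realisable_rotate)
  then have "realisable (((fst p, snd p) # (fst p, - snd p) # word_inv f @ y @ f) # C) \<delta>" by simp
  then have "realisable ((word_inv f @ y @ f) # C) \<delta>" by (rule realisable_cancel) (use assms(2) in simp)
  then show ?case by (rule snoc.IH)
qed simp

text \<open>Letters cancel as for conjugates, but the final pair closes up the component with a
  disc, which gains 1.\<close>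

lemma realisable_inverse:
  assumes "realisable ((word_inv e @ e) # C) \<delta>" "e \<noteq> []"
  shows "realisable C (\<delta> - 1)"
  using assms
proof (induction e rule: rev_induct)
  case (snoc p f)
  have "realisable ((((fst p, - snd p) # word_inv f @ f) @ [p]) # C) \<delta>" using snoc.prems by simp
  then have "realisable (([p] @ ((fst p, - snd p) # word_inv f @ f)) # C) \<delta>" by (rule realisable_rotate)
  then have *: "realisable (((fst p, snd p) # (fst p, - snd p) # word_inv f @ f) # C) \<delta>" by simp
  show ?case
  proof (cases "f = []")
    case True
    then have "realisable ([(fst p, snd p), (fst p, - snd p)] # C) \<delta>" using * by simp
    then show ?thesis by (rule realisable_cancel_pair)
  next
    case False
    then have "realisable ((word_inv f @ f) # C) \<delta>" using realisable_cancel[OF *] by simp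
    then show ?thesis using snoc.IH False by blast
  qed
qed simp

text \<open>A handle: two cuts and one joining cost 3 and leave \<open>word_inv a @ a\<close>, whose
  disc gives back 1; the letters of \<open>b\<close> cancel by conjugation in between.\<close>

lemma realisable_commutator:
  assumes "realisable ((w @ word_inv a @ word_inv b @ a @ b) # C) \<delta>" "w \<noteq> []"
  shows "realisable (w # C) (\<delta> + 2)"
proof -
  consider "a = []" | "b = []" | "a \<noteq> []" "b \<noteq> []" by blast
  then show ?thesis
  proof cases
    case 1
    then have "realisable (((w @ word_inv b) @ b) # C) \<delta>" using assms by simp
    then have "realisable ((b @ w @ word_inv b) # C) \<delta>" by (rule realisable_rotate)
    then have "realisable (w # C) \<delta>" using realisable_conj[of "word_inv b" w] assms by simp
    then show ?thesis by (rule realisable_mono) simp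
  next
    case 2
    then have "realisable (((w @ word_inv a) @ a) # C) \<delta>" using assms by simp
    then have "realisable ((a @ w @ word_inv a) # C) \<delta>" by (rule realisable_rotate)
    then have "realisable (w # C) \<delta>" using realisable_conj[of "word_inv a" w] assms by simp
    then show ?thesis by (rule realisable_mono) simp
  next
    case 3
    have "realisable (w # (word_inv a @ word_inv b @ a @ b) # C) (\<delta> + 1)"
      by (rule realisable_split) (use assms 3 in simp_all)
    then have "realisable ((word_inv a @ word_inv b @ a @ b) # w # C) (\<delta> + 1)" by (rule realisable_swap)
    then have "realisable (word_inv a # (word_inv b @ a @ b) # w # C) (\<delta> + 1 + 1)"
      by (rule realisable_split) (use 3 in simp_all)
    then have "realisable ((word_inv b @ a @ b) # word_inv a # w # C) (\<delta> + 1 + 1)" by (rule realisable_swap)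
    then have "realisable (a # word_inv a # w # C) (\<delta> + 1 + 1)" by (rule realisable_conj) (use 3 in simp)
    then have "realisable (word_inv a # a # w # C) (\<delta> + 1 + 1)" by (rule realisable_swap)
    then have "realisable ((word_inv a @ a) # w # C) (\<delta> + 1 + 1 + 1)" by (rule realisable_join) (use 3 in simp_all)
    then have "realisable (w # C) (\<delta> + 1 + 1 + 1 - 1)" by (rule realisable_inverse) (use 3 in simp)
    then show ?thesis by (simp add: add.commute)
  qed
qed

lemma realisable_conjugate:
  assumes "realisable ((w @ word_inv e @ x @ e) # C) \<delta>" "w \<noteq> []" "x \<noteq> []"
  shows "realisable (x # w # C) (\<delta> + 1)"
proof -
  have "realisable (w # (word_inv e @ x @ e) # C) (\<delta> + 1)" by (rule realisable_split) (use assms in simp_all)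
  then have "realisable ((word_inv e @ x @ e) # w # C) (\<delta> + 1)" by (rule realisable_swap)
  then show ?thesis by (rule realisable_conj) fact
qed

lemma realisable_commutators:
  "realisable ((w @ concat (map (\<lambda>(a, b). word_inv a @ word_inv b @ a @ b) ps)) # C) \<delta> \<Longrightarrow> w \<noteq> [] \<Longrightarrow>
    realisable (w # C) (\<delta> + 2 * int (length ps))"
proof (induction ps arbitrary: \<delta> rule: rev_induct)
  case (snoc p ps)
  obtain a b where p: "p = (a, b)" by (cases p)
  let ?w = "w @ concat (map (\<lambda>(a, b). word_inv a @ word_inv b @ a @ b) ps)"
  have "realisable ((?w @ word_inv a @ word_inv b @ a @ b) # C) \<delta>" using snoc.prems(1) by (simp add: p)
  then have "realisable (?w # C) (\<delta> + 2)" by (rule realisable_commutator) (use snoc.prems in simp)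
  then have "realisable (w # C) (\<delta> + 2 + 2 * int (length ps))" by (rule snoc.IH) (rule snoc.prems)
  then show ?case by (simp add: algebra_simps)
qed simp

text \<open>Each nonempty entry is cut off at cost 1, conjugated to a single letter and erased for
  free.\<close>

lemma realisable_elliptics:
  "realisable ((w @ concat es) # C) \<delta> \<Longrightarrow> w \<noteq> [] \<Longrightarrow>
    (\<And>v. v \<in> set es \<Longrightarrow> v = [] \<or> (\<exists>e p. v = word_inv e @ [p] @ e)) \<Longrightarrow> realisable (w # C) (\<delta> + int (length es))"
proof (induction es arbitrary: \<delta> rule: rev_induct)
  case (snoc v es)
  have "realisable ((w @ concat es) # C) (\<delta> + 1)"
  proof (cases "v = []")
    case True
    then have "realisable ((w @ concat es) # C) \<delta>" using snoc.prems(1) by simp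
    then show ?thesis by (rule realisable_mono) simp
  next
    case False
    then obtain e p where v: "v = word_inv e @ [p] @ e" using snoc.prems(3)[of v] by auto
    have "realisable (((w @ concat es) @ word_inv e @ [p] @ e) # C) \<delta>" using snoc.prems(1) by (simp add: v)
    then have "realisable ([p] # (w @ concat es) # C) (\<delta> + 1)"
      by (rule realisable_conjugate) (use snoc.prems in simp_all)
    then show ?thesis by (cases p) (auto intro: realisable_single)
  qed
  then have "realisable (w # C) (\<delta> + 1 + int (length es))"
    by (rule snoc.IH) (use snoc.prems in auto)
  then show ?case by (simp add: algebra_simps)
qed simp

lemma concat_replicate_commute: "concat (replicate j x) @ x = x @ concat (replicate j x)"
  by (induction j) simp_all

text \<open>An empty \<open>e\<close> marks a copy of \<open>x\<close> itself, which extends the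
  leading power for free; every other copy is cut off as its own component at cost 1. The exponent
  \<open>Suc j\<close> keeps the leading word nonempty.\<close>

lemma realisable_conjugates:
  assumes x: "x \<noteq> []"
  shows "realisable ((concat (replicate (Suc j) x) @ concat (map (\<lambda>e. word_inv e @ x @ e) es)) # C) \<delta> \<Longrightarrow>
    realisable (concat (replicate (Suc j + length (filter (\<lambda>e. e = []) es)) x) #
      replicate (length (filter (\<lambda>e. e \<noteq> []) es)) x @ C) (\<delta> + int (length (filter (\<lambda>e. e \<noteq> []) es)))"
proof (induction es arbitrary: j C \<delta>)
  case (Cons e es)
  show ?case
  proof (cases "e = []")
    case True
    have "concat (replicate (Suc j) x) @ x = concat (replicate (Suc (Suc j)) x)"
      by (simp add: concat_replicate_commute)
    moreover have "realisable (((concat (replicate (Suc j) x) @ x) @ concat (map (\<lambda>e. word_inv e @ x @ e) es)) # C) \<delta>"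
      using Cons.prems True by simp
    ultimately have "realisable ((concat (replicate (Suc (Suc j)) x) @ concat (map (\<lambda>e. word_inv e @ x @ e) es)) # C) \<delta>"
      by (simp only:)
    then show ?thesis using Cons.IH[of "Suc j"] True by simp
  next
    case False
    let ?p = "concat (replicate (Suc j) x)" and ?r = "concat (map (\<lambda>e. word_inv e @ x @ e) es)"
    have "realisable (((?p @ word_inv e @ x @ e) @ ?r) # C) \<delta>" using Cons.prems by simp
    \<comment> \<open>Rotation brings the conjugate to the end of the word, where it can be cut
      off.\<close>
    then have "realisable ((?r @ ?p @ word_inv e @ x @ e) # C) \<delta>" by (rule realisable_rotate)
    then have "realisable (((?r @ ?p) @ word_inv e @ x @ e) # C) \<delta>" by simp
    then have "realisable (x # (?r @ ?p) # C) (\<delta> + 1)" by (rule realisable_conjugate) (use x in simp_all)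
    then have "realisable ((?r @ ?p) # x # C) (\<delta> + 1)" by (rule realisable_swap)
    then have "realisable ((?p @ ?r) # x # C) (\<delta> + 1)" by (rule realisable_rotate)
    from Cons.IH[OF this] show ?thesis
      using False by (simp add: replicate_app_Cons_same algebra_simps)
  qed
qed simp

section \<open>Families of subgroups generating a free product\<close>

lemma add_eq_0_commute: "a + b = 0 \<longleftrightarrow> b + a = (0 :: 'g::group_add)"
  by (metis add.inverse_unique add.left_inverse add.right_inverse minus_minus)

lemma conj_sum_list: "(e :: 'g::group_add) + sum_list xs - e = sum_list (map (\<lambda>x. e + x - e) xs)"
proof (induction xs)
  case (Cons x xs)
  have "e + (x + sum_list xs) - e = (e + x - e) + (e + sum_list xs - e)"
    by (simp add: add.assoc diff_conv_add_uminus del: add_uminus_conv_diff)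
  then show ?case using Cons by simp
qed simp

lemma uminus_sum_list_rev: "- sum_list xs = sum_list (map uminus (rev (xs :: 'g::group_add list)))"
  by (induction xs) (simp_all add: minus_add)

text \<open>An internal free product of subgroups of one ambient group;
  \<open>reduced_nonzero\<close> is the normal form theorem in the shape that building discs calls
  for.\<close>

locale free_product_sum =
  fixes I :: "'i set" and A :: "'i \<Rightarrow> 'g::group_add set"
  assumes I_nonempty: "I \<noteq> {}"
    and A_0: "\<alpha> \<in> I \<Longrightarrow> 0 \<in> A \<alpha>"
    and A_add: "\<alpha> \<in> I \<Longrightarrow> g \<in> A \<alpha> \<Longrightarrow> h \<in> A \<alpha> \<Longrightarrow> g + h \<in> A \<alpha>"
    and A_uminus: "\<alpha> \<in> I \<Longrightarrow> g \<in> A \<alpha> \<Longrightarrow> - g \<in> A \<alpha>"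
    and reduced_nonzero: "w \<noteq> [] \<Longrightarrow> (\<And>\<alpha> g. (\<alpha>, g) \<in> set w \<Longrightarrow> \<alpha> \<in> I \<and> g \<in> A \<alpha> \<and> g \<noteq> 0) \<Longrightarrow>
      successively (\<lambda>s t. fst s \<noteq> fst t) w \<Longrightarrow> sum_list (map snd w) \<noteq> 0"
    and torsion_free: "\<alpha> \<in> I \<Longrightarrow> g \<in> A \<alpha> \<Longrightarrow> g \<noteq> 0 \<Longrightarrow> n > 0 \<Longrightarrow> sum_list (replicate n g) \<noteq> 0"
begin

section \<open>Words in the subgroups and the disc of a trivial word\<close>

definition word :: "('i \<times> 'g) list \<Rightarrow> bool"
  where "word w \<longleftrightarrow> (\<forall>p\<in>set w. fst p \<in> I \<and> snd p \<in> A (fst p) \<and> snd p \<noteq> 0)"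

definition elts :: "'g set"
  where "elts = {word_val w | w. word w}"

lemma word_simps [simp]:
  "word []" "word (u @ v) \<longleftrightarrow> word u \<and> word v"
  "word (p # u) \<longleftrightarrow> fst p \<in> I \<and> snd p \<in> A (fst p) \<and> snd p \<noteq> 0 \<and> word u"
  by (auto simp: word_def)

lemma word_inv_word [simp]: "word (word_inv w) \<longleftrightarrow> word w"
proof -
  have "word w \<Longrightarrow> word (word_inv w)" for w by (induction w) (auto simp: A_uminus)
  from this[of w] this[of "word_inv w"] show ?thesis by auto
qed

lemma word_concat: "word (concat ws) \<longleftrightarrow> (\<forall>w\<in>set ws. word w)"
  by (induction ws) auto

lemma elts_I: "word w \<Longrightarrow> word_val w \<in> elts"
  by (auto simp: elts_def)

lemma elts_0: "0 \<in> elts" using elts_I[of "[]"] by simp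

lemma elts_add: "a \<in> elts \<Longrightarrow> b \<in> elts \<Longrightarrow> a + b \<in> elts"
proof -
  assume "a \<in> elts" "b \<in> elts"
  then obtain u v where "word u" "word v" "a = word_val u" "b = word_val v" by (auto simp: elts_def)
  then show ?thesis using elts_I[of "u @ v"] by simp
qed

lemma elts_uminus: "a \<in> elts \<Longrightarrow> - a \<in> elts"
proof -
  assume "a \<in> elts"
  then obtain u where "word u" "a = word_val u" by (auto simp: elts_def)
  then show ?thesis using elts_I[of "word_inv u"] by simp
qed

lemma elts_diff: "a \<in> elts \<Longrightarrow> b \<in> elts \<Longrightarrow> a - b \<in> elts"
  using elts_add[of a "- b"] elts_uminus by simp

text \<open>A disc diagram built by undoing a reduction: a trivial nonempty word has neighbouring
  letters from one factor, merging or cancelling them shortens it, and the reverse moves are free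
  surgeries.\<close>

lemma realisable_word:
  assumes "word w" "w \<noteq> []" "word_val w = 0"
  shows "realisable [w] (- 1)"
  using assms
proof (induction "length w" arbitrary: w rule: less_induct)
  case less
  have "\<not> successively (\<lambda>s t. fst s \<noteq> fst t) w"
  proof
    assume "successively (\<lambda>s t. fst s \<noteq> fst t) w"
    then have "sum_list (map snd w) \<noteq> 0"
      by (rule reduced_nonzero[rotated 2]) (use less.prems in \<open>auto simp: word_def\<close>)
    then show False using less.prems by simp
  qed
  then obtain i where i: "Suc i < length w" "fst (w ! i) = fst (w ! Suc i)"
    by (auto simp: successively_conv_nth)
  let ?u = "take i w" and ?v = "drop (Suc (Suc i)) w"
  have w: "w = ?u @ w ! i # w ! Suc i # ?v"
    using i by (metis Cons_nth_drop_Suc Suc_lessD append_take_drop_id)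
  define \<alpha> g h where "\<alpha> = fst (w ! i)" and "g = snd (w ! i)" and "h = snd (w ! Suc i)"
  have wi: "w ! i = (\<alpha>, g)" "w ! Suc i = (\<alpha>, h)" using i(2) by (simp_all add: \<alpha>_def g_def h_def prod_eq_iff)
  define t where "t = ?v @ ?u"
  have w': "w = ?u @ (\<alpha>, g) # (\<alpha>, h) # ?v" using w wi by simp
  have len: "length t + 2 = length w" using i(1) by (simp add: t_def)
  have "word (?u @ (\<alpha>, g) # (\<alpha>, h) # ?v)" using less.prems(1) w' by simp
  then have wt: "word t" "\<alpha> \<in> I" "g \<in> A \<alpha>" "h \<in> A \<alpha>" "g \<noteq> 0" "h \<noteq> 0" by (simp_all add: t_def)
  have "word_val (?u @ (\<alpha>, g) # (\<alpha>, h) # ?v) = 0" using less.prems(3) w' by simp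
  then have "word_val ?u + (g + h + word_val ?v) = 0" by (simp add: add.assoc)
  \<comment> \<open>Rotating a sum equal to 0 keeps it 0; the word is rotated because the surgeries
    act at its front.\<close>
  then have "(g + h + word_val ?v) + word_val ?u = 0" by (simp only: add_eq_0_commute)
  then have val: "g + h + word_val t = 0" by (simp add: t_def add.assoc)
  have "realisable [(\<alpha>, g) # (\<alpha>, h) # t] (- 1)"
  proof (cases "g + h = 0")
    case True
    then have h: "h = - g" by (metis add.inverse_unique)
    show ?thesis
    proof (cases "t = []")
      case True
      then show ?thesis using h realisable_base by simp
    next
      case False
      have "realisable [t] (- 1)"
        by (rule less.hyps) (use len wt False val True in simp_all)
      then show ?thesis unfolding h by (rule realisable_insert_pair)
    qed
  next
    case False
    have "realisable [(\<alpha>, g + h) # t] (- 1)"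
      by (rule less.hyps) (use len wt False val A_add in simp_all)
    then show ?thesis by (rule realisable_split_letter)
  qed
  then have "realisable [((\<alpha>, g) # (\<alpha>, h) # ?v) @ ?u] (- 1)" by (simp add: t_def)
  then have "realisable [?u @ ((\<alpha>, g) # (\<alpha>, h) # ?v)] (- 1)" by (rule realisable_rotate)
  then show ?case using w' by simp
qed

definition letter_word :: "'i \<Rightarrow> 'g \<Rightarrow> ('i \<times> 'g) list"
  where "letter_word \<alpha> g = (if g = 0 then [] else [(\<alpha>, g)])"

lemma letter_word [simp]:
  "word_val (letter_word \<alpha> g) = g" "length (letter_word \<alpha> g) \<le> 1"
  "\<alpha> \<in> I \<Longrightarrow> g \<in> A \<alpha> \<Longrightarrow> word (letter_word \<alpha> g)"
  by (auto simp: letter_word_def)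

definition cyclically_reduced :: "('i \<times> 'g) list \<Rightarrow> bool"
  where "cyclically_reduced x \<longleftrightarrow> (\<forall>i<length x. fst (x ! (Suc i mod length x)) \<noteq> fst (x ! i))"

lemma cyclic_reduction:
  assumes "word w"
  shows "\<exists>e x. word e \<and> word x \<and> word_val w = - word_val e + word_val x + word_val e \<and>
    (length x \<le> 1 \<or> cyclically_reduced x)"
  using assms
proof (induction "length w" arbitrary: w rule: less_induct)
  case less
  show ?case
  proof (cases "length w \<le> 1 \<or> cyclically_reduced w")
    case True
    then show ?thesis using less.prems by (intro exI[of _ "[]"] exI[of _ w]) simp
  next
    case False
    then obtain i where i: "i < length w" "fst (w ! (Suc i mod length w)) = fst (w ! i)"
      by (auto simp: cyclically_reduced_def)
    show ?thesis
    proof (cases "Suc i < length w")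
      case True
      let ?u = "take i w" and ?v = "drop (Suc (Suc i)) w"
      define \<alpha> g h where "\<alpha> = fst (w ! i)" and "g = snd (w ! i)" and "h = snd (w ! Suc i)"
      have wi: "w ! i = (\<alpha>, g)" "w ! Suc i = (\<alpha>, h)"
        using i(2) True by (simp_all add: \<alpha>_def g_def h_def prod_eq_iff)
      have w: "w = ?u @ (\<alpha>, g) # (\<alpha>, h) # ?v"
        using True wi by (metis Cons_nth_drop_Suc Suc_lessD append_take_drop_id)
      let ?w = "?u @ letter_word \<alpha> (g + h) @ ?v"
      have *: "word (?u @ (\<alpha>, g) # (\<alpha>, h) # ?v)" using less.prems w by simp
      have "word_val (?u @ (\<alpha>, g) # (\<alpha>, h) # ?v) = word_val ?w" by (simp add: add.assoc)
      then have "word_val w = word_val ?w" using w by simp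
      moreover have "length ?w < length w"
        using True letter_word(2)[of \<alpha> "g + h"] by simp
      moreover have "word ?w" using * A_add by simp
      ultimately show ?thesis using less.hyps[of ?w] by simp
    next
      \<comment> \<open>The repeated factor is that of the last and the first letter; conjugating by
        the last letter brings the two together.\<close>
      case F: False
      then have n: "Suc i = length w" using i by simp
      then have "fst (w ! 0) = fst (w ! i)" using i by simp
      moreover have "2 \<le> length w" using False by simp
      moreover obtain a v where av: "w = a # v" using calculation(2) by (cases w) auto
      moreover obtain v' b where vb: "v = v' @ [b]" using calculation(2) av by (cases v rule: rev_cases) auto
      ultimately have fab: "fst a = fst b" using n by (simp add: nth_append)
      define \<alpha> g h where "\<alpha> = fst a" and "g = snd b" and "h = snd a"
      have w: "w = (\<alpha>, h) # v' @ [(\<alpha>, g)]" using av vb fab by (simp add: \<alpha>_def g_def h_def prod_eq_iff)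
      let ?w = "letter_word \<alpha> (g + h) @ v'"
      have "length ?w < length w" unfolding w using letter_word(2)[of \<alpha> "g + h"] by simp
      moreover have "word ?w" using less.prems A_add unfolding w by simp
      ultimately obtain e x where ex: "word e" "word x"
        "word_val ?w = - word_val e + word_val x + word_val e" "length x \<le> 1 \<or> cyclically_reduced x"
        using less.hyps[of ?w] by blast
      have "word_val w = - g + word_val ?w + g" unfolding w by (simp add: add.assoc)
      also have "\<dots> = - word_val (e @ [(\<alpha>, g)]) + word_val x + word_val (e @ [(\<alpha>, g)])"
        unfolding ex(3) by (simp add: add.assoc minus_add diff_conv_add_uminus del: add_uminus_conv_diff)
      finally have "word_val w = \<dots>" .
      moreover have "word (e @ [(\<alpha>, g)])" using ex(1) less.prems unfolding w by simp
      ultimately show ?thesis using ex(2,4) by blast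
    qed
  qed
qed

theorem multiplicity_bound:
  assumes c: "\<And>x. x \<in> set c \<Longrightarrow> \<exists>a\<in>elts. \<exists>b\<in>elts. x = - a - b + a + b"
    and d: "\<And>x. x \<in> set d \<Longrightarrow> \<exists>\<alpha>\<in>I. \<exists>g\<in>A \<alpha>. \<exists>z\<in>elts. x = - z + g + z"
    and h: "set h \<subseteq> elts" "\<And>x y. x \<in> set h \<Longrightarrow> y \<in> set h \<Longrightarrow> \<exists>z\<in>elts. y = - z + x + z"
    and hyp: "\<And>x \<alpha> g z. x \<in> set h \<Longrightarrow> \<alpha> \<in> I \<Longrightarrow> g \<in> A \<alpha> \<Longrightarrow> z \<in> elts \<Longrightarrow> x \<noteq> - z + g + z"
    and eq: "sum_list (c @ d) = sum_list h" and x0: "x0 \<in> set h"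
  shows "int (count_list h x0) \<le> 2 * int (length c) + int (length d) - 1"
proof -
  obtain w0 where w0: "word w0" "x0 = word_val w0" using h(1) x0 by (auto simp: elts_def)
  obtain e x where ex: "word e" "word x" "x0 = - word_val e + word_val x + word_val e"
    and red: "length x \<le> 1 \<or> cyclically_reduced x"
    using cyclic_reduction[OF w0(1)] w0(2) by metis
  let ?e = "word_val e"
  have eE: "?e \<in> elts" using ex elts_I by blast
  have len: "length x > 1"
  proof (rule ccontr)
    assume "\<not> length x > 1"
    then consider "x = []" | p where "x = [p]" by (cases x) auto
    then show False
    proof cases
      case 1
      \<comment> \<open>An empty \<open>x\<close> makes \<open>x0\<close> trivial, hence conjugate
        to the neutral element of any factor.\<close>
      obtain \<alpha> where "\<alpha> \<in> I" using I_nonempty by blast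
      then show False using hyp[OF x0 _ A_0 eE] ex(3) 1 by simp
    next
      case 2
      then show False using hyp[OF x0 _ _ eE, of "fst p" "snd p"] ex by simp
    qed
  qed
  then have cyc: "cyclically_reduced x" and xne: "x \<noteq> []" using red by auto
  \<comment> \<open>Everything is conjugated by \<open>?e\<close>: then \<open>x0\<close> becomes
    the value of \<open>x\<close> and its block is literally \<open>x\<close>, with empty
    conjugator, by which its occurrences are recognised later.\<close>
  have "\<exists>E. word E \<and> ?e + y - ?e = word_val (word_inv E @ x @ E) \<and> (y = x0 \<longrightarrow> E = [])"
    if y: "y \<in> set h" for y
  proof (cases "y = x0")
    case True
    then have "?e + y - ?e = word_val x" unfolding ex(3) by (simp add: add.assoc[symmetric])
    then show ?thesis by (intro exI[of _ "[]"]) simp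
  next
    case False
    obtain z where z: "z \<in> elts" "y = - z + x0 + z" using h(2)[OF x0 y] by blast
    have "?e + z - ?e \<in> elts" using z(1) eE elts_add elts_diff by blast
    then obtain E where E: "word E" "?e + z - ?e = word_val E" by (auto simp: elts_def)
    have "?e + y - ?e = - (?e + z - ?e) + word_val x + (?e + z - ?e)"
      unfolding z(2) ex(3) by (simp add: add.assoc minus_add diff_conv_add_uminus del: add_uminus_conv_diff)
    then have "?e + y - ?e = word_val (word_inv E @ x @ E)" unfolding E(2) by (simp add: add.assoc)
    then show ?thesis using E(1) False by blast
  qed
  then obtain E where E: "\<And>y. y \<in> set h \<Longrightarrow> word (E y) \<and> ?e + y - ?e = word_val (word_inv (E y) @ x @ E y) \<and>
      (y = x0 \<longrightarrow> E y = [])"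
    by metis
  have "\<exists>p. word (fst p) \<and> word (snd p) \<and>
      ?e + - y - ?e = word_val (word_inv (fst p) @ word_inv (snd p) @ fst p @ snd p)"
    if y: "y \<in> set c" for y
  proof -
    obtain a b where ab: "a \<in> elts" "b \<in> elts" "y = - a - b + a + b" using c[OF y] by blast
    have "?e + b - ?e \<in> elts" "?e + a - ?e \<in> elts" using ab eE elts_add elts_diff by blast+
    then obtain u v where u: "word u" "?e + b - ?e = word_val u" and v: "word v" "?e + a - ?e = word_val v"
      by (auto simp: elts_def)
    \<comment> \<open>The inverse of the commutator of \<open>a\<close> and \<open>b\<close> is that
      of \<open>b\<close> and \<open>a\<close>, so \<open>u\<close> comes from
      \<open>b\<close>.\<close>
    have "?e + - y - ?e = - (?e + b - ?e) + (- (?e + a - ?e) + ((?e + b - ?e) + (?e + a - ?e)))"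
      unfolding ab(3) by (simp add: add.assoc minus_add diff_conv_add_uminus del: add_uminus_conv_diff)
    then have "?e + - y - ?e = word_val (word_inv u @ word_inv v @ u @ v)"
      unfolding u(2) v(2) by (simp add: add.assoc)
    then show ?thesis using u v by (intro exI[of _ "(u, v)"]) simp
  qed
  then obtain P where P: "\<And>y. y \<in> set c \<Longrightarrow> word (fst (P y)) \<and> word (snd (P y)) \<and>
      ?e + - y - ?e = word_val (word_inv (fst (P y)) @ word_inv (snd (P y)) @ fst (P y) @ snd (P y))"
    by metis
  have "\<exists>v. word v \<and> (v = [] \<or> (\<exists>f p. v = word_inv f @ [p] @ f)) \<and> ?e + - y - ?e = word_val v"
    if y: "y \<in> set d" for y
  proof -
    obtain \<alpha> g z where z: "\<alpha> \<in> I" "g \<in> A \<alpha>" "z \<in> elts" "y = - z + g + z" using d[OF y] by blast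
    show ?thesis
    proof (cases "g = 0")
      case True
      then show ?thesis using z by (intro exI[of _ "[]"]) simp
    next
      case False
      have "z - ?e \<in> elts" using z eE elts_diff by blast
      then obtain f where f: "word f" "z - ?e = word_val f" by (auto simp: elts_def)
      have "?e + - y - ?e = - (z - ?e) + (- g + (z - ?e))"
        unfolding z(4) by (simp add: add.assoc minus_add diff_conv_add_uminus del: add_uminus_conv_diff)
      then have "?e + - y - ?e = word_val (word_inv f @ [(\<alpha>, - g)] @ f)"
        unfolding f(2) by (simp add: add.assoc)
      moreover have "word (word_inv f @ [(\<alpha>, - g)] @ f)" using f z False A_uminus by simp
      ultimately show ?thesis by blast
    qed
  qed
  then obtain W where W: "\<And>y. y \<in> set d \<Longrightarrow> word (W y) \<and> (W y = [] \<or> (\<exists>f p. W y = word_inv f @ [p] @ f)) \<and>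
      ?e + - y - ?e = word_val (W y)"
    by metis
  \<comment> \<open>The relation is read as \<open>h\<close> followed by the inverses of
    \<open>d\<close> and \<open>c\<close>, hence the reversed lists.\<close>
  let ?blk = "\<lambda>E. word_inv E @ x @ E" and ?com = "\<lambda>(a, b). word_inv a @ word_inv b @ a @ b"
  let ?H = "concat (map ?blk (map E h))" and ?D = "concat (map W (rev d))"
    and ?C = "concat (map ?com (map P (rev c)))"
  have val_concat: "word_val (concat ws) = sum_list (map word_val ws)" for ws :: "('i \<times> 'g) list list"
    by (induction ws) simp_all
  have H: "word_val ?H = ?e + sum_list h - ?e"
    unfolding val_concat conj_sum_list map_map by (intro arg_cong[of _ _ sum_list] map_cong) (use E in auto)
  have D: "word_val ?D = ?e + - sum_list d - ?e"
    unfolding uminus_sum_list_rev val_concat conj_sum_list map_map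
    by (intro arg_cong[of _ _ sum_list] map_cong) (use W in auto)
  have Cc: "word_val ?C = ?e + - sum_list c - ?e"
    unfolding uminus_sum_list_rev val_concat conj_sum_list map_map
    by (intro arg_cong[of _ _ sum_list] map_cong) (use P in \<open>auto simp: split_def\<close>)
  have "word_val (?H @ ?D @ ?C) = (?e + sum_list h - ?e) + ((?e + - sum_list d - ?e) + (?e + - sum_list c - ?e))"
    unfolding map_append sum_list_append H D Cc ..
  also have "\<dots> = 0"
    unfolding eq[symmetric] sum_list_append
    by (simp add: add.assoc minus_add diff_conv_add_uminus del: add_uminus_conv_diff)
  finally have val0: "word_val (?H @ ?D @ ?C) = 0" .
  have wordW: "word (?H @ ?D @ ?C)"
    using E W P ex(2) by (auto simp: word_concat split_def)
  \<comment> \<open>Rotating to an occurrence of \<open>x0\<close> will make the boundary start with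
    \<open>x\<close>, the initial power from which copies are collected.\<close>
  obtain h1 h2 where h12: "h = h1 @ x0 # h2" using x0 by (meson split_list)
  have Ex0: "E x0 = []" using E[OF x0] by blast
  have Hne: "?H \<noteq> []" unfolding h12 using xne by simp
  have "realisable [?H @ ?D @ ?C] (- 1)" by (rule realisable_word[OF wordW _ val0]) (use Hne in simp)
  then have "realisable [(?H @ ?D) @ ?C] (- 1)" by simp
  then have "realisable [?H @ ?D] (- 1 + 2 * int (length (map P (rev c))))"
    by (rule realisable_commutators) (use Hne in simp)
  then have "realisable [?H] (- 1 + 2 * int (length (map P (rev c))) + int (length (map W (rev d))))"
    by (rule realisable_elliptics) (use Hne W in auto)
  then have RZH: "realisable [?H] (2 * int (length c) + int (length d) - 1)" by (simp add: algebra_simps)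
  let ?es = "map E (h2 @ h1)"
  let ?n = "length (filter (\<lambda>e. e = []) ?es)" and ?k = "length (filter (\<lambda>e. e \<noteq> []) ?es)"
  let ?\<delta> = "2 * int (length c) + int (length d) - 1"
  have "realisable [concat (map ?blk (map E h1)) @ (x @ concat (map ?blk (map E h2)))] ?\<delta>"
    using RZH unfolding h12 by (simp add: Ex0)
  then have "realisable [(x @ concat (map ?blk (map E h2))) @ concat (map ?blk (map E h1))] ?\<delta>"
    by (rule realisable_rotate)
  then have "realisable [concat (replicate (Suc 0) x) @ concat (map ?blk ?es)] ?\<delta>" by simp
  from realisable_conjugates[OF xne this]
  have RZF: "realisable (concat (replicate (Suc 0 + ?n) x) # replicate ?k x) (?\<delta> + int ?k)" by simp
  \<comment> \<open>The total exponent comes from the leading power \<open>1 + ?n\<close> and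
    \<open>?k\<close> single copies; each of these also cost one cut, so \<open>?k\<close>
    cancels.\<close>
  have "int (Suc 0 + ?n + ?k) \<le> ?\<delta> + int ?k"
  proof (rule realisable_bound[OF RZF _ xne])
    show "\<exists>j. w = concat (replicate j x)"
      if "w \<in> set (concat (replicate (Suc 0 + ?n) x) # replicate ?k x)" for w
    proof (cases "w = x")
      case True
      then show ?thesis by (intro exI[of _ 1]) simp
    next
      case False
      then have "w = concat (replicate (Suc 0 + ?n) x)"
        using that in_set_replicate[of w ?k x] unfolding list.set(2) insert_iff by blast
      then show ?thesis by blast
    qed
    have lr: "length (concat (replicate j x)) = j * length x" for j by (induction j) simp_all
    show "length (concat (concat (replicate (Suc 0 + ?n) x) # replicate ?k x)) = (Suc 0 + ?n + ?k) * length x"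
      unfolding concat.simps length_append lr by (simp add: algebra_simps)
    show "fst (x ! (Suc i mod length x)) \<noteq> fst (x ! i)" if "i < length x" for i
      using cyc that by (simp add: cyclically_reduced_def)
    show "sum_list (replicate n (snd (x ! i))) \<noteq> 0" if "i < length x" "n > 0" for i n
    proof -
      have "x ! i \<in> set x" using that by simp
      then show ?thesis using ex(2) torsion_free[of "fst (x ! i)" "snd (x ! i)" n] that by (auto simp: word_def)
    qed
  qed simp
  moreover have "count_list h x0 \<le> Suc 0 + ?n"
  proof -
    have "count_list hs x0 \<le> length (filter (\<lambda>e. e = []) (map E hs))" for hs
      by (induction hs) (auto simp: Ex0)
    from this[of h1] this[of h2] show ?thesis unfolding h12 by simp
  qed
  ultimately show ?thesis by linarith
qed

end

section \<open>Free products as groups of bijections\<close>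

text \<open>
  The Cayley embedding into a type of class \<open>group_add\<close> (which need not be commutative) disposes of
  carrier sets.
\<close>

typedef 'a sym = "{f :: 'a \<Rightarrow> 'a. bij f}"
  by (rule exI[of _ id]) simp

setup_lifting type_definition_sym

instantiation sym :: (type) group_add
begin

lift_definition zero_sym :: "'a sym" is id by simp
lift_definition plus_sym :: "'a sym \<Rightarrow> 'a sym \<Rightarrow> 'a sym" is "(\<circ>)" by (simp add: bij_comp)
lift_definition uminus_sym :: "'a sym \<Rightarrow> 'a sym" is "inv_into UNIV" by (simp add: bij_imp_bij_inv)
definition minus_sym :: "'a sym \<Rightarrow> 'a sym \<Rightarrow> 'a sym" where "minus_sym f g = f + - g"

instance
proof
  fix a b c :: "'a sym"
  show "a + b + c = a + (b + c)" by transfer (simp add: comp_assoc)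
  show "0 + a = a" "a + 0 = a" by (transfer, simp)+
  show "- a + a = 0" by transfer (simp add: bij_is_inj)
  show "a + - b = a - b" by (simp add: minus_sym_def)
qed

end

text \<open>Extending the translation by the identity outside the carrier makes it a bijection of
  the whole type.\<close>

definition cayley :: "('a, 'b) monoid_scheme \<Rightarrow> 'a \<Rightarrow> 'a sym"
  where "cayley H g = Abs_sym (\<lambda>v. if v \<in> carrier H then g \<otimes>\<^bsub>H\<^esub> v else v)"

context group
begin

lemma Rep_cayley:
  assumes "g \<in> carrier G"
  shows "Rep_sym (cayley G g) = (\<lambda>v. if v \<in> carrier G then g \<otimes> v else v)"
proof -
  have "bij (\<lambda>v. if v \<in> carrier G then g \<otimes> v else v)"
  proof (rule o_bij)
    show "(\<lambda>v. if v \<in> carrier G then inv g \<otimes> v else v) \<circ> (\<lambda>v. if v \<in> carrier G then g \<otimes> v else v) = id"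
      using assms by (auto simp: fun_eq_iff m_assoc[symmetric])
    show "(\<lambda>v. if v \<in> carrier G then g \<otimes> v else v) \<circ> (\<lambda>v. if v \<in> carrier G then inv g \<otimes> v else v) = id"
      using assms by (auto simp: fun_eq_iff m_assoc[symmetric])
  qed
  then show ?thesis by (simp add: cayley_def Abs_sym_inverse)
qed

lemma cayley_mult:
  assumes "g \<in> carrier G" "h \<in> carrier G"
  shows "cayley G (g \<otimes> h) = cayley G g + cayley G h"
  using assms
  by (auto simp: Rep_sym_inject[symmetric] plus_sym.rep_eq Rep_cayley fun_eq_iff m_assoc)

lemma cayley_one: "cayley G \<one> = 0"
  by (auto simp: Rep_sym_inject[symmetric] zero_sym.rep_eq Rep_cayley fun_eq_iff)

lemma cayley_inv:
  assumes "g \<in> carrier G"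
  shows "cayley G (inv g) = - cayley G g"
  using cayley_mult[of "inv g" g] assms by (simp add: cayley_one eq_neg_iff_add_eq_0)

lemma cayley_inj: "inj_on (cayley G) (carrier G)"
proof (rule inj_onI)
  fix g h assume gh: "g \<in> carrier G" "h \<in> carrier G" "cayley G g = cayley G h"
  then have "Rep_sym (cayley G g) \<one> = Rep_sym (cayley G h) \<one>" by simp
  then show "g = h" using gh(1,2) by (simp add: Rep_cayley)
qed

lemma cayley_eq_0_iff: "g \<in> carrier G \<Longrightarrow> cayley G g = 0 \<longleftrightarrow> g = \<one>"
  using inj_onD[OF cayley_inj, of g \<one>] by (auto simp: cayley_one)

lemma group_product_closed: "set xs \<subseteq> carrier G \<Longrightarrow> group_product G xs \<in> carrier G"
  by (induction xs) (auto simp: group_product_def)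

lemma cayley_group_product:
  "set xs \<subseteq> carrier G \<Longrightarrow> cayley G (group_product G xs) = sum_list (map (cayley G) xs)"
proof (induction xs)
  case (Cons x xs)
  then show ?case using group_product_closed[of xs] by (simp add: group_product_def cayley_mult)
qed (simp add: group_product_def cayley_one)

end

section \<open>Transfer of the free product and its factors\<close>

locale torsion_free_family = group_family I G
  for I :: "'i set" and G :: "'i \<Rightarrow> ('a, 'b) monoid_scheme" +
  assumes nonempty: "I \<noteq> {}"
    and torsion_free_G: "\<alpha> \<in> I \<Longrightarrow> torsion_free_group (G \<alpha>)"
begin

sublocale F: group "free_product I G" by (rule group_free_product)

abbreviation J :: "('i \<times> 'a) list \<Rightarrow> ('i \<times> 'a) list sym"
  where "J \<equiv> cayley (free_product I G)"

lemma J_mult: "u \<in> reduced_words I G \<Longrightarrow> v \<in> reduced_words I G \<Longrightarrow>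
    J (u \<otimes>\<^bsub>free_product I G\<^esub> v) = J u + J v"
  by (rule F.cayley_mult) simp_all

lemma J_factor_mult:
  assumes "\<alpha> \<in> I" "g \<in> carrier (G \<alpha>)" "h \<in> carrier (G \<alpha>)"
  shows "J (factor_embedding G \<alpha> (g \<otimes>\<^bsub>G \<alpha>\<^esub> h)) = J (factor_embedding G \<alpha> g) + J (factor_embedding G \<alpha> h)"
proof -
  have hom: "factor_embedding G \<alpha> \<in> hom (G \<alpha>) (free_product I G)"
    using factor_embedding_hom[OF assms(1)] .
  show ?thesis
    unfolding hom_mult[OF hom assms(2,3)]
    by (rule F.cayley_mult) (use hom_in_carrier[OF hom] assms in blast)+
qed

lemma factor_embedding_closed:
  "\<alpha> \<in> I \<Longrightarrow> g \<in> carrier (G \<alpha>) \<Longrightarrow> factor_embedding G \<alpha> g \<in> carrier (free_product I G)"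
  using hom_in_carrier[OF factor_embedding_hom] by blast

lemma J_reduced_word:
  assumes "w \<in> reduced_words I G"
  shows "J w = word_val (map (\<lambda>(\<alpha>, g). (\<alpha>, J [(\<alpha>, g)])) w)"
  using assms
proof (induction w)
  case Nil
  show ?case using F.cayley_one by simp
next
  case (Cons p w)
  obtain \<alpha> g where p: "p = (\<alpha>, g)" by (cases p)
  have w: "w \<in> reduced_words I G" "[(\<alpha>, g)] \<in> reduced_words I G"
    using Cons.prems by (auto simp: p reduced_words_Cons)
  have "p # w = [(\<alpha>, g)] \<otimes>\<^bsub>free_product I G\<^esub> w"
    using syllable_mult_reduced[of \<alpha> g w I G] Cons.prems by (simp add: p)
  then have "J (p # w) = J [(\<alpha>, g)] + J w" using J_mult[OF w(2,1)] by simp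
  then show ?case using Cons.IH[OF w(1)] by (simp add: p)
qed

text \<open>The normal form property is inherent in the construction: a reduced word in the images
  is \<open>J\<close> of a list that is itself an element of the free product, and a nonempty list
  is not its identity.\<close>

sublocale S: free_product_sum I "\<lambda>\<alpha>. J ` free_factor G \<alpha>"
proof
  show "I \<noteq> {}" by (rule nonempty)
next
  fix \<alpha> assume \<alpha>: "\<alpha> \<in> I"
  interpret A: group "G \<alpha>" by (rule group_G) fact
  have "factor_embedding G \<alpha> \<one>\<^bsub>G \<alpha>\<^esub> = []" by (simp add: factor_embedding_def)
  then have J1: "J (factor_embedding G \<alpha> \<one>\<^bsub>G \<alpha>\<^esub>) = 0" using F.cayley_one by simp
  then show "0 \<in> J ` free_factor G \<alpha>" unfolding free_factor_def by (metis A.one_closed image_eqI)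
next
  fix \<alpha> g h assume \<alpha>: "\<alpha> \<in> I" and g: "g \<in> J ` free_factor G \<alpha>" and h: "h \<in> J ` free_factor G \<alpha>"
  interpret A: group "G \<alpha>" by (rule group_G) fact
  from g h obtain a b where "a \<in> carrier (G \<alpha>)" "b \<in> carrier (G \<alpha>)"
    "g = J (factor_embedding G \<alpha> a)" "h = J (factor_embedding G \<alpha> b)"
    by (auto simp: free_factor_def)
  then have "g + h = J (factor_embedding G \<alpha> (a \<otimes>\<^bsub>G \<alpha>\<^esub> b))" "a \<otimes>\<^bsub>G \<alpha>\<^esub> b \<in> carrier (G \<alpha>)"
    using J_factor_mult[OF \<alpha>] by auto
  then show "g + h \<in> J ` free_factor G \<alpha>" by (auto simp: free_factor_def)
next
  fix \<alpha> g assume \<alpha>: "\<alpha> \<in> I" and g: "g \<in> J ` free_factor G \<alpha>"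
  interpret A: group "G \<alpha>" by (rule group_G) fact
  from g obtain a where a: "a \<in> carrier (G \<alpha>)" "g = J (factor_embedding G \<alpha> a)"
    by (auto simp: free_factor_def)
  have "J (factor_embedding G \<alpha> (inv\<^bsub>G \<alpha>\<^esub> a)) + g = J (factor_embedding G \<alpha> \<one>\<^bsub>G \<alpha>\<^esub>)"
    using J_factor_mult[OF \<alpha>, of "inv\<^bsub>G \<alpha>\<^esub> a" a] a by simp
  also have "\<dots> = 0" using F.cayley_one by (simp add: factor_embedding_def)
  finally have "- J (factor_embedding G \<alpha> (inv\<^bsub>G \<alpha>\<^esub> a)) = g" by (rule minus_unique)
  then have "- g = J (factor_embedding G \<alpha> (inv\<^bsub>G \<alpha>\<^esub> a))" by auto
  then show "- g \<in> J ` free_factor G \<alpha>" using a by (auto simp: free_factor_def)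
next
  fix w :: "('i \<times> ('i \<times> 'a) list sym) list"
  assume w: "w \<noteq> []" "\<And>\<alpha> g. (\<alpha>, g) \<in> set w \<Longrightarrow> \<alpha> \<in> I \<and> g \<in> J ` free_factor G \<alpha> \<and> g \<noteq> 0"
    and succ: "successively (\<lambda>s t. fst s \<noteq> fst t) w"
  have "\<exists>a\<in>carrier (G (fst p)). a \<noteq> \<one>\<^bsub>G (fst p)\<^esub> \<and> snd p = J [(fst p, a)]" if p: "p \<in> set w" for p
  proof -
    have "fst p \<in> I" "snd p \<in> J ` free_factor G (fst p)" "snd p \<noteq> 0" using w(2)[of "fst p" "snd p"] p by auto
    then obtain a where a: "a \<in> carrier (G (fst p))" "snd p = J (factor_embedding G (fst p) a)"
      by (auto simp: free_factor_def)
    have "a \<noteq> \<one>\<^bsub>G (fst p)\<^esub>"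
      using a(2) \<open>snd p \<noteq> 0\<close> F.cayley_one by (auto simp: factor_embedding_def)
    then show ?thesis using a by (auto simp: factor_embedding_def)
  qed
  then obtain f where f: "\<And>p. p \<in> set w \<Longrightarrow> f p \<in> carrier (G (fst p)) \<and> f p \<noteq> \<one>\<^bsub>G (fst p)\<^esub> \<and> snd p = J [(fst p, f p)]"
    by metis
  let ?v = "map (\<lambda>p. (fst p, f p)) w"
  have v: "?v \<in> reduced_words I G"
    using f w(2) succ by (force simp: reduced_words_def successively_map)
  have "map (\<lambda>(\<alpha>, g). (\<alpha>, J [(\<alpha>, g)])) ?v = map id w"
    unfolding map_map by (rule map_cong) (use f in \<open>auto simp: prod_eq_iff\<close>)
  then have "sum_list (map snd w) = J ?v" using J_reduced_word[OF v] by simp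
  moreover have "J ?v \<noteq> 0" using F.cayley_eq_0_iff[of ?v] v w(1) by simp
  ultimately show "sum_list (map snd w) \<noteq> 0" by simp
next
  fix \<alpha> g and n :: nat
  assume \<alpha>: "\<alpha> \<in> I" and g: "g \<in> J ` free_factor G \<alpha>" "g \<noteq> 0" and n: "n > 0"
  interpret A: group "G \<alpha>" by (rule group_G) fact
  from g obtain a where a: "a \<in> carrier (G \<alpha>)" "g = J (factor_embedding G \<alpha> a)"
    by (auto simp: free_factor_def)
  have one: "J (factor_embedding G \<alpha> \<one>\<^bsub>G \<alpha>\<^esub>) = 0" using F.cayley_one by (simp add: factor_embedding_def)
  have pow: "sum_list (replicate k g) = J (factor_embedding G \<alpha> (a [^]\<^bsub>G \<alpha>\<^esub> k))" for k :: nat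
  proof (induction k)
    case (Suc k)
    have "replicate (Suc k) g = replicate k g @ [g]" by (simp add: replicate_append_same)
    then have "sum_list (replicate (Suc k) g) = sum_list (replicate k g) + g" by simp
    then show ?case using Suc J_factor_mult[OF \<alpha>, of "a [^]\<^bsub>G \<alpha>\<^esub> k" a] a by simp
  qed (simp add: one)
  have ne: "a [^]\<^bsub>G \<alpha>\<^esub> n \<noteq> \<one>\<^bsub>G \<alpha>\<^esub>"
    using torsion_free_G[OF \<alpha>] a n g(2) one unfolding torsion_free_group_def by blast
  have "factor_embedding G \<alpha> (a [^]\<^bsub>G \<alpha>\<^esub> n) \<noteq> []" using ne by (simp add: factor_embedding_def)
  moreover have "factor_embedding G \<alpha> (a [^]\<^bsub>G \<alpha>\<^esub> n) \<in> carrier (free_product I G)"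
    by (rule factor_embedding_closed) (use \<alpha> a in simp_all)
  ultimately show "sum_list (replicate n g) \<noteq> 0" unfolding pow using F.cayley_eq_0_iff by simp
qed

lemma elts_eq: "S.elts = J ` carrier (free_product I G)"
proof
  show "S.elts \<subseteq> J ` carrier (free_product I G)"
  proof
    fix x assume "x \<in> S.elts"
    then obtain w where w: "S.word w" "x = word_val w" by (auto simp: S.elts_def)
    have "word_val w \<in> J ` carrier (free_product I G)"
      using w(1)
    proof (induction w)
      case Nil
      then show ?case using F.cayley_one F.one_closed by (metis image_eqI list.simps(8) sum_list.Nil)
    next
      case (Cons p w)
      then obtain v where v: "v \<in> carrier (free_product I G)" "word_val w = J v" by auto
      obtain u where u: "u \<in> carrier (free_product I G)" "snd p = J u"
      proof -
        have "fst p \<in> I" "snd p \<in> J ` free_factor G (fst p)" using Cons.prems by simp_all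
        then show ?thesis using that factor_embedding_closed unfolding free_factor_def by blast
      qed
      have "word_val (p # w) = J (u \<otimes>\<^bsub>free_product I G\<^esub> v)"
        using F.cayley_mult[OF u(1) v(1)] u(2) v(2) by simp
      then show ?case using F.m_closed[OF u(1) v(1)] by blast
    qed
    then show "x \<in> J ` carrier (free_product I G)" using w by simp
  qed
  show "J ` carrier (free_product I G) \<subseteq> S.elts"
  proof
    fix x assume "x \<in> J ` carrier (free_product I G)"
    then obtain v where v: "v \<in> reduced_words I G" "x = J v" by auto
    let ?w = "map (\<lambda>(\<alpha>, g). (\<alpha>, J [(\<alpha>, g)])) v"
    have "S.word ?w"
      unfolding S.word_def
    proof
      fix p assume "p \<in> set ?w"
      then obtain \<alpha> g where p: "(\<alpha>, g) \<in> set v" "p = (\<alpha>, J [(\<alpha>, g)])" by auto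
      then have g: "\<alpha> \<in> I" "g \<in> carrier (G \<alpha>)" "g \<noteq> \<one>\<^bsub>G \<alpha>\<^esub>" using v by (auto simp: reduced_words_def)
      then have "[(\<alpha>, g)] = factor_embedding G \<alpha> g" by (simp add: factor_embedding_def)
      then have "[(\<alpha>, g)] \<in> free_factor G \<alpha>" using g by (auto simp: free_factor_def)
      moreover have "J [(\<alpha>, g)] \<noteq> 0" using F.cayley_eq_0_iff[of "[(\<alpha>, g)]"] g by (simp add: reduced_words_Cons)
      ultimately show "fst p \<in> I \<and> snd p \<in> J ` free_factor G (fst p) \<and> snd p \<noteq> 0" using g p by simp
    qed
    then show "x \<in> S.elts" using S.elts_I[of ?w] J_reduced_word[OF v(1)] v(2) by simp
  qed
qed

end

theorem corollary2:
  fixes I :: "'i set" and G :: "'i \<Rightarrow> ('a, 'b) monoid_scheme"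
    and k l m :: nat
    and c d h :: "('i \<times> 'a) list list"
  assumes "I \<noteq> {}"
    and "\<And>\<alpha>. \<alpha> \<in> I \<Longrightarrow> torsion_free_group (G \<alpha>)"
    and "m \<ge> 1"
    and "length c = k" and "length d = l" and "length h = m"
    and "set c \<subseteq> carrier (free_product I G)"
    and "set d \<subseteq> carrier (free_product I G)"
    and "set h \<subseteq> carrier (free_product I G)"
    and "group_product (free_product I G) (c @ d) = group_product (free_product I G) h"
    and "\<And>x. x \<in> set c \<Longrightarrow> is_commutator (free_product I G) x"
    and "\<And>x. x \<in> set d \<Longrightarrow> conjugate_into_factor I G x"
    and "\<And>x y. x \<in> set h \<Longrightarrow> y \<in> set h \<Longrightarrow> conjugate_in (free_product I G) x y"
    and "\<And>x. x \<in> set h \<Longrightarrow> \<not> conjugate_into_factor I G x"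
  shows "\<forall>x\<in>carrier (free_product I G). int (count_list h x) \<le> 2 * int k + int l - 1"
proof -
  interpret torsion_free_family I G
  proof (intro torsion_free_family.intro group_family.intro torsion_free_family_axioms.intro)
    show "group (G \<alpha>)" if "\<alpha> \<in> I" for \<alpha> using assms(2)[OF that] by (simp add: torsion_free_group_def)
  qed (fact assms(1), rule assms(2))
  let ?F = "free_product I G"
  have closed: "free_factor G \<alpha> \<subseteq> carrier ?F" if "\<alpha> \<in> I" for \<alpha>
    using that factor_embedding_closed by (auto simp: free_factor_def)
  have J_conj: "J (inv\<^bsub>?F\<^esub> z \<otimes>\<^bsub>?F\<^esub> x \<otimes>\<^bsub>?F\<^esub> z) = - J z + J x + J z"
    if "x \<in> carrier ?F" "z \<in> carrier ?F" for x z
    using that by (simp only: F.cayley_mult F.cayley_inv F.inv_closed F.m_closed)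
  have bound: "int (count_list h x) \<le> 2 * int k + int l - 1" if x: "x \<in> set h" for x
  proof -
    have "int (count_list (map J h) (J x)) \<le> 2 * int (length (map J c)) + int (length (map J d)) - 1"
    proof (rule S.multiplicity_bound)
      fix y assume "y \<in> set (map J c)"
      then obtain a where a: "a \<in> set c" "y = J a" by auto
      then obtain u v where uv: "u \<in> carrier ?F" "v \<in> carrier ?F"
        "a = inv\<^bsub>?F\<^esub> u \<otimes>\<^bsub>?F\<^esub> inv\<^bsub>?F\<^esub> v \<otimes>\<^bsub>?F\<^esub> u \<otimes>\<^bsub>?F\<^esub> v"
        using assms(11) unfolding is_commutator_def by blast
      have "J a = - J u - J v + J u + J v"
        unfolding uv(3) using uv(1,2)
        by (simp only: F.cayley_mult F.cayley_inv F.inv_closed F.m_closed diff_conv_add_uminus)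
      then show "\<exists>a\<in>S.elts. \<exists>b\<in>S.elts. y = - a - b + a + b"
        unfolding elts_eq a(2) using uv(1,2) by blast
    next
      fix y assume "y \<in> set (map J d)"
      then obtain a where a: "a \<in> set d" "y = J a" by auto
      have aF: "a \<in> carrier ?F" using a assms(8) by blast
      obtain \<alpha> g z where g: "\<alpha> \<in> I" "g \<in> free_factor G \<alpha>" "z \<in> carrier ?F"
        "g = inv\<^bsub>?F\<^esub> z \<otimes>\<^bsub>?F\<^esub> a \<otimes>\<^bsub>?F\<^esub> z"
        using assms(12)[OF a(1)] unfolding conjugate_into_factor_def conjugate_in_def by blast
      have "J g = - J z + J a + J z" unfolding g(4) by (rule J_conj) fact+
      then have "J a = J z + J g - J z" by (simp add: add.assoc)
      \<comment> \<open>The hypothesis conjugates \<open>a\<close> into the factor, while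
        \<open>multiplicity_bound\<close> takes \<open>a\<close> as a conjugate of a factor element,
        hence the inverse of \<open>z\<close>.\<close>
      then have "y = - J (inv\<^bsub>?F\<^esub> z) + J g + J (inv\<^bsub>?F\<^esub> z)"
        unfolding a(2) F.cayley_inv[OF g(3)] by simp
      moreover have "J (inv\<^bsub>?F\<^esub> z) \<in> S.elts" unfolding elts_eq using F.inv_closed[OF g(3)] by blast
      ultimately show "\<exists>\<alpha>\<in>I. \<exists>g\<in>J ` free_factor G \<alpha>. \<exists>z\<in>S.elts. y = - z + g + z"
        using g(1,2) by blast
    next
      show "set (map J h) \<subseteq> S.elts" unfolding elts_eq using assms(9) by auto
    next
      fix y y' assume "y \<in> set (map J h)" "y' \<in> set (map J h)"
      then obtain a b where ab: "a \<in> set h" "b \<in> set h" "y = J a" "y' = J b" by auto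
      obtain z where z: "z \<in> carrier ?F" "b = inv\<^bsub>?F\<^esub> z \<otimes>\<^bsub>?F\<^esub> a \<otimes>\<^bsub>?F\<^esub> z"
        using assms(13)[OF ab(1,2)] unfolding conjugate_in_def by blast
      have "J b = - J z + J a + J z" unfolding z(2) by (rule J_conj) (use ab z assms(9) in blast)+
      then show "\<exists>z\<in>S.elts. y' = - z + y + z" unfolding elts_eq ab(3,4) using z(1) by blast
    next
      fix y \<alpha> g z
      assume "y \<in> set (map J h)" and \<alpha>: "\<alpha> \<in> I" and "g \<in> J ` free_factor G \<alpha>" "z \<in> S.elts"
      then obtain a g' z' where a: "a \<in> set h" "y = J a" and g': "g' \<in> free_factor G \<alpha>" "g = J g'"
        and z': "z' \<in> carrier ?F" "z = J z'"
        unfolding elts_eq by auto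
      have aF: "a \<in> carrier ?F" and gF: "g' \<in> carrier ?F" using a assms(9) g' closed[OF \<alpha>] by blast+
      show "y \<noteq> - z + g + z"
      proof
        assume "y = - z + g + z"
        then have "J g' = - J (inv\<^bsub>?F\<^esub> z') + J a + J (inv\<^bsub>?F\<^esub> z')"
          unfolding a(2) g'(2) z'(2) F.cayley_inv[OF z'(1)] by (simp add: add.assoc)
        also have "\<dots> = J (inv\<^bsub>?F\<^esub> (inv\<^bsub>?F\<^esub> z') \<otimes>\<^bsub>?F\<^esub> a \<otimes>\<^bsub>?F\<^esub> inv\<^bsub>?F\<^esub> z')"
          by (rule J_conj[symmetric]) (use aF z' F.inv_closed in blast)+
        finally have "g' = inv\<^bsub>?F\<^esub> (inv\<^bsub>?F\<^esub> z') \<otimes>\<^bsub>?F\<^esub> a \<otimes>\<^bsub>?F\<^esub> inv\<^bsub>?F\<^esub> z'"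
          by (rule inj_onD[OF F.cayley_inj _ gF]) (intro F.m_closed F.inv_closed aF z')
        then have "conjugate_in ?F a g'"
          unfolding conjugate_in_def using F.inv_closed[OF z'(1)] by blast
        then show False
          using assms(14)[OF a(1)] \<alpha> g'(1) unfolding conjugate_into_factor_def by blast
      qed
    next
      have "set (c @ d) \<subseteq> carrier ?F" using assms(7,8) by simp
      then have "sum_list (map J (c @ d)) = J (group_product ?F (c @ d))"
        by (rule F.cayley_group_product[symmetric])
      also have "\<dots> = sum_list (map J h)"
        unfolding assms(10) by (rule F.cayley_group_product) fact
      finally show "sum_list (map J c @ map J d) = sum_list (map J h)" by simp
    next
      show "J x \<in> set (map J h)" using x by simp
    qed
    moreover have "count_list (map J h) (J x) = count_list h x"
      by (rule count_list_inj_map[OF inj_on_subset[OF F.cayley_inj assms(9)] x])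
    ultimately show ?thesis using assms(4,5) by simp
  qed
  \<comment> \<open>An element outside \<open>h\<close> occurs 0 times, so the right-hand side must
    be nonnegative; since \<open>m \<ge> 1\<close>, the bound at an entry of \<open>h\<close> shows
    this.\<close>
  obtain y where y: "y \<in> set h" using assms(3,6) by (cases h) auto
  then have "count_list h y > 0" by (metis count_list_0_iff gr0I)
  then have "0 \<le> 2 * int k + int l - 1" using bound[OF y] by linarith
  then show ?thesis using bound by (metis count_list_0_iff of_nat_0)
qed

end
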